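(* Let $k_1\geq 4$ be a fixed integer. The following decision problem is NP-complete: given a graph $G$ of order $n$, a $k_1$-subset $S$ of $V(G)$, and an integer $k_2$ with $2\leq k_2\leq n-1$, decide whether there are $k_2$ internally disjoint trees connecting $S$ in $G$, i.e., decide whether $\kappa(S)\geq k_2$.
   Context: All graphs are finite and simple. For a graph $G$ and a set $S\subseteq V(G)$, a tree connecting $S$ is a subtree of $G$ whose vertex set contains $S$. A collection $\{T_1,\ldots,T_\ell\}$ of trees in $G$ is an internally disjoint set of trees connecting $S$ if each $T_i$ is a tree connecting $S$, the trees are pairwise edge-disjoint, and $V(T_i)\cap V(T_j)=S$ for every pair of distinct $i,j$. $\kappa(S)$ denotes the maximum number $\ell$ of such internally disjoint trees connecting $S$. Here $k_1$ is fixed (not part of the input) while $G$, $S$ and $k_2$ are part of the input. *)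

theory Defs
  imports "HOL-Computational_Algebra.Polynomial"
begin

section \<open>Trees connecting a vertex set\<close>

type_synonym 'v graph = "'v set \<times> 'v set set"

definition simple_graph :: "'v graph \<Rightarrow> bool" where
  "simple_graph G \<longleftrightarrow> finite (fst G) \<and> (\<forall>e \<in> snd G. e \<subseteq> fst G \<and> card e = 2)"

definition connected_graph :: "'v graph \<Rightarrow> bool" where
  "connected_graph G \<longleftrightarrow>
     fst G \<noteq> {} \<and> (\<forall>u \<in> fst G. \<forall>v \<in> fst G. (u, v) \<in> {(x, y). {x, y} \<in> snd G}\<^sup>*)"

definition is_cycle :: "'v graph \<Rightarrow> 'v list \<Rightarrow> bool" where
  "is_cycle G c \<longleftrightarrow> 3 \<le> length c \<and> distinct c \<and>
     (\<forall>i < length c. {c ! i, c ! (Suc i mod length c)} \<in> snd G)"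

definition is_tree :: "'v graph \<Rightarrow> bool" where
  "is_tree T \<longleftrightarrow> simple_graph T \<and> connected_graph T \<and> (\<nexists>c. is_cycle T c)"

definition tree_connecting :: "'v graph \<Rightarrow> 'v set \<Rightarrow> 'v graph \<Rightarrow> bool" where
  "tree_connecting G S T \<longleftrightarrow>
     is_tree T \<and> fst T \<subseteq> fst G \<and> snd T \<subseteq> snd G \<and> S \<subseteq> fst T"

definition internally_disjoint_trees :: "'v graph \<Rightarrow> 'v set \<Rightarrow> 'v graph set \<Rightarrow> bool" where
  "internally_disjoint_trees G S \<T> \<longleftrightarrow>
     (\<forall>T \<in> \<T>. tree_connecting G S T) \<and>
     (\<forall>T \<in> \<T>. \<forall>T' \<in> \<T>. T \<noteq> T' \<longrightarrow> snd T \<inter> snd T' = {} \<and> fst T \<inter> fst T' = S)"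

definition kappa :: "'v graph \<Rightarrow> 'v set \<Rightarrow> nat" where
  "kappa G S = Max {card \<T> | \<T>. internally_disjoint_trees G S \<T>}"

lemma finite_edges: "simple_graph G \<Longrightarrow> finite (snd G)"
  unfolding simple_graph_def by (meson Pow_iff finite_Pow_iff finite_subset subsetI)

lemma internally_disjoint_trees_subset_Pow:
  "internally_disjoint_trees G S \<T> \<Longrightarrow> \<T> \<subseteq> Pow (fst G) \<times> Pow (snd G)"
  by (force simp: internally_disjoint_trees_def tree_connecting_def)

lemma finite_internally_disjoint_trees:
  assumes "simple_graph G" "internally_disjoint_trees G S \<T>"
  shows "finite \<T>"
proof (rule finite_subset[OF internally_disjoint_trees_subset_Pow[OF assms(2)]])
  show "finite (Pow (fst G) \<times> Pow (snd G))"
    using assms(1) finite_edges[OF assms(1)] by (simp add: simple_graph_def)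
qed

text \<open>The maximum is attained and families may be thinned out, so \<open>\<kappa>(S) \<ge> k\<close> says that
  there are \<open>k\<close> internally disjoint trees connecting \<open>S\<close>.\<close>

lemma le_kappa_iff:
  assumes "simple_graph G"
  shows "k \<le> kappa G S \<longleftrightarrow> (\<exists>\<T>. internally_disjoint_trees G S \<T> \<and> card \<T> = k)"
proof -
  let ?C = "{card \<T> | \<T>. internally_disjoint_trees G S \<T>}"
  have "finite {\<T>. internally_disjoint_trees G S \<T>}"
  proof (rule finite_subset)
    show "{\<T>. internally_disjoint_trees G S \<T>} \<subseteq> Pow (Pow (fst G) \<times> Pow (snd G))"
      using internally_disjoint_trees_subset_Pow by blast
    show "finite (Pow (Pow (fst G) \<times> Pow (snd G)))"
      using assms finite_edges[OF assms] by (simp add: simple_graph_def)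
  qed
  then have fin: "finite ?C" by simp
  have "internally_disjoint_trees G S {}"
    by (simp add: internally_disjoint_trees_def)
  then have ne: "?C \<noteq> {}" by blast
  show ?thesis
  proof
    assume k: "k \<le> kappa G S"
    have "kappa G S \<in> ?C" unfolding kappa_def using fin ne by (rule Max_in)
    then obtain \<T> where \<T>: "internally_disjoint_trees G S \<T>" "card \<T> = kappa G S" by auto
    obtain \<U> where \<U>: "\<U> \<subseteq> \<T>" "card \<U> = k"
      using k \<T>(2) by (metis obtain_subset_with_card_n)
    have "internally_disjoint_trees G S \<U>"
      using \<T>(1) \<U>(1) unfolding internally_disjoint_trees_def by (meson subsetD)
    then show "\<exists>\<T>. internally_disjoint_trees G S \<T> \<and> card \<T> = k" using \<U>(2) by blast
  next
    assume "\<exists>\<T>. internally_disjoint_trees G S \<T> \<and> card \<T> = k"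
    then show "k \<le> kappa G S" unfolding kappa_def using fin by (intro Max_ge) auto
  qed
qed


section \<open>Deterministic multi-tape Turing machines\<close>

text \<open>The control states are \<open>0, \<dots>, state_count\<close>, where \<open>0\<close> is initial and
  \<open>state_count\<close> is the only halting state. The tape symbols are the numbers below
  \<open>symbol_count\<close>: \<open>0\<close> is the blank, \<open>1\<close> and \<open>2\<close> stand for the bits \<open>False\<close> and \<open>True\<close>.
  Tapes are infinite in both directions. Tape \<open>0\<close> holds the input, tape \<open>1\<close> the output.\<close>

datatype move = Left | Stay | Right

record tm =
  tape_count :: nat
  state_count :: nat
  symbol_count :: nat
  delta :: "nat \<Rightarrow> nat list \<Rightarrow> nat \<times> (nat \<times> move) list"

text \<open>Only the finitely many values of \<open>delta\<close> constrained here influence a computation.\<close>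

definition turing_machine :: "tm \<Rightarrow> bool" where
  "turing_machine M \<longleftrightarrow> 2 \<le> tape_count M \<and> 3 \<le> symbol_count M \<and>
     (\<forall>q < state_count M. \<forall>ss. length ss = tape_count M \<and> set ss \<subseteq> {..<symbol_count M} \<longrightarrow>
        fst (delta M q ss) \<le> state_count M \<and>
        length (snd (delta M q ss)) = tape_count M \<and>
        fst ` set (snd (delta M q ss)) \<subseteq> {..<symbol_count M})"

type_synonym tape = "(int \<Rightarrow> nat) \<times> int"
type_synonym config = "nat \<times> tape list"

fun offset :: "move \<Rightarrow> int" where
  "offset Left = -1"
| "offset Stay = 0"
| "offset Right = 1"

fun read :: "tape \<Rightarrow> nat" where
  "read (f, i) = f i"

fun act :: "nat \<times> move \<Rightarrow> tape \<Rightarrow> tape" where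
  "act (s, m) (f, i) = (f(i := s), i + offset m)"

definition step :: "tm \<Rightarrow> config \<Rightarrow> config" where
  "step M c = (case c of (q, ts) \<Rightarrow>
     if q < state_count M
     then let (q', as) = delta M q (map read ts) in (q', map2 act as ts)
     else (q, ts))"

definition contents :: "bool list \<Rightarrow> int \<Rightarrow> nat" where
  "contents x i =
     (if 0 \<le> i \<and> i < int (length x) then if x ! nat i then 2 else 1 else 0)"

definition initial_config :: "tm \<Rightarrow> bool list \<Rightarrow> config" where
  "initial_config M x = (0, (contents x, 0) # replicate (tape_count M - 1) (contents [], 0))"

definition computes_within :: "tm \<Rightarrow> (bool list \<Rightarrow> bool list) \<Rightarrow> (nat \<Rightarrow> nat) \<Rightarrow> bool" where
  "computes_within M f b \<longleftrightarrow>
     (\<forall>x. \<exists>t \<le> b (length x). \<exists>ts.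
        (step M ^^ t) (initial_config M x) = (state_count M, ts) \<and>
        fst (ts ! 1) = contents (f x))"

definition polytime :: "(bool list \<Rightarrow> bool list) \<Rightarrow> bool" where
  "polytime f \<longleftrightarrow> (\<exists>M (p :: nat poly). turing_machine M \<and> computes_within M f (poly p))"


section \<open>NP-completeness\<close>

type_synonym language = "bool list set"

text \<open>A self-delimiting pairing: every bit of the first component is preceded by \<open>True\<close>.\<close>

definition pair :: "bool list \<Rightarrow> bool list \<Rightarrow> bool list" where
  "pair x u = concat (map (\<lambda>b. [True, b]) x) @ [False] @ u"

definition NP :: "language set" where
  "NP = {L. \<exists>v (p :: nat poly). polytime v \<and>
     (\<forall>x. x \<in> L \<longleftrightarrow> (\<exists>u. length u \<le> poly p (length x) \<and> v (pair x u) = [True]))}"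

definition poly_reducible :: "language \<Rightarrow> language \<Rightarrow> bool" where
  "poly_reducible L L' \<longleftrightarrow> (\<exists>f. polytime f \<and> (\<forall>x. x \<in> L \<longleftrightarrow> f x \<in> L'))"

definition NP_hard :: "language \<Rightarrow> bool" where
  "NP_hard L \<longleftrightarrow> (\<forall>L' \<in> NP. poly_reducible L' L)"

definition NP_complete :: "language \<Rightarrow> bool" where
  "NP_complete L \<longleftrightarrow> L \<in> NP \<and> NP_hard L"


section \<open>The decision problem\<close>

text \<open>A graph of order \<open>n\<close> is given on the vertices \<open>0, \<dots>, n - 1\<close> by its adjacency matrix,
  \<open>S\<close> by its characteristic vector and \<open>k\<close> in unary. As \<open>k < n\<close> in every instance,
  unary and binary notation of \<open>k\<close> yield polynomially related input lengths.\<close>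

definition encode :: "nat \<Rightarrow> nat set set \<Rightarrow> nat set \<Rightarrow> nat \<Rightarrow> bool list" where
  "encode n E S k =
     replicate n True @ [False] @
     map (\<lambda>(i, j). {i, j} \<in> E) (List.product [0..<n] [0..<n]) @
     map (\<lambda>i. i \<in> S) [0..<n] @
     replicate k True"

lemma replicate_True_append_False_eq:
  "replicate n True @ False # xs = replicate m True @ False # ys \<Longrightarrow> n = m \<and> xs = ys"
proof (induction n arbitrary: m)
  case 0
  then show ?case by (cases m) auto
next
  case (Suc n)
  then show ?case by (cases m) auto
qed

lemma encode_inject:
  assumes "encode n E S k = encode n' E' S' k'"
    and "simple_graph ({..<n}, E)" "simple_graph ({..<n'}, E')" "S \<subseteq> {..<n}" "S' \<subseteq> {..<n'}"
  shows "n = n' \<and> E = E' \<and> S = S' \<and> k = k'"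
proof -
  have tails: "n = n' \<and>
      map (\<lambda>(i, j). {i, j} \<in> E) (List.product [0..<n] [0..<n]) @
        map (\<lambda>i. i \<in> S) [0..<n] @ replicate k True =
      map (\<lambda>(i, j). {i, j} \<in> E') (List.product [0..<n'] [0..<n']) @
        map (\<lambda>i. i \<in> S') [0..<n'] @ replicate k' True"
    using assms(1) unfolding encode_def append_Cons append_Nil
    by (rule replicate_True_append_False_eq)
  then have n: "n = n'" by (rule conjunct1)
  have parts: "map (\<lambda>(i, j). {i, j} \<in> E) (List.product [0..<n] [0..<n]) =
      map (\<lambda>(i, j). {i, j} \<in> E') (List.product [0..<n] [0..<n])"
    "map (\<lambda>i. i \<in> S) [0..<n] = map (\<lambda>i. i \<in> S') [0..<n]"
    "replicate k True = replicate k' True"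
    using tails unfolding n[symmetric] by (simp_all only: append_eq_append_conv length_map simp_thms)
  have adj: "{i, j} \<in> E \<longleftrightarrow> {i, j} \<in> E'" if "i < n" "j < n" for i j
  proof -
    have "(i, j) \<in> set (List.product [0..<n] [0..<n])" using that by simp
    with parts(1) show ?thesis unfolding map_eq_conv by blast
  qed
  have vec: "i \<in> S \<longleftrightarrow> i \<in> S'" if "i < n" for i
    using parts(2) that by simp
  have "k = k'" using parts(3) by (metis length_replicate)
  moreover have "S = S'" using vec assms(4,5) n by blast
  moreover have "e \<in> E \<longleftrightarrow> e \<in> E'" for e
  proof (cases "e \<in> E \<or> e \<in> E'")
    case True
    then have "e \<subseteq> {..<n}" "card e = 2"
      using assms(2,3) unfolding simple_graph_def n by auto
    then obtain i j where "e = {i, j}" "i < n" "j < n"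
      by (auto simp: card_2_iff)
    then show ?thesis using adj by simp
  qed simp
  ultimately show ?thesis using n by blast
qed

definition internally_disjoint_trees_problem :: "nat \<Rightarrow> language" where
  "internally_disjoint_trees_problem k\<^sub>1 =
     {encode n E S k\<^sub>2 | n E S k\<^sub>2.
        simple_graph ({..<n}, E) \<and> S \<subseteq> {..<n} \<and> card S = k\<^sub>1 \<and>
        2 \<le> k\<^sub>2 \<and> k\<^sub>2 \<le> n - 1 \<and> k\<^sub>2 \<le> kappa ({..<n}, E) S}"

end

theory Submission
  imports Defs
begin

text \<open>Polynomial time is handled through a language of arithmetic terms with bounded sums: every
  bit string written by nested loops over such terms is computed by a polynomial-time machine that
  uses its tapes as counters. Membership in NP then only needs a certificate that is checked by
  bounded quantifiers: for each of the \<open>k\<^sub>2\<close> subgraphs, the walks from a root to its vertices.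

  For hardness, the computation of a verifier is described by clauses, with the tapes taken relative
  to their heads. A satisfiability instance becomes a graph whose terminals all have degree \<open>k\<^sub>2\<close>, so
  that each tree contains exactly one neighbour of each terminal. Some trees must then join the
  sources to the sinks on the cycle of a variable, all in the same direction, which fixes a truth
  value; the others must join \<open>Cls i\<close> to \<open>Fin i\<close> through a vertex left free by the cycles, that is,
  by a true literal of clause \<open>i\<close>.\<close>

section \<open>Counter programs on Turing machines\<close>

text \<open>\<open>NP\<close> ranges over arbitrary Turing machines, while the verifier and the
  reduction need concrete ones. Counters make these easy to build, and as a fixed term with bounded
  sums has a value polynomial in its inputs, counting in unary is fast enough. The reduction never
  stores a graph: each bit of its output is the truth value of one term, and an adjacency bit asks
  whether some arc joins two given numbers.

  The clauses are Horn clauses except where the certificate is chosen. An assignment may therefore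
  put several symbols into one cell; it still contains all facts of an actual run, and acceptance is
  tested by negative literals only. Clauses may have any length, since \<open>Cls i\<close> may be
  adjacent to any number of tips.

  The terminals are of three kinds. Terminal 1 sees the sinks in place of the sources, terminal 2
  sees the \<open>Fin i\<close> in place of the \<open>Cls i\<close>, and every other terminal sees
  the sources and the \<open>Cls i\<close>. A tree that owns a source can reach terminal 1 only by
  finding a sink; a tree that owns some \<open>Cls i\<close> can reach terminal 2 only by finding
  some \<open>Fin i\<close>.\<close>

datatype com = Skip | Inc nat | Dec nat | Emit bool | Seq com com
  | Cond nat nat com com | Until nat nat com

type_synonym store = "nat \<Rightarrow> nat"

text \<open>The counters are head positions: counter 0 is the head of the input tape, and counter
  \<open>j \<ge> 2\<close> is the head of tape \<open>j\<close>, whose only nonblank cell is a marker 3 at position 0. There is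
  no counter 1, as tape 1 takes the output.\<close>

definition scan :: "bool list \<Rightarrow> store \<Rightarrow> nat \<Rightarrow> nat" where
  "scan x \<sigma> j = (if j = 0 then contents x (int (\<sigma> 0)) else if \<sigma> j = 0 then 3 else 0)"

inductive exec :: "bool list \<Rightarrow> com \<Rightarrow> store \<times> bool list \<Rightarrow> nat \<Rightarrow> store \<times> bool list \<Rightarrow> bool" for x where
  Skip: "exec x Skip s 0 s"
| Inc: "exec x (Inc j) (\<sigma>, y) 1 (\<sigma>(j := Suc (\<sigma> j)), y)"
| Dec: "\<sigma> j = Suc k \<Longrightarrow> exec x (Dec j) (\<sigma>, y) 1 (\<sigma>(j := k), y)"
| Emit: "exec x (Emit b) (\<sigma>, y) 1 (\<sigma>, y @ [b])"
| Seq: "exec x c s t s' \<Longrightarrow> exec x c' s' t' s'' \<Longrightarrow> exec x (Seq c c') s (t + t') s''"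
| CondT: "scan x \<sigma> j = a \<Longrightarrow> exec x c (\<sigma>, y) t s' \<Longrightarrow> exec x (Cond j a c c') (\<sigma>, y) (1 + t) s'"
| CondF: "scan x \<sigma> j \<noteq> a \<Longrightarrow> exec x c' (\<sigma>, y) t s' \<Longrightarrow>
    exec x (Cond j a c c') (\<sigma>, y) (1 + (t + 1)) s'"
| UntilT: "scan x \<sigma> j = a \<Longrightarrow> exec x (Until j a c) (\<sigma>, y) 1 (\<sigma>, y)"
| UntilF: "scan x \<sigma> j \<noteq> a \<Longrightarrow> exec x c (\<sigma>, y) t s' \<Longrightarrow> exec x (Until j a c) s' t' s'' \<Longrightarrow>
    exec x (Until j a c) (\<sigma>, y) (1 + (t + (1 + t'))) s''"

section \<open>Translation of counter programs into machine instructions\<close>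

datatype instr = Shift nat move | Print bool | Jump nat nat nat | Goto nat

text \<open>The second argument is the address of the first instruction, as jumps are absolute. The
  false branch of \<open>Cond\<close> stands first and has to jump over the true branch, which is
  the extra step charged by \<open>CondF\<close>; \<open>UntilF\<close> likewise charges the jump
  back.\<close>

fun code :: "com \<Rightarrow> nat \<Rightarrow> instr list" where
  "code Skip a = []"
| "code (Inc j) a = [Shift j Right]"
| "code (Dec j) a = [Shift j Left]"
| "code (Emit b) a = [Print b]"
| "code (Seq c c') a = (let p = code c a in p @ code c' (a + length p))"
| "code (Cond j s c c') a =
     (let p' = code c' (a + 1); l = a + length p' + 2; p = code c l
      in Jump j s l # p' @ Goto (l + length p) # p)"
| "code (Until j s c) a =
     (let p = code c (a + 1) in Jump j s (a + length p + 2) # p @ [Goto a])"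

fun tapes_below :: "nat \<Rightarrow> com \<Rightarrow> bool" where
  "tapes_below K Skip = True"
| "tapes_below K (Inc j) = (j < K \<and> j \<noteq> 1)"
| "tapes_below K (Dec j) = (j < K \<and> j \<noteq> 1)"
| "tapes_below K (Emit b) = True"
| "tapes_below K (Seq c c') = (tapes_below K c \<and> tapes_below K c')"
| "tapes_below K (Cond j s c c') = (j < K \<and> j \<noteq> 1 \<and> tapes_below K c \<and> tapes_below K c')"
| "tapes_below K (Until j s c) = (j < K \<and> j \<noteq> 1 \<and> tapes_below K c)"

fun instr_delta :: "nat \<Rightarrow> instr \<Rightarrow> nat \<Rightarrow> nat list \<Rightarrow> nat \<times> (nat \<times> move) list" where
  "instr_delta K (Shift j m) q ss = (Suc q, map (\<lambda>i. (ss ! i, if i = j then m else Stay)) [0..<K])"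
| "instr_delta K (Print b) q ss =
     (Suc q, map (\<lambda>i. if i = 1 then (if b then 2 else 1, Right) else (ss ! i, Stay)) [0..<K])"
| "instr_delta K (Jump j s l) q ss =
     (if ss ! j = s then l else Suc q, map (\<lambda>i. (ss ! i, Stay)) [0..<K])"
| "instr_delta K (Goto l) q ss = (l, map (\<lambda>i. (ss ! i, Stay)) [0..<K])"

text \<open>State 0 only writes the markers on the counter tapes; the instructions, counted from 1,
  are the further states. The cap by \<open>min\<close> makes every target a legal state, whatever
  the instruction list.\<close>

definition program_delta :: "nat \<Rightarrow> instr list \<Rightarrow> nat \<Rightarrow> nat list \<Rightarrow> nat \<times> (nat \<times> move) list" where
  "program_delta K P q ss =
     (if q = 0 then (1, map (\<lambda>i. (if i < 2 then ss ! i else 3, Stay)) [0..<K])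
      else let r = instr_delta K (P ! (q - 1)) q ss in (min (fst r) (Suc (length P)), snd r))"

definition machine :: "nat \<Rightarrow> instr list \<Rightarrow> tm" where
  "machine K P = \<lparr>tape_count = K, state_count = Suc (length P), symbol_count = 4,
     delta = program_delta K P\<rparr>"

definition tape_of :: "bool list \<Rightarrow> store \<times> bool list \<Rightarrow> nat \<Rightarrow> tape" where
  "tape_of x s j = (if j = 0 then (contents x, int (fst s 0))
     else if j = 1 then (contents (snd s), int (length (snd s)))
     else ((contents [])(0 := 3), int (fst s j)))"

definition tapes_of :: "nat \<Rightarrow> bool list \<Rightarrow> store \<times> bool list \<Rightarrow> tape list" where
  "tapes_of K x s = map (tape_of x s) [0..<K]"

definition code_at :: "instr list \<Rightarrow> nat \<Rightarrow> instr list \<Rightarrow> bool" where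
  "code_at P a cs \<longleftrightarrow> (\<exists>pre post. P = pre @ cs @ post \<and> a = Suc (length pre))"

lemma code_at_append:
  assumes "code_at P a (cs @ ds)"
  shows "code_at P a cs" "code_at P (a + length cs) ds"
proof -
  from assms obtain pre post where *: "P = pre @ (cs @ ds) @ post" "a = Suc (length pre)"
    by (auto simp: code_at_def)
  have "P = pre @ cs @ (ds @ post)" "P = (pre @ cs) @ ds @ post" using * by auto
  then show "code_at P a cs" "code_at P (a + length cs) ds"
    unfolding code_at_def using *(2) by (blast, metis add_Suc length_append)
qed

lemma code_at_Cons:
  assumes "code_at P a (i # ds)"
  shows "P ! (a - 1) = i" "0 < a" "a < Suc (length P)" "code_at P (a + 1) ds"
proof -
  from assms obtain pre post where *: "P = pre @ (i # ds) @ post" "a = Suc (length pre)"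
    by (auto simp: code_at_def)
  then show "P ! (a - 1) = i" "0 < a" "a < Suc (length P)" by auto
  show "code_at P (a + 1) ds" using code_at_append(2)[of P a "[i]" ds] assms by simp
qed

lemma code_at_le: "code_at P a cs \<Longrightarrow> a + length cs \<le> Suc (length P)"
  by (auto simp: code_at_def)

section \<open>Simulation of counter programs\<close>

lemma turing_machine_machine:
  assumes "2 \<le> K"
  shows "turing_machine (machine K P)"
proof -
  have d: "length (snd (instr_delta K i q ss)) = K \<and> fst ` set (snd (instr_delta K i q ss)) \<subseteq> {..<4}"
    if "length ss = K" "set ss \<subseteq> {..<4}" for i q ss
  proof -
    have "ss ! i < 4" if "i < K" for i
      using \<open>length ss = K\<close> \<open>set ss \<subseteq> {..<4}\<close> that nth_mem by blast
    then show ?thesis by (cases i) auto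
  qed
  have s: "ss ! i < 4" if "length ss = K" "set ss \<subseteq> {..<4}" "i < K" for i and ss :: "nat list"
    using that nth_mem by blast
  show ?thesis
    unfolding turing_machine_def
  proof (intro conjI allI impI)
    fix q ss
    assume q: "q < state_count (machine K P)"
      and "length ss = tape_count (machine K P) \<and> set ss \<subseteq> {..<symbol_count (machine K P)}"
    then have ss: "length ss = K" "set ss \<subseteq> {..<4}" by (auto simp: machine_def)
    show "fst (delta (machine K P) q ss) \<le> state_count (machine K P)"
      by (simp add: machine_def program_delta_def Let_def split: prod.split)
    show "length (snd (delta (machine K P) q ss)) = tape_count (machine K P)"
      using d[OF ss] by (simp add: machine_def program_delta_def Let_def)
    show "fst ` set (snd (delta (machine K P) q ss)) \<subseteq> {..<symbol_count (machine K P)}"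
    proof (cases "q = 0")
      case True
      then show ?thesis using s[OF ss] by (auto simp: machine_def program_delta_def)
    next
      case False
      then show ?thesis using d[OF ss] by (simp add: machine_def program_delta_def Let_def)
    qed
  qed (use assms in \<open>auto simp: machine_def\<close>)
qed

lemma steps_trans:
  "(step M ^^ t) c = c' \<Longrightarrow> (step M ^^ t') c' = c'' \<Longrightarrow> (step M ^^ (t + t')) c = c''"
  by (simp add: funpow_add[of t' t] add.commute[of t])

lemma step_machine:
  assumes "code_at P a (i # cs)"
  shows "step (machine K P) (a, ts) = (let r = instr_delta K i a (map read ts)
    in (min (fst r) (Suc (length P)), map2 act (snd r) ts))"
  using code_at_Cons[OF assms] by (auto simp: step_def machine_def program_delta_def Let_def split: prod.splits)

lemma map2_act_tapes_of:
  "map2 act (map f [0..<K]) (tapes_of K x s) = map (\<lambda>j. act (f j) (tape_of x s j)) [0..<K]"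
  by (auto simp: tapes_of_def intro!: nth_equalityI)

lemma act_read_Stay [simp]: "act (read t, Stay) t = t"
  by (cases t) auto

lemma read_tapes_of [simp]: "j < K \<Longrightarrow> map read (tapes_of K x s) ! j = read (tape_of x s j)"
  by (simp add: tapes_of_def)

lemma read_tape_of: "j \<noteq> 1 \<Longrightarrow> read (tape_of x (\<sigma>, y) j) = scan x \<sigma> j"
  by (auto simp: tape_of_def scan_def contents_def)

lemma contents_snoc: "(contents y)(int (length y) := if b then 2 else 1) = contents (y @ [b])"
proof
  fix i :: int
  show "((contents y)(int (length y) := if b then 2 else 1)) i = contents (y @ [b]) i"
  proof (cases "i < 0")
    case True
    then show ?thesis by (simp add: contents_def)
  next
    case False
    then obtain k where "i = int k" by (metis nonneg_int_cases not_less)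
    then show ?thesis
      by (cases "k < length y"; cases "k = length y") (auto simp: contents_def nth_append)
  qed
qed

lemma step_Shift:
  assumes "code_at P a (Shift j m # cs)" "j < K" "j \<noteq> 1" "int k = int (\<sigma> j) + offset m"
  shows "step (machine K P) (a, tapes_of K x (\<sigma>, y)) = (a + 1, tapes_of K x (\<sigma>(j := k), y))"
proof -
  have "map2 act (map (\<lambda>i. (map read (tapes_of K x (\<sigma>, y)) ! i, if i = j then m else Stay)) [0..<K])
     (tapes_of K x (\<sigma>, y)) = tapes_of K x (\<sigma>(j := k), y)"
    unfolding map2_act_tapes_of
    using assms(2-4) by (auto simp: tapes_of_def) (auto simp: tape_of_def)
  then show ?thesis
    using code_at_le[OF assms(1)] by (simp add: step_machine[OF assms(1)])
qed

lemma step_Print: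
  assumes "code_at P a (Print b # cs)" "2 \<le> K"
  shows "step (machine K P) (a, tapes_of K x (\<sigma>, y)) = (a + 1, tapes_of K x (\<sigma>, y @ [b]))"
proof -
  have "map2 act (map (\<lambda>i. if i = 1 then (if b then 2 else 1, Right) else
      (map read (tapes_of K x (\<sigma>, y)) ! i, Stay)) [0..<K])
     (tapes_of K x (\<sigma>, y)) = tapes_of K x (\<sigma>, y @ [b])"
    unfolding map2_act_tapes_of using assms(2) contents_snoc[of y b]
    by (auto simp: tapes_of_def) (auto simp: tape_of_def)
  then show ?thesis
    using code_at_le[OF assms(1)] by (simp add: step_machine[OF assms(1)])
qed

lemma map2_act_Stay:
  "map2 act (map (\<lambda>i. (map read (tapes_of K x s) ! i, Stay)) [0..<K]) (tapes_of K x s) = tapes_of K x s"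
  unfolding map2_act_tapes_of by (auto simp: tapes_of_def)

lemma step_Jump:
  assumes "code_at P a (Jump j v l # cs)" "j < K" "j \<noteq> 1" "l \<le> Suc (length P)"
  shows "step (machine K P) (a, tapes_of K x (\<sigma>, y)) =
    (if scan x \<sigma> j = v then l else a + 1, tapes_of K x (\<sigma>, y))"
  using assms code_at_le[OF assms(1)]
  by (simp add: step_machine[OF assms(1)] map2_act_Stay read_tape_of)

lemma step_Goto:
  assumes "code_at P a (Goto l # cs)" "l \<le> Suc (length P)"
  shows "step (machine K P) (a, tapes_of K x s) = (l, tapes_of K x s)"
  using assms by (simp add: step_machine[OF assms(1)] map2_act_Stay)

lemma code_at_Cond:
  assumes "code_at P a (code (Cond j v c c') a)"
  obtains l cs cs' where "code_at P a (Jump j v l # cs)" "code_at P l (code c l)"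
    "code_at P (a + 1) (code c' (a + 1))"
    "code_at P (a + 1 + length (code c' (a + 1))) (Goto (l + length (code c l)) # cs')"
    "l + length (code c l) = a + length (code (Cond j v c c') a)"
proof -
  define l where "l = a + length (code c' (a + 1)) + 2"
  have at: "code_at P a (Jump j v l # code c' (a + 1) @ Goto (l + length (code c l)) # code c l)"
    using assms by (simp add: l_def Let_def)
  note at' = code_at_append[OF code_at_Cons(4)[OF at]]
  have "code_at P l (code c l)" using code_at_Cons(4)[OF at'(2)] by (simp add: l_def)
  from that[OF at this at'] show ?thesis by (simp add: l_def Let_def)
qed

text \<open>The induction follows the derivation of \<open>exec\<close>, not the program, so that
  loops unroll by themselves. Each rule charges exactly the machine steps of its code, hence the
  same \<open>t\<close> on both sides.\<close>

lemma exec_simulation: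
  assumes "exec x c s t s'" "tapes_below K c" "2 \<le> K" "code_at P a (code c a)"
  shows "(step (machine K P) ^^ t) (a, tapes_of K x s) = (a + length (code c a), tapes_of K x s')"
  using assms
proof (induction arbitrary: a rule: exec.induct)
  case (Skip s)
  then show ?case by simp
next
  case (Inc j \<sigma> y)
  then show ?case by (simp add: step_Shift[where k = "Suc (\<sigma> j)"])
next
  case (Dec \<sigma> j k y)
  then show ?case by (simp add: step_Shift[where k = k])
next
  case (Emit b \<sigma> y)
  then show ?case by (simp add: step_Print)
next
  case (Seq c s t s' c' t' s'')
  let ?p = "code c a"
  have at: "code_at P a ?p" "code_at P (a + length ?p) (code c' (a + length ?p))"
    using Seq.prems(3) by (auto simp: Let_def dest: code_at_append)
  show ?case
    using steps_trans[OF Seq.IH(1)[OF _ _ at(1)] Seq.IH(2)[OF _ _ at(2)]] Seq.prems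
    by (simp add: Let_def add.assoc)
next
  case (CondT \<sigma> j v c y t s' c')
  obtain l cs where at: "code_at P a (Jump j v l # cs)" "code_at P l (code c l)"
    and l: "l + length (code c l) = a + length (code (Cond j v c c') a)"
    using code_at_Cond[OF CondT.prems(3)] by metis
  have 1: "(step (machine K P) ^^ 1) (a, tapes_of K x (\<sigma>, y)) = (l, tapes_of K x (\<sigma>, y))"
    using step_Jump[OF at(1)] CondT.hyps(1) CondT.prems code_at_le[OF at(2)] by simp
  show ?case
    using steps_trans[OF 1 CondT.IH[OF _ _ at(2)]] CondT.prems unfolding l[symmetric] by simp
next
  case (CondF \<sigma> j v c' y t s' c)
  obtain l cs cs' where at: "code_at P a (Jump j v l # cs)" "code_at P l (code c l)"
    "code_at P (a + 1) (code c' (a + 1))"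
    "code_at P (a + 1 + length (code c' (a + 1))) (Goto (l + length (code c l)) # cs')"
    and l: "l + length (code c l) = a + length (code (Cond j v c c') a)"
    using code_at_Cond[OF CondF.prems(3)] .
  have 1: "(step (machine K P) ^^ 1) (a, tapes_of K x (\<sigma>, y)) = (a + 1, tapes_of K x (\<sigma>, y))"
    using step_Jump[OF at(1)] CondF.hyps(1) CondF.prems code_at_le[OF at(2)] by simp
  have 2: "(step (machine K P) ^^ t) (a + 1, tapes_of K x (\<sigma>, y)) =
      (a + 1 + length (code c' (a + 1)), tapes_of K x s')"
    using CondF.IH[OF _ _ at(3)] CondF.prems by simp
  have 3: "(step (machine K P) ^^ 1) (a + 1 + length (code c' (a + 1)), tapes_of K x s') =
      (l + length (code c l), tapes_of K x s')"
    using step_Goto[OF at(4) code_at_le[OF at(2)]] by simp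
  show ?case
    unfolding l[symmetric] by (rule steps_trans[OF 1 steps_trans[OF 2 3]])
next
  case (UntilT \<sigma> j v c y)
  then show ?case
    using step_Jump[of P a j v _ _ K x \<sigma> y] code_at_le[OF UntilT.prems(3)] by (simp add: Let_def)
next
  case (UntilF \<sigma> j v c y t s' t' s'')
  define p where "p = code c (a + 1)"
  have C: "code (Until j v c) a = Jump j v (a + length p + 2) # p @ [Goto a]"
    by (simp add: p_def Let_def)
  have at: "code_at P a (Jump j v (a + length p + 2) # p @ [Goto a])" using UntilF.prems(3) C by simp
  have atp: "code_at P (a + 1) p" and atg: "code_at P (a + 1 + length p) [Goto a]"
    using code_at_append[OF code_at_Cons(4)[OF at]] by auto
  have 1: "(step (machine K P) ^^ 1) (a, tapes_of K x (\<sigma>, y)) = (a + 1, tapes_of K x (\<sigma>, y))"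
    using step_Jump[OF at] UntilF.hyps(1) UntilF.prems code_at_le[OF at] by simp
  have 2: "(step (machine K P) ^^ t) (a + 1, tapes_of K x (\<sigma>, y)) =
      (a + 1 + length p, tapes_of K x s')"
    using UntilF.IH(1)[of "a + 1"] UntilF.prems atp by (simp add: p_def)
  have 3: "(step (machine K P) ^^ 1) (a + 1 + length p, tapes_of K x s') = (a, tapes_of K x s')"
    using step_Goto[OF atg] code_at_le[OF atg] by simp
  have 4: "(step (machine K P) ^^ t') (a, tapes_of K x s') =
      (a + length (code (Until j v c) a), tapes_of K x s'')"
    using UntilF.IH(2)[of a] UntilF.prems by simp
  show ?case
    using steps_trans[OF 1 steps_trans[OF 2 steps_trans[OF 3 4]]] .
qed

lemma polytime_exec:
  assumes tb: "tapes_below K c" "2 \<le> K"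
    and run: "\<And>x. \<exists>t \<le> poly p (length x). \<exists>\<sigma>. exec x c (\<lambda>_. 0, []) t (\<sigma>, f x)"
  shows "polytime f"
proof -
  let ?P = "code c 1"
  let ?M = "machine K ?P"
  \<comment> \<open>The added 1 pays for the step that writes the markers.\<close>
  have "computes_within ?M f (poly (p + 1))"
    unfolding computes_within_def
  proof
    fix x
    obtain t \<sigma> where t: "t \<le> poly p (length x)" "exec x c (\<lambda>_. 0, []) t (\<sigma>, f x)"
      using run by blast
    have init: "(contents x, 0) # replicate (K - 1) (contents [], 0) =
        map (\<lambda>i. (if i = 0 then contents x else contents [], 0)) [0..<K]"
      by (rule nth_equalityI) (use tb(2) in \<open>auto simp: nth_Cons'\<close>)
    have "step ?M (initial_config ?M x) = (1, tapes_of K x (\<lambda>_. 0, []))"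
      unfolding initial_config_def step_def
      by (rule prod_eqI)
        (auto simp: machine_def program_delta_def init[unfolded One_nat_def] tapes_of_def tape_of_def
          intro!: nth_equalityI)
    then have 1: "(step ?M ^^ 1) (initial_config ?M x) = (1, tapes_of K x (\<lambda>_. 0, []))" by simp
    have at: "code_at ?P 1 (code c 1)" unfolding code_at_def by (intro exI[of _ "[]"]) auto
    have "(step ?M ^^ (1 + t)) (initial_config ?M x) = (state_count ?M, tapes_of K x (\<sigma>, f x))"
      using steps_trans[OF 1 exec_simulation[OF t(2) tb at]] by (simp add: machine_def)
    moreover have "fst (tapes_of K x (\<sigma>, f x) ! 1) = contents (f x)"
      using tb(2) by (simp add: tapes_of_def tape_of_def)
    ultimately show "\<exists>t\<le>poly (p + 1) (length x). \<exists>ts.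
        (step ?M ^^ t) (initial_config ?M x) = (state_count ?M, ts) \<and> fst (ts ! 1) = contents (f x)"
      using t(1) by (intro exI[of _ "1 + t"]) auto
  qed
  then show ?thesis
    unfolding polytime_def using turing_machine_machine[OF tb(2)] by blast
qed

section \<open>Bounded arithmetic terms\<close>

text \<open>Sums with computed ranges are the only loops. This keeps values polynomially bounded and
  still gives bounded quantifiers, comparisons and evaluation of polynomials.\<close>

datatype expr = Const nat | Var nat | Plus expr expr | Times expr expr | Minus expr expr
  | Len | Bit expr | Sum nat expr expr

type_synonym env = "nat \<Rightarrow> nat"

fun val :: "bool list \<Rightarrow> expr \<Rightarrow> env \<Rightarrow> nat" where
  "val x (Const k) \<rho> = k"
| "val x (Var v) \<rho> = \<rho> v"
| "val x (Plus e e') \<rho> = val x e \<rho> + val x e' \<rho>"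
| "val x (Times e e') \<rho> = val x e \<rho> * val x e' \<rho>"
| "val x (Minus e e') \<rho> = val x e \<rho> - val x e' \<rho>"
| "val x Len \<rho> = length x"
| "val x (Bit e) \<rho> = (if val x e \<rho> < length x \<and> x ! val x e \<rho> then 1 else 0)"
| "val x (Sum v e e') \<rho> = (\<Sum>i<val x e \<rho>. val x e' (\<rho>(v := i)))"

datatype cmd = Out expr | Then cmd cmd | For nat expr cmd

fun outputs :: "bool list \<Rightarrow> cmd \<Rightarrow> env \<Rightarrow> bool list" where
  "outputs x (Out e) \<rho> = [val x e \<rho> \<noteq> 0]"
| "outputs x (Then c c') \<rho> = outputs x c \<rho> @ outputs x c' \<rho>"
| "outputs x (For v e c) \<rho> = concat (map (\<lambda>i. outputs x c (\<rho>(v := i))) [0..<val x e \<rho>])"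

section \<open>Time bounds for loops over counters\<close>

definition runs :: "bool list \<Rightarrow> com \<Rightarrow> store \<Rightarrow> bool list \<Rightarrow> nat \<Rightarrow> store \<Rightarrow> bool list \<Rightarrow> bool" where
  "runs x c \<sigma> y b \<sigma>' y' \<longleftrightarrow> (\<exists>t\<le>b. exec x c (\<sigma>, y) t (\<sigma>', y'))"

abbreviation While :: "nat \<Rightarrow> com \<Rightarrow> com" where
  "While j c \<equiv> Until j 3 c"

lemma scan_counter [simp]: "j \<noteq> 0 \<Longrightarrow> scan x \<sigma> j = 3 \<longleftrightarrow> \<sigma> j = 0"
  by (simp add: scan_def)

lemma runs_mono: "runs x c \<sigma> y b \<sigma>' y' \<Longrightarrow> b \<le> b' \<Longrightarrow> runs x c \<sigma> y b' \<sigma>' y'"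
  unfolding runs_def by (meson le_trans)

lemma runs_weaken:
  "runs x c \<sigma> y b \<sigma>' y' \<Longrightarrow> \<sigma>' = \<sigma>'' \<Longrightarrow> b \<le> b' \<Longrightarrow> runs x c \<sigma> y b' \<sigma>'' y'"
  using runs_mono by blast

lemma runs_Skip: "runs x Skip \<sigma> y 0 \<sigma> y"
  unfolding runs_def by (auto intro: exec.intros)

lemma runs_Inc: "runs x (Inc j) \<sigma> y 1 (\<sigma>(j := Suc (\<sigma> j))) y"
  unfolding runs_def using exec.Inc by blast

lemma runs_Dec: "\<sigma> j \<noteq> 0 \<Longrightarrow> runs x (Dec j) \<sigma> y 1 (\<sigma>(j := \<sigma> j - 1)) y"
  unfolding runs_def using exec.Dec[of \<sigma> j "\<sigma> j - 1"] by (auto intro!: exI[of _ 1])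

lemma runs_Emit: "runs x (Emit b) \<sigma> y 1 \<sigma> (y @ [b])"
  unfolding runs_def using exec.Emit by blast

lemma runs_Seq:
  "runs x c \<sigma> y b \<sigma>' y' \<Longrightarrow> runs x c' \<sigma>' y' b' \<sigma>'' y'' \<Longrightarrow> runs x (Seq c c') \<sigma> y (b + b') \<sigma>'' y''"
  unfolding runs_def by (meson add_mono exec.Seq)

lemma runs_Cond:
  assumes "scan x \<sigma> j = a \<Longrightarrow> runs x c \<sigma> y b \<sigma>' y'"
    and "scan x \<sigma> j \<noteq> a \<Longrightarrow> runs x c' \<sigma> y b \<sigma>' y'"
  shows "runs x (Cond j a c c') \<sigma> y (b + 2) \<sigma>' y'"
proof (cases "scan x \<sigma> j = a")
  case True
  then obtain t where "t \<le> b" "exec x c (\<sigma>, y) t (\<sigma>', y')" using assms(1) by (auto simp: runs_def)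
  then show ?thesis using exec.CondT[OF True] by (auto simp: runs_def intro!: exI[of _ "1 + t"])
next
  case False
  then obtain t where "t \<le> b" "exec x c' (\<sigma>, y) t (\<sigma>', y')" using assms(2) by (auto simp: runs_def)
  then show ?thesis using exec.CondF[OF False] by (auto simp: runs_def intro!: exI[of _ "1 + (t + 1)"])
qed

text \<open>The stores and outputs after each round are given in advance. The induction is on the
  number of rounds still to go, because \<open>Until\<close> unrolls from the front; a round costs
  its body, the test and the jump back.\<close>

lemma runs_loop:
  assumes body: "\<And>i. i < n \<Longrightarrow>
      scan x (\<sigma> i) j \<noteq> a \<and> runs x c (\<sigma> i) (y i) b (\<sigma> (Suc i)) (y (Suc i))"
    and exit: "scan x (\<sigma> n) j = a"
  shows "runs x (Until j a c) (\<sigma> 0) (y 0) (n * (b + 2) + 1) (\<sigma> n) (y n)"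
proof -
  have "runs x (Until j a c) (\<sigma> (n - m)) (y (n - m)) (m * (b + 2) + 1) (\<sigma> n) (y n)" if "m \<le> n" for m
    using that
  proof (induction m)
    case 0
    then show ?case unfolding runs_def using exec.UntilT[OF exit] by auto
  next
    case (Suc m)
    let ?i = "n - Suc m"
    have i: "?i < n" "Suc ?i = n - m" using Suc.prems by auto
    obtain t where t: "t \<le> b" "exec x c (\<sigma> ?i, y ?i) t (\<sigma> (n - m), y (n - m))"
      using body[OF i(1)] i(2) by (auto simp: runs_def)
    obtain t' where t': "t' \<le> m * (b + 2) + 1"
        "exec x (Until j a c) (\<sigma> (n - m), y (n - m)) t' (\<sigma> n, y n)"
      using Suc by (auto simp: runs_def)
    show ?case
      unfolding runs_def
      using exec.UntilF[of x "\<sigma> ?i" j a c "y ?i", OF _ t(2) t'(2)] body[OF i(1)] t(1) t'(1)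
      by (intro exI[of _ "1 + (t + (1 + t'))"]) auto
  qed
  from this[of n] show ?thesis by simp
qed

lemma runs_While:
  assumes "j \<noteq> 0" "\<sigma> 0 = \<sigma>\<^sub>0"
    and "\<And>i. i < \<sigma>\<^sub>0 j \<Longrightarrow> runs x c (\<sigma> i) (y i) b (\<sigma> (Suc i)) (y (Suc i))"
    and "\<And>i. i \<le> \<sigma>\<^sub>0 j \<Longrightarrow> \<sigma> i j = \<sigma>\<^sub>0 j - i"
  shows "runs x (While j c) \<sigma>\<^sub>0 (y 0) (\<sigma>\<^sub>0 j * (b + 2) + 1) (\<sigma> (\<sigma>\<^sub>0 j)) (y (\<sigma>\<^sub>0 j))"
  using runs_loop[of "\<sigma>\<^sub>0 j" x \<sigma> j 3 c y b] assms by auto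

primrec repeat :: "nat \<Rightarrow> com \<Rightarrow> com" where
  "repeat 0 c = Skip"
| "repeat (Suc n) c = Seq c (repeat n c)"

lemma runs_repeat_Inc: "runs x (repeat n (Inc j)) \<sigma> y n (\<sigma>(j := \<sigma> j + n)) y"
proof (induction n arbitrary: \<sigma>)
  case 0
  then show ?case by (simp add: runs_Skip)
next
  case (Suc n)
  show ?case
    unfolding repeat.simps by (rule runs_weaken[OF runs_Seq[OF runs_Inc Suc]]) (auto simp: fun_eq_iff)
qed

definition clear :: "nat \<Rightarrow> com" where
  "clear j = While j (Dec j)"

lemma runs_clear:
  assumes "j \<noteq> 0"
  shows "runs x (clear j) \<sigma> y (\<sigma> j * 3 + 1) (\<sigma>(j := 0)) y"
proof -
  let ?s = "\<lambda>i. \<sigma>(j := \<sigma> j - i)"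
  have "runs x (Dec j) (?s i) y 1 (?s (Suc i)) y" if "i < \<sigma> j" for i
    using runs_Dec[of "?s i" j x y] that by simp
  from runs_While[of j ?s \<sigma> x "Dec j" "\<lambda>_. y" 1] this assms show ?thesis
    by (auto simp: clear_def algebra_simps elim!: runs_mono)
qed

definition move_add :: "nat \<Rightarrow> nat \<Rightarrow> com" where
  "move_add i j = While i (Seq (Dec i) (Inc j))"

lemma runs_move_add:
  assumes "i \<noteq> 0" "i \<noteq> j"
  shows "runs x (move_add i j) \<sigma> y (\<sigma> i * 4 + 1) (\<sigma>(i := 0, j := \<sigma> j + \<sigma> i)) y"
proof -
  let ?s = "\<lambda>k. \<sigma>(i := \<sigma> i - k, j := \<sigma> j + k)"
  have "runs x (Seq (Dec i) (Inc j)) (?s k) y 2 (?s (Suc k)) y" if "k < \<sigma> i" for k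
  proof -
    have "runs x (Dec i) (?s k) y 1 ((?s k)(i := \<sigma> i - Suc k)) y"
      using runs_Dec[of "?s k" i x y] that assms by (simp add: fun_upd_twist)
    from runs_Seq[OF this runs_Inc[of x j]] show ?thesis
      using assms by (simp add: fun_upd_twist numeral_2_eq_2)
  qed
  from runs_While[of i ?s \<sigma> x "Seq (Dec i) (Inc j)" "\<lambda>_. y" 2] this assms
  show ?thesis by (simp add: move_add_def)
qed

text \<open>A counter can only be read by emptying it, so its value goes to \<open>j\<close> and to
  the scratch counter \<open>k\<close> at once and is then restored from \<open>k\<close>.\<close>

definition copy_add :: "nat \<Rightarrow> nat \<Rightarrow> nat \<Rightarrow> com" where
  "copy_add i j k = Seq (While i (Seq (Dec i) (Seq (Inc j) (Inc k)))) (move_add k i)"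

lemma runs_copy_add:
  assumes "i \<noteq> 0" "k \<noteq> 0" "i \<noteq> j" "i \<noteq> k" "j \<noteq> k" "\<sigma> k = 0"
  shows "runs x (copy_add i j k) \<sigma> y (\<sigma> i * 9 + 2) (\<sigma>(j := \<sigma> j + \<sigma> i)) y"
proof -
  let ?s = "\<lambda>l. \<sigma>(i := \<sigma> i - l, j := \<sigma> j + l, k := l)"
  have body: "runs x (Seq (Dec i) (Seq (Inc j) (Inc k))) (?s l) y 3 (?s (Suc l)) y" if "l < \<sigma> i" for l
  proof -
    have "runs x (Dec i) (?s l) y 1 ((?s l)(i := \<sigma> i - Suc l)) y"
      using runs_Dec[of "?s l" i x y] that assms by (simp add: fun_upd_twist)
    from runs_Seq[OF this runs_Seq[OF runs_Inc[of x j] runs_Inc[of x k]]]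
    have "runs x (Seq (Dec i) (Seq (Inc j) (Inc k))) (?s l) y (1 + (1 + 1)) (?s (Suc l)) y"
      using assms by (simp add: fun_upd_twist)
    then show ?thesis by (rule runs_mono) simp
  qed
  have s0: "?s 0 = \<sigma>" using assms by auto
  have "runs x (While i (Seq (Dec i) (Seq (Inc j) (Inc k)))) \<sigma> y (\<sigma> i * (3 + 2) + 1) (?s (\<sigma> i)) y"
    using runs_While[of i ?s \<sigma> x "Seq (Dec i) (Seq (Inc j) (Inc k))" "\<lambda>_. y" 3, OF _ s0 body] assms
    by simp
  from runs_Seq[OF this runs_move_add[of k i x "?s (\<sigma> i)" y]] assms
  have "runs x (copy_add i j k) \<sigma> y (\<sigma> i * (3 + 2) + 1 + (\<sigma> i * 4 + 1))
      ((?s (\<sigma> i))(k := 0, i := \<sigma> i)) y"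
    by (simp add: copy_add_def)
  moreover have "(?s (\<sigma> i))(k := 0, i := \<sigma> i) = \<sigma>(j := \<sigma> j + \<sigma> i)"
    using assms by (auto simp: fun_eq_iff)
  ultimately show ?thesis by (simp add: algebra_simps)
qed


text \<open>Variable \<open>v\<close> is kept on tape \<open>\<tau> v\<close>, and the value is delivered on tape \<open>d\<close>, the first of the
  free tapes.\<close>

fun compile :: "(nat \<Rightarrow> nat) \<Rightarrow> nat \<Rightarrow> expr \<Rightarrow> com" where
  "compile \<tau> d (Const k) = repeat k (Inc d)"
| "compile \<tau> d (Var v) = copy_add (\<tau> v) d (d + 1)"
| "compile \<tau> d (Plus e e') =
     Seq (compile \<tau> d e) (Seq (compile \<tau> (d + 1) e') (move_add (d + 1) d))"
| "compile \<tau> d (Times e e') =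
     Seq (compile \<tau> (d + 1) e) (Seq (compile \<tau> (d + 2) e')
       (Seq (While (d + 1) (Seq (Dec (d + 1)) (copy_add (d + 2) d (d + 3)))) (clear (d + 2))))"
| "compile \<tau> d (Minus e e') =
     Seq (compile \<tau> d e) (Seq (compile \<tau> (d + 1) e')
       (While (d + 1) (Seq (Dec (d + 1)) (Cond d 3 Skip (Dec d)))))"
| "compile \<tau> d Len =
     Seq (Until 0 0 (Seq (Inc 0) (Seq (Inc d) (Inc (d + 1))))) (While (d + 1) (Seq (Dec (d + 1)) (Dec 0)))"
| "compile \<tau> d (Bit e) =
     Seq (compile \<tau> d e) (Seq (While d (Seq (Dec d) (Seq (Inc 0) (Inc (d + 1)))))
       (Seq (Cond 0 2 (Inc d) Skip) (While (d + 1) (Seq (Dec (d + 1)) (Dec 0)))))"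
| "compile \<tau> d (Sum v e e') =
     Seq (compile \<tau> (d + 1) e) (Seq
       (While (d + 1) (Seq (Dec (d + 1)) (Seq (compile (\<tau>(v := d + 2)) (d + 3) e')
         (Seq (move_add (d + 3) d) (Inc (d + 2))))))
       (clear (d + 2)))"

fun compile_cmd :: "(nat \<Rightarrow> nat) \<Rightarrow> nat \<Rightarrow> cmd \<Rightarrow> com" where
  "compile_cmd \<tau> d (Out e) = Seq (compile \<tau> d e) (Seq (Cond d 3 (Emit False) (Emit True)) (clear d))"
| "compile_cmd \<tau> d (Then c c') = Seq (compile_cmd \<tau> d c) (compile_cmd \<tau> d c')"
| "compile_cmd \<tau> d (For v e c) =
     Seq (compile \<tau> d e) (Seq
       (While d (Seq (Dec d) (Seq (compile_cmd (\<tau>(v := d + 1)) (d + 2) c) (Inc (d + 1)))))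
       (clear (d + 1)))"

section \<open>Correctness and running time of compiled terms\<close>

definition represents :: "(nat \<Rightarrow> nat) \<Rightarrow> nat \<Rightarrow> env \<Rightarrow> store \<Rightarrow> bool" where
  "represents \<tau> d \<rho> \<sigma> \<longleftrightarrow> 3 \<le> d \<and> \<sigma> 0 = 0 \<and> (\<forall>v. 2 \<le> \<tau> v \<and> \<tau> v < d \<and> \<sigma> (\<tau> v) = \<rho> v) \<and> (\<forall>j\<ge>d. \<sigma> j = 0)"

lemma represents_upd: "represents \<tau> d \<rho> \<sigma> \<Longrightarrow> represents \<tau> (Suc d) \<rho> (\<sigma>(d := k))"
  unfolding represents_def by (auto simp: less_Suc_eq)

text \<open>The variable is redirected to the fresh tape \<open>d\<close>. Since
  \<open>\<tau>\<close> need not be injective, the tape that it leaves may go on serving other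
  variables.\<close>

lemma represents_bind:
  "represents \<tau> d \<rho> \<sigma> \<Longrightarrow> represents (\<tau>(v := d)) (Suc d) (\<rho>(v := k)) (\<sigma>(d := k))"
  unfolding represents_def by (auto simp: less_Suc_eq)

text \<open>\<open>B\<close> bounds the input length and all variables. Inside a sum the bound
  variable stays below the value of the range, hence the argument
  \<open>B + value_bound e B\<close>.\<close>

fun value_bound :: "expr \<Rightarrow> nat \<Rightarrow> nat" where
  "value_bound (Const k) B = k"
| "value_bound (Var v) B = B"
| "value_bound (Plus e e') B = value_bound e B + value_bound e' B"
| "value_bound (Times e e') B = value_bound e B * value_bound e' B"
| "value_bound (Minus e e') B = value_bound e B"
| "value_bound Len B = B"
| "value_bound (Bit e) B = 1"
| "value_bound (Sum v e e') B = value_bound e B * value_bound e' (B + value_bound e B)"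

fun time_bound :: "expr \<Rightarrow> nat \<Rightarrow> nat" where
  "time_bound (Const k) B = k"
| "time_bound (Var v) B = B * 9 + 2"
| "time_bound (Plus e e') B = time_bound e B + (time_bound e' B + (value_bound e' B * 4 + 1))"
| "time_bound (Times e e') B = time_bound e B + (time_bound e' B +
     ((value_bound e B * (1 + (value_bound e' B * 9 + 2) + 2) + 1) + (value_bound e' B * 3 + 1)))"
| "time_bound (Minus e e') B = time_bound e B + (time_bound e' B + (value_bound e' B * 6 + 1))"
| "time_bound Len B = (B * 5 + 1) + (B * 4 + 1)"
| "time_bound (Bit e) B =
     time_bound e B + ((value_bound e B * 5 + 1) + (3 + (value_bound e B * 4 + 1)))"
| "time_bound (Sum v e e') B = (let B' = B + value_bound e B in
     time_bound e B + ((value_bound e B *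
       (1 + (time_bound e' B' + ((value_bound e' B' * 4 + 1) + 1)) + 2) + 1) + (value_bound e B * 3 + 1)))"

fun cmd_time_bound :: "cmd \<Rightarrow> nat \<Rightarrow> nat" where
  "cmd_time_bound (Out e) B = time_bound e B + (3 + (value_bound e B * 3 + 1))"
| "cmd_time_bound (Then c c') B = cmd_time_bound c B + cmd_time_bound c' B"
| "cmd_time_bound (For v e c) B = time_bound e B + ((value_bound e B *
     (1 + (cmd_time_bound c (B + value_bound e B) + 1) + 2) + 1) + (value_bound e B * 3 + 1))"

definition fits_within :: "nat \<Rightarrow> bool list \<Rightarrow> env \<Rightarrow> bool" where
  "fits_within B x \<rho> \<longleftrightarrow> length x \<le> B \<and> (\<forall>v. \<rho> v \<le> B)"

lemma fits_within_upd: "fits_within B x \<rho> \<Longrightarrow> i \<le> k \<Longrightarrow> fits_within (B + k) x (\<rho>(v := i))"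
  unfolding fits_within_def by (auto intro: le_trans trans_le_add1 trans_le_add2)

lemma val_le_value_bound: "fits_within B x \<rho> \<Longrightarrow> val x e \<rho> \<le> value_bound e B"
proof (induction e arbitrary: B \<rho>)
  case (Sum v e e')
  have "(\<Sum>i<val x e \<rho>. val x e' (\<rho>(v := i))) \<le>
      of_nat (card {..<val x e \<rho>}) * value_bound e' (B + value_bound e B)"
    using Sum.IH(1)[OF Sum.prems]
    by (intro sum_bounded_above Sum.IH(2) fits_within_upd Sum.prems) auto
  also have "\<dots> \<le> value_bound e B * value_bound e' (B + value_bound e B)"
    using Sum.IH(1)[OF Sum.prems] by simp
  finally show ?case by simp
next
  case (Minus e e')
  then show ?case by (simp add: le_diff_conv trans_le_add1)
qed (auto simp: fits_within_def add_mono mult_le_mono)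

text \<open>The input tape has no marker at position 0, so the way back must be counted: tape
  \<open>d + 1\<close> records how far the head has moved, and \<open>runs_rewind\<close> consumes
  that record. The end of the input shows as the first blank.\<close>

lemma runs_Until_input:
  assumes "3 \<le> d" "\<sigma> 0 = 0" "\<sigma> d = 0" "\<sigma> (d + 1) = 0"
  shows "runs x (Until 0 0 (Seq (Inc 0) (Seq (Inc d) (Inc (d + 1))))) \<sigma> y (length x * 5 + 1)
    (\<sigma>(0 := length x, d := length x, d + 1 := length x)) y"
proof -
  let ?s = "\<lambda>i. \<sigma>(0 := i, d := i, d + 1 := i)"
  have body: "scan x (?s i) 0 \<noteq> 0 \<and>
      runs x (Seq (Inc 0) (Seq (Inc d) (Inc (d + 1)))) (?s i) y 3 (?s (Suc i)) y" if "i < length x" for i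
  proof
    show "scan x (?s i) 0 \<noteq> 0" using that assms(1) by (simp add: scan_def contents_def)
    show "runs x (Seq (Inc 0) (Seq (Inc d) (Inc (d + 1)))) (?s i) y 3 (?s (Suc i)) y"
      by (rule runs_weaken[OF runs_Seq[OF runs_Inc runs_Seq[OF runs_Inc runs_Inc]]])
        (use assms(1) in \<open>auto simp: fun_eq_iff\<close>)
  qed
  have exit: "scan x (?s (length x)) 0 = 0" using assms(1) by (simp add: scan_def contents_def)
  have "runs x (Until 0 0 (Seq (Inc 0) (Seq (Inc d) (Inc (d + 1))))) (?s 0) y
      (length x * (3 + 2) + 1) (?s (length x)) y"
    by (rule runs_loop[where \<sigma> = ?s and y = "\<lambda>_. y", OF body exit])
  moreover have "?s 0 = \<sigma>" using assms by auto
  ultimately show ?thesis by simp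
qed

lemma runs_rewind:
  assumes "3 \<le> d" "\<sigma> 0 = \<sigma> d"
  shows "runs x (While d (Seq (Dec d) (Dec 0))) \<sigma> y (\<sigma> d * 4 + 1) (\<sigma>(0 := 0, d := 0)) y"
proof -
  let ?s = "\<lambda>i. \<sigma>(0 := \<sigma> d - i, d := \<sigma> d - i)"
  have body: "runs x (Seq (Dec d) (Dec 0)) (?s i) y 2 (?s (Suc i)) y" if "i < \<sigma> d" for i
    by (rule runs_weaken[OF runs_Seq[OF runs_Dec runs_Dec]])
      (use assms(1) that in \<open>auto simp: fun_eq_iff\<close>)
  have "?s 0 = \<sigma>" using assms by auto
  from runs_While[of d ?s \<sigma> x _ "\<lambda>_. y" 2, OF _ this body] assms show ?thesis by simp
qed

lemma runs_seek:
  assumes "3 \<le> d" "\<sigma> 0 = 0" "\<sigma> (d + 1) = 0"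
  shows "runs x (While d (Seq (Dec d) (Seq (Inc 0) (Inc (d + 1))))) \<sigma> y (\<sigma> d * 5 + 1)
    (\<sigma>(0 := \<sigma> d, d := 0, d + 1 := \<sigma> d)) y"
proof -
  let ?s = "\<lambda>i. \<sigma>(0 := i, d := \<sigma> d - i, d + 1 := i)"
  have body: "runs x (Seq (Dec d) (Seq (Inc 0) (Inc (d + 1)))) (?s i) y 3 (?s (Suc i)) y"
    if "i < \<sigma> d" for i
    by (rule runs_weaken[OF runs_Seq[OF runs_Dec runs_Seq[OF runs_Inc runs_Inc]]])
      (use assms(1) that in \<open>auto simp: fun_eq_iff\<close>)
  have "?s 0 = \<sigma>" using assms by auto
  from runs_While[of d ?s \<sigma> x _ "\<lambda>_. y" 3, OF _ this body] assms show ?thesis by simp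
qed

lemma runs_compile:
  assumes "represents \<tau> d \<rho> \<sigma>" "fits_within B x \<rho>"
  shows "runs x (compile \<tau> d e) \<sigma> y (time_bound e B) (\<sigma>(d := val x e \<rho>)) y"
  using assms
proof (induction e arbitrary: \<tau> d \<rho> \<sigma> B)
  case (Const k)
  then have "\<sigma> d = 0" by (simp add: represents_def)
  then show ?case
    unfolding compile.simps time_bound.simps
    by (intro runs_weaken[OF runs_repeat_Inc]) (auto simp: fun_eq_iff)
next
  case (Var v)
  then have "\<tau> v < d" "\<tau> v \<noteq> 0" "\<sigma> d = 0" "\<sigma> (d + 1) = 0" "\<sigma> (\<tau> v) = \<rho> v" "\<rho> v \<le> B"
    by (auto simp: represents_def fits_within_def intro: gr0I dest: spec[of _ v])
  then show ?case
    unfolding compile.simps time_bound.simps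
    by (intro runs_weaken[OF runs_copy_add]) (auto simp: fun_eq_iff)
next
  case (Plus e e')
  have d: "3 \<le> d" "\<sigma> (Suc d) = 0" using Plus.prems by (auto simp: represents_def)
  note v = val_le_value_bound[OF Plus.prems(2)]
  show ?case
    unfolding compile.simps time_bound.simps
    apply (rule runs_Seq[OF Plus.IH(1)[OF Plus.prems]])
    apply (rule runs_Seq)
     apply (simp only: Suc_eq_plus1[symmetric])
     apply (rule Plus.IH(2)[OF represents_upd[OF Plus.prems(1)] Plus.prems(2)])
    apply (rule runs_weaken[OF runs_move_add])
    using d v[of e'] by (auto simp: fun_eq_iff)
next
  case (Times e e')
  have d: "3 \<le> d" "\<sigma> (d + 1) = 0" "\<sigma> (d + 2) = 0" "\<sigma> (d + 3) = 0" "\<sigma> d = 0"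
    using Times.prems by (auto simp: represents_def)
  let ?m = "val x e \<rho>" and ?n = "val x e' \<rho>"
  have r1: "represents \<tau> (d + 1) \<rho> \<sigma>"
    using represents_upd[OF Times.prems(1), of 0] d by (simp add: fun_upd_idem)
  have r2: "represents \<tau> (d + 2) \<rho> (\<sigma>(d + 1 := ?m))"
    using represents_upd[OF r1] by simp
  let ?s = "\<lambda>i. \<sigma>(d + 1 := ?m - i, d + 2 := ?n, d := i * ?n)"
  have body: "runs x (Seq (Dec (d + 1)) (copy_add (d + 2) d (d + 3))) (?s i) y
      (1 + (?n * 9 + 2)) (?s (Suc i)) y" if "i < ?m" for i
    by (rule runs_weaken[OF runs_Seq[OF runs_Dec runs_copy_add]])
      (use that d in \<open>auto simp: fun_eq_iff\<close>)
  have s0: "?s 0 = \<sigma>(d + 1 := ?m, d + 2 := ?n)" using d by auto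
  note loop = runs_While[of "d + 1" ?s _ x _ "\<lambda>_. y", OF _ s0 body]
  have l: "runs x (While (d + 1) (Seq (Dec (d + 1)) (copy_add (d + 2) d (d + 3))))
      (\<sigma>(d + 1 := ?m, d + 2 := ?n)) y (?m * (1 + (?n * 9 + 2) + 2) + 1) (?s ?m) y"
    using loop by simp
  have "?m \<le> value_bound e B" "?n \<le> value_bound e' B"
    using val_le_value_bound[OF Times.prems(2)] by auto
  then show ?case
    unfolding compile.simps time_bound.simps
    apply (intro runs_weaken[OF runs_Seq[OF Times.IH(1)[OF r1 Times.prems(2)]
      runs_Seq[OF Times.IH(2)[OF r2 Times.prems(2)] runs_Seq[OF l runs_clear]]]])
      apply simp
    subgoal using d by (auto simp: fun_eq_iff)
    subgoal by (intro add_mono mult_le_mono order_refl) auto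
    done
next
  case (Minus e e')
  have d: "3 \<le> d" "\<sigma> (d + 1) = 0" "\<sigma> d = 0"
    using Minus.prems by (auto simp: represents_def)
  let ?m = "val x e \<rho>" and ?n = "val x e' \<rho>"
  have r: "represents \<tau> (d + 1) \<rho> (\<sigma>(d := ?m))"
    using represents_upd[OF Minus.prems(1)] by simp
  let ?s = "\<lambda>i. \<sigma>(d := ?m - i, d + 1 := ?n - i)"
  \<comment> \<open>\<open>Dec\<close> must not leave position 0 to the left; the test on the marker
    turns it into truncated subtraction.\<close>
  have dec: "runs x (Cond d 3 Skip (Dec d)) \<sigma>' y (1 + 2) (\<sigma>'(d := \<sigma>' d - 1)) y" for \<sigma>'
  proof (rule runs_Cond)
    assume "scan x \<sigma>' d = 3"
    then have "\<sigma>'(d := \<sigma>' d - 1) = \<sigma>'" using d(1) by (auto simp: fun_eq_iff)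
    then show "runs x Skip \<sigma>' y 1 (\<sigma>'(d := \<sigma>' d - 1)) y"
      using runs_mono[OF runs_Skip] by simp
  next
    assume "scan x \<sigma>' d \<noteq> 3"
    then show "runs x (Dec d) \<sigma>' y 1 (\<sigma>'(d := \<sigma>' d - 1)) y" using d(1) by (intro runs_Dec) simp
  qed
  have body: "runs x (Seq (Dec (d + 1)) (Cond d 3 Skip (Dec d))) (?s i) y 4 (?s (Suc i)) y"
    if "i < ?n" for i
    by (rule runs_weaken[OF runs_Seq[OF runs_Dec dec]])
      (use that d in \<open>auto simp: fun_eq_iff\<close>)
  have s0: "?s 0 = \<sigma>(d := ?m, d + 1 := ?n)" by auto
  have l: "runs x (While (d + 1) (Seq (Dec (d + 1)) (Cond d 3 Skip (Dec d))))
      (\<sigma>(d := ?m, d + 1 := ?n)) y (?n * (4 + 2) + 1) (?s ?n) y"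
    using runs_While[of "d + 1" ?s _ x _ "\<lambda>_. y", OF _ s0 body] by simp
  show ?case
    unfolding compile.simps time_bound.simps
    apply (intro runs_weaken[OF runs_Seq[OF Minus.IH(1)[OF Minus.prems]
      runs_Seq[OF Minus.IH(2)[OF r Minus.prems(2)] l]]])
    subgoal using d by (auto simp: fun_eq_iff)
    subgoal using val_le_value_bound[OF Minus.prems(2)] by auto
    done
next
  case Len
  then have d: "3 \<le> d" "\<sigma> 0 = 0" "\<sigma> d = 0" "\<sigma> (d + 1) = 0" "length x \<le> B"
    by (auto simp: represents_def fits_within_def)
  show ?case
    unfolding compile.simps time_bound.simps
    apply (rule runs_weaken[OF runs_Seq[OF runs_Until_input[OF d(1-4)] runs_rewind]])
    using d by (auto simp: fun_eq_iff)
next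
  case (Bit e)
  then have d: "3 \<le> d" "\<sigma> 0 = 0" "\<sigma> d = 0" "\<sigma> (d + 1) = 0"
    by (auto simp: represents_def)
  let ?m = "val x e \<rho>" and ?b = "val x (Bit e) \<rho>"
  let ?s = "\<sigma>(0 := ?m, d := 0, d + 1 := ?m)"
  have test: "runs x (Cond 0 2 (Inc d) Skip) ?s y (1 + 2) (?s(d := ?b)) y"
  proof (rule runs_Cond)
    assume "scan x ?s 0 = 2"
    then have "?b = 1" using d(1) by (auto simp: scan_def contents_def split: if_splits)
    then show "runs x (Inc d) ?s y 1 (?s(d := ?b)) y"
      by (intro runs_weaken[OF runs_Inc]) (use d in \<open>auto simp: fun_eq_iff\<close>)
  next
    assume "scan x ?s 0 \<noteq> 2"
    then have "?b = 0" using d(1) by (auto simp: scan_def contents_def split: if_splits)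
    then show "runs x Skip ?s y 1 (?s(d := ?b)) y"
      by (intro runs_weaken[OF runs_Skip]) (use d in \<open>auto simp: fun_eq_iff\<close>)
  qed
  have seek: "runs x (While d (Seq (Dec d) (Seq (Inc 0) (Inc (d + 1))))) (\<sigma>(d := ?m)) y (?m * 5 + 1) ?s y"
    by (rule runs_weaken[OF runs_seek]) (use d in \<open>auto simp: fun_eq_iff\<close>)
  show ?case
    unfolding compile.simps time_bound.simps
    apply (rule runs_weaken[OF runs_Seq[OF Bit.IH[OF Bit.prems] runs_Seq[OF seek
      runs_Seq[OF test runs_rewind]]]])
    using d val_le_value_bound[OF Bit.prems(2), of e] by (auto simp: fun_eq_iff)
next
  case (Sum v e e')
  have d: "3 \<le> d" "\<sigma> (d + 1) = 0" "\<sigma> (d + 2) = 0" "\<sigma> (d + 3) = 0" "\<sigma> d = 0"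
    using Sum.prems by (auto simp: represents_def)
  let ?m = "val x e \<rho>"
  define f where "f i = val x e' (\<rho>(v := i))" for i
  let ?B' = "B + value_bound e B"
  have m: "?m \<le> value_bound e B" using val_le_value_bound[OF Sum.prems(2)] by auto
  have r1: "represents \<tau> (d + 1) \<rho> \<sigma>"
    using represents_upd[OF Sum.prems(1), of 0] d by (simp add: fun_upd_idem)
  \<comment> \<open>After \<open>i\<close> rounds, tape \<open>d\<close> holds the partial sum,
    \<open>d + 1\<close> the number of rounds left, and \<open>d + 2\<close> the bound
    variable.\<close>
  let ?s = "\<lambda>i. \<sigma>(d := (\<Sum>k<i. f k), d + 1 := ?m - i, d + 2 := i)"
  have body: "runs x (Seq (Dec (d + 1)) (Seq (compile (\<tau>(v := d + 2)) (d + 3) e')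
        (Seq (move_add (d + 3) d) (Inc (d + 2))))) (?s i) y
      (1 + (time_bound e' ?B' + ((value_bound e' ?B' * 4 + 1) + 1))) (?s (Suc i)) y" if "i < ?m" for i
  proof -
    have r: "represents (\<tau>(v := d + 2)) (d + 3) (\<rho>(v := i)) ((?s i)(d + 1 := ?s i (d + 1) - 1))"
      using represents_bind[OF represents_upd[OF represents_upd[OF Sum.prems(1),
        of "\<Sum>k<i. f k"], of "?m - Suc i"], of v i]
      by (simp add: fun_upd_twist eval_nat_numeral)
    have w: "fits_within ?B' x (\<rho>(v := i))" using fits_within_upd[OF Sum.prems(2)] that m by simp
    show ?thesis
      by (rule runs_weaken[OF runs_Seq[OF runs_Dec runs_Seq[OF Sum.IH(2)[OF r w, folded f_def]
          runs_Seq[OF runs_move_add runs_Inc]]]])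
        (use that d val_le_value_bound[OF w, of e', folded f_def] in \<open>auto simp: fun_eq_iff\<close>)
  qed
  have s0: "?s 0 = \<sigma>(d + 1 := ?m)" using d by auto
  note l = runs_While[of "d + 1" ?s "\<sigma>(d + 1 := ?m)" x _ "\<lambda>_. y", OF _ s0 body]
  show ?case
    unfolding compile.simps time_bound.simps Let_def
    apply (rule runs_weaken[OF runs_Seq[OF Sum.IH(1)[OF r1 Sum.prems(2)]
      runs_Seq[OF l runs_clear]]])
    apply simp_all
    subgoal using d by (auto simp: fun_eq_iff f_def)
    subgoal using m mult_le_mono1[OF m] by (auto intro!: add_mono mult_le_mono)
    done
qed


lemma runs_compile_cmd:
  assumes "represents \<tau> d \<rho> \<sigma>" "fits_within B x \<rho>"
  shows "runs x (compile_cmd \<tau> d c) \<sigma> y (cmd_time_bound c B) \<sigma> (y @ outputs x c \<rho>)"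
  using assms
proof (induction c arbitrary: \<tau> d \<rho> \<sigma> B y)
  case (Out e)
  then have d: "3 \<le> d" "\<sigma> d = 0" by (auto simp: represents_def)
  let ?s = "\<sigma>(d := val x e \<rho>)"
  have "runs x (Cond d 3 (Emit False) (Emit True)) ?s y (1 + 2) ?s (y @ [val x e \<rho> \<noteq> 0])"
    by (rule runs_Cond) (use d runs_Emit[of x _ ?s y] in auto)
  from runs_Seq[OF runs_compile[OF Out.prems] runs_Seq[OF this runs_clear]]
  show ?case unfolding compile_cmd.simps cmd_time_bound.simps outputs.simps
    by (rule runs_weaken)
      (use d val_le_value_bound[OF Out.prems(2), of e] in \<open>auto simp: fun_eq_iff\<close>)
next
  case (Then c c')
  show ?case unfolding compile_cmd.simps cmd_time_bound.simps outputs.simps append_assoc[symmetric]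
    by (rule runs_Seq[OF Then.IH(1)[OF Then.prems] Then.IH(2)[OF Then.prems]])
next
  case (For v e c)
  have d: "3 \<le> d" "\<sigma> (d + 1) = 0" "\<sigma> d = 0"
    using For.prems by (auto simp: represents_def)
  let ?m = "val x e \<rho>"
  let ?B' = "B + value_bound e B"
  have m: "?m \<le> value_bound e B" using val_le_value_bound[OF For.prems(2)] by auto
  let ?s = "\<lambda>i. \<sigma>(d := ?m - i, d + 1 := i)"
  let ?y = "\<lambda>i. y @ concat (map (\<lambda>i. outputs x c (\<rho>(v := i))) [0..<i])"
  have body: "runs x (Seq (Dec d) (Seq (compile_cmd (\<tau>(v := d + 1)) (d + 2) c) (Inc (d + 1))))
      (?s i) (?y i) (1 + (cmd_time_bound c ?B' + 1)) (?s (Suc i)) (?y (Suc i))" if "i < ?m" for i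
  proof -
    have r: "represents (\<tau>(v := d + 1)) (d + 2) (\<rho>(v := i)) ((?s i)(d := ?s i d - 1))"
      using represents_bind[OF represents_upd[OF For.prems(1), of "?m - Suc i"], of v i]
      by (simp add: fun_upd_twist)
    have w: "fits_within ?B' x (\<rho>(v := i))" using fits_within_upd[OF For.prems(2)] that m by simp
    have y: "?y (Suc i) = ?y i @ outputs x c (\<rho>(v := i))" by simp
    show ?thesis unfolding y
      by (rule runs_weaken[OF runs_Seq[OF runs_Dec runs_Seq[OF For.IH[OF r w] runs_Inc]]])
        (use that d in \<open>auto simp: fun_eq_iff\<close>)
  qed
  have s0: "?s 0 = \<sigma>(d := ?m)" using d by auto
  note l = runs_While[of d ?s "\<sigma>(d := ?m)" x _ ?y, OF _ s0 body]
  have y0: "?y 0 = y" by simp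
  show ?case
    unfolding compile_cmd.simps cmd_time_bound.simps outputs.simps
    apply (rule runs_weaken[OF runs_Seq[OF runs_compile[OF For.prems]
      runs_Seq[OF l[unfolded y0, simplified fun_upd_same] runs_clear]]])
    using d(1) apply (simp; fail)+
    subgoal using d by (auto simp: fun_eq_iff)
    subgoal using m mult_le_mono1[OF m] by (auto intro!: add_mono mult_le_mono)
    done
qed

section \<open>Polynomial bounds and the number of tapes\<close>

definition poly_bounded :: "(nat \<Rightarrow> nat) \<Rightarrow> bool" where
  "poly_bounded f \<longleftrightarrow> (\<exists>p. \<forall>n. f n \<le> poly p n)"

lemma poly_mono_nat: "m \<le> n \<Longrightarrow> poly p m \<le> poly (p :: nat poly) n"
  by (induction p) (auto intro: add_mono mult_le_mono)

lemma poly_bounded_const [simp, intro]: "poly_bounded (\<lambda>_. k)"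
  unfolding poly_bounded_def by (intro exI[of _ "[:k:]"]) simp

lemma poly_bounded_id [simp, intro]: "poly_bounded (\<lambda>n. n)"
  unfolding poly_bounded_def by (intro exI[of _ "[:0, 1:]"]) simp

lemma poly_bounded_add [intro]: "poly_bounded f \<Longrightarrow> poly_bounded g \<Longrightarrow> poly_bounded (\<lambda>n. f n + g n)"
  unfolding poly_bounded_def by (metis add_mono poly_add)

lemma poly_bounded_mult [intro]: "poly_bounded f \<Longrightarrow> poly_bounded g \<Longrightarrow> poly_bounded (\<lambda>n. f n * g n)"
  unfolding poly_bounded_def by (metis mult_le_mono poly_mult)

text \<open>Polynomials with natural coefficients are monotone, so bounds can be substituted into
  each other, as nested sums require.\<close>

lemma poly_bounded_comp:
  assumes "poly_bounded f" "poly_bounded g"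
  shows "poly_bounded (\<lambda>n. f (g n))"
proof -
  obtain p q where "\<And>n. f n \<le> poly p n" "\<And>n. g n \<le> poly q n"
    using assms unfolding poly_bounded_def by blast
  then have "f (g n) \<le> poly (pcompose p q) n" for n
    unfolding poly_pcompose by (meson le_trans poly_mono_nat)
  then show ?thesis unfolding poly_bounded_def by blast
qed

lemma poly_bounded_shift:
  "poly_bounded f \<Longrightarrow> poly_bounded g \<Longrightarrow> poly_bounded (\<lambda>n. f (n + g n))"
  by (rule poly_bounded_comp) auto

lemma poly_bounded_value_bound: "poly_bounded (value_bound e)"
  by (induction e; simp only: value_bound.simps[abs_def])
    (auto intro!: poly_bounded_shift[of "value_bound _"])

lemma poly_bounded_time_bound: "poly_bounded (time_bound e)"
  by (induction e; simp only: time_bound.simps[abs_def] Let_def)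
    (intro poly_bounded_add poly_bounded_mult poly_bounded_const poly_bounded_id
      poly_bounded_value_bound poly_bounded_shift[of "value_bound _"] poly_bounded_shift[of "time_bound _"];
      assumption)+

lemma poly_bounded_cmd_time_bound: "poly_bounded (cmd_time_bound c)"
  by (induction c; simp only: cmd_time_bound.simps[abs_def])
    (intro poly_bounded_add poly_bounded_mult poly_bounded_const poly_bounded_id
      poly_bounded_value_bound poly_bounded_time_bound poly_bounded_shift[of "cmd_time_bound _"];
      assumption)+

text \<open>Any sufficiently large number of tapes will do; saying so with \<open>eventually\<close>
  avoids computing it and is compatible with finite conjunctions.\<close>

lemma eventually_tapes_below_repeat:
  "eventually (\<lambda>K. tapes_below K c) sequentially \<Longrightarrow> eventually (\<lambda>K. tapes_below K (repeat n c)) sequentially"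
  by (induction n) (auto simp: eventually_conj_iff)

lemma eventually_tapes_below_compile:
  assumes "2 \<le> d" "\<forall>v. 2 \<le> \<tau> v"
  shows "eventually (\<lambda>K. tapes_below K (compile \<tau> d e)) sequentially"
  using assms
proof (induction e arbitrary: \<tau> d)
  case (Var v)
  then have "2 \<le> \<tau> v" by simp
  then have "\<tau> v \<noteq> 1" by simp
  with Var show ?case
    by (simp add: eventually_conj_iff eventually_gt_at_top copy_add_def move_add_def)
qed (simp_all add: eventually_conj_iff eventually_gt_at_top copy_add_def move_add_def clear_def
        eventually_tapes_below_repeat)

lemma eventually_tapes_below_compile_cmd:
  assumes "2 \<le> d" "\<forall>v. 2 \<le> \<tau> v"
  shows "eventually (\<lambda>K. tapes_below K (compile_cmd \<tau> d c)) sequentially"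
  using assms
  by (induction c arbitrary: \<tau> d)
    (simp_all add: eventually_conj_iff eventually_gt_at_top clear_def eventually_tapes_below_compile)

theorem polytime_outputs: "polytime (\<lambda>x. outputs x c (\<lambda>_. 0))"
proof -
  \<comment> \<open>Outside all loops every variable is 0, so all of them can share tape 2, which
    stays at 0; each loop moves its variable to a tape of its own.\<close>
  let ?c = "compile_cmd (\<lambda>_. 2) 3 c"
  have "eventually (\<lambda>K. tapes_below K ?c \<and> 2 \<le> K) sequentially"
    by (intro eventually_conj eventually_tapes_below_compile_cmd eventually_ge_at_top) auto
  then obtain K where K: "tapes_below K ?c" "2 \<le> K"
    unfolding eventually_sequentially by blast
  obtain p where p: "\<And>n. cmd_time_bound c n \<le> poly p n"
    using poly_bounded_cmd_time_bound[of c] by (auto simp: poly_bounded_def)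
  have "\<exists>t\<le>poly p (length x). \<exists>\<sigma>. exec x ?c (\<lambda>_. 0, []) t (\<sigma>, outputs x c (\<lambda>_. 0))" for x
  proof -
    have "runs x ?c (\<lambda>_. 0) [] (cmd_time_bound c (length x)) (\<lambda>_. 0) ([] @ outputs x c (\<lambda>_. 0))"
      by (rule runs_compile_cmd) (auto simp: represents_def fits_within_def)
    then show ?thesis unfolding runs_def using order_trans[OF _ p] by auto
  qed
  then show ?thesis by (rule polytime_exec[OF K])
qed

section \<open>Formulas as arithmetic terms\<close>

definition tr :: "bool list \<Rightarrow> expr \<Rightarrow> env \<Rightarrow> bool" where
  "tr x e \<rho> \<longleftrightarrow> val x e \<rho> \<noteq> 0"

text \<open>Truth is being nonzero, so conjunction, disjunction and bounded existence are product,
  sum and \<open>Sum\<close>. Truncated subtraction does the rest: \<open>1 - e\<close> negates any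
  value, and \<open>e' - e\<close> is nonzero exactly if \<open>e\<close> is the smaller
  one.\<close>

definition Neg :: "expr \<Rightarrow> expr" where "Neg e = Minus (Const 1) e"
definition Conj :: "expr \<Rightarrow> expr \<Rightarrow> expr" where "Conj e e' = Times e e'"
definition Disj :: "expr \<Rightarrow> expr \<Rightarrow> expr" where "Disj e e' = Plus e e'"
definition Imp :: "expr \<Rightarrow> expr \<Rightarrow> expr" where "Imp e e' = Disj (Neg e) e'"
definition BEx :: "nat \<Rightarrow> expr \<Rightarrow> expr \<Rightarrow> expr" where "BEx v e e' = Sum v e e'"
definition BAll :: "nat \<Rightarrow> expr \<Rightarrow> expr \<Rightarrow> expr" where "BAll v e e' = Neg (BEx v e (Neg e'))"
definition Less :: "expr \<Rightarrow> expr \<Rightarrow> expr" where "Less e e' = Minus e' e"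
definition Leq :: "expr \<Rightarrow> expr \<Rightarrow> expr" where "Leq e e' = Neg (Less e' e)"
definition Equal :: "expr \<Rightarrow> expr \<Rightarrow> expr" where "Equal e e' = Conj (Leq e e') (Leq e' e)"
definition Conjs :: "expr list \<Rightarrow> expr" where "Conjs es = foldr Conj es (Const 1)"
definition Disjs :: "expr list \<Rightarrow> expr" where "Disjs es = foldr Disj es (Const 0)"

lemma tr_Const [simp]: "tr x (Const k) \<rho> \<longleftrightarrow> k \<noteq> 0"
  and tr_Var [simp]: "tr x (Var v) \<rho> \<longleftrightarrow> \<rho> v \<noteq> 0"
  and tr_Bit [simp]: "tr x (Bit e) \<rho> \<longleftrightarrow> val x e \<rho> < length x \<and> x ! val x e \<rho>"
  and tr_Neg [simp]: "tr x (Neg e) \<rho> \<longleftrightarrow> \<not> tr x e \<rho>"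
  and tr_Conj [simp]: "tr x (Conj e e') \<rho> \<longleftrightarrow> tr x e \<rho> \<and> tr x e' \<rho>"
  and tr_Disj [simp]: "tr x (Disj e e') \<rho> \<longleftrightarrow> tr x e \<rho> \<or> tr x e' \<rho>"
  and tr_Less [simp]: "tr x (Less e e') \<rho> \<longleftrightarrow> val x e \<rho> < val x e' \<rho>"
  and tr_BEx [simp]: "tr x (BEx v e e') \<rho> \<longleftrightarrow> (\<exists>i<val x e \<rho>. tr x e' (\<rho>(v := i)))"
  by (auto simp: tr_def Neg_def Conj_def Disj_def Less_def BEx_def)

lemma tr_Imp [simp]: "tr x (Imp e e') \<rho> \<longleftrightarrow> (tr x e \<rho> \<longrightarrow> tr x e' \<rho>)"
  and tr_BAll [simp]: "tr x (BAll v e e') \<rho> \<longleftrightarrow> (\<forall>i<val x e \<rho>. tr x e' (\<rho>(v := i)))"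
  and tr_Leq [simp]: "tr x (Leq e e') \<rho> \<longleftrightarrow> val x e \<rho> \<le> val x e' \<rho>"
  by (auto simp: Imp_def BAll_def Leq_def)

lemma tr_Equal [simp]: "tr x (Equal e e') \<rho> \<longleftrightarrow> val x e \<rho> = val x e' \<rho>"
  by (auto simp: Equal_def)

lemma tr_Conjs [simp]: "tr x (Conjs es) \<rho> \<longleftrightarrow> (\<forall>e\<in>set es. tr x e \<rho>)"
  unfolding Conjs_def by (induction es) auto

lemma tr_Disjs [simp]: "tr x (Disjs es) \<rho> \<longleftrightarrow> (\<exists>e\<in>set es. tr x e \<rho>)"
  unfolding Disjs_def by (induction es) auto

lemma outputs_Out: "outputs x (Out e) \<rho> = [tr x e \<rho>]"
  by (simp add: tr_def)

definition poly_expr :: "nat poly \<Rightarrow> expr \<Rightarrow> expr" where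
  "poly_expr p e = foldr (\<lambda>a e'. Plus (Const a) (Times e e')) (coeffs p) (Const 0)"

lemma val_poly_expr [simp]: "val x (poly_expr p e) \<rho> = poly p (val x e \<rho>)"
proof -
  have "val x (foldr (\<lambda>a e'. Plus (Const a) (Times e e')) as (Const 0)) \<rho> =
      foldr (\<lambda>a b. a + val x e \<rho> * b) as 0" for as
    by (induction as) auto
  then show ?thesis by (simp add: poly_expr_def poly_def fold_coeffs_def horner_sum_foldr comp_def)
qed

section \<open>Disjoint connected subgraphs\<close>

abbreviation adj_rel :: "'v set set \<Rightarrow> 'v rel" where
  "adj_rel E \<equiv> {(x, y). {x, y} \<in> E}"

lemma adj_rel_rtrancl_sym: "(u, v) \<in> (adj_rel E)\<^sup>* \<Longrightarrow> (v, u) \<in> (adj_rel E)\<^sup>*"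
proof -
  have "sym (adj_rel E)" by (auto simp: sym_def insert_commute)
  then show "(u, v) \<in> (adj_rel E)\<^sup>* \<Longrightarrow> (v, u) \<in> (adj_rel E)\<^sup>*"
    by (meson sym_rtrancl symD)
qed

lemma connected_graphI:
  assumes "r \<in> V" "\<And>v. v \<in> V \<Longrightarrow> (r, v) \<in> (adj_rel E)\<^sup>*"
  shows "connected_graph (V, E)"
proof -
  have "(u, v) \<in> (adj_rel E)\<^sup>*" if "u \<in> V" "v \<in> V" for u v
    using adj_rel_rtrancl_sym[OF assms(2)[OF that(1)]] assms(2)[OF that(2)] by (rule rtrancl_trans)
  then show ?thesis using assms(1) by (auto simp: connected_graph_def)
qed

text \<open>Serves as a cut argument: a set that no edge leaves contains every vertex as soon as it
  contains one.\<close>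

lemma connected_graph_closed:
  assumes "connected_graph (V, E)" "u \<in> V" "u \<in> U" "v \<in> V"
    and closed: "\<And>x y. x \<in> U \<Longrightarrow> {x, y} \<in> E \<Longrightarrow> y \<in> U"
  shows "v \<in> U"
proof -
  have "(u, v) \<in> (adj_rel E)\<^sup>*" using assms(1,2,4) by (auto simp: connected_graph_def)
  then show ?thesis by induction (use assms(3) closed in auto)
qed

text \<open>The removed edge closes the cycle; the other edges of the cycle still join its two ends,
  so every walk can be rerouted.\<close>

lemma connected_graph_remove_cycle_edge:
  assumes "connected_graph (V, E)" "is_cycle (V, E) c"
  shows "\<exists>e\<in>E. connected_graph (V, E - {e})"
proof -
  let ?n = "length c"
  have n: "3 \<le> ?n" and dist: "distinct c"
    and edge: "\<And>i. i < ?n \<Longrightarrow> {c ! i, c ! (Suc i mod ?n)} \<in> E"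
    using assms(2) by (auto simp: is_cycle_def)
  let ?e = "{c ! (?n - 1), c ! 0}"
  let ?F = "E - {?e}"
  have "Suc (?n - 1) = ?n" "c \<noteq> []" using n by auto
  then have e: "?e \<in> E" using edge[of "?n - 1"] by simp
  have step: "(c ! i, c ! Suc i) \<in> adj_rel ?F" if "Suc i < ?n" for i
  proof -
    have "{c ! i, c ! Suc i} \<in> E" using edge[of i] that by simp
    \<comment> \<open>Equality would give \<open>i = 0\<close> and \<open>Suc i = ?n - 1\<close>,
      hence a cycle on two vertices.\<close>
    moreover have "{c ! i, c ! Suc i} \<noteq> ?e"
    proof
      assume eq: "{c ! i, c ! Suc i} = ?e"
      have "c ! Suc i \<noteq> c ! 0" using dist that n by (subst nth_eq_iff_index_eq) auto
      then have "c ! i = c ! 0" "c ! Suc i = c ! (?n - 1)" using eq by (metis doubleton_eq_iff)+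
      then have "i = 0" "Suc i = ?n - 1"
        using nth_eq_iff_index_eq[OF dist, of i 0] nth_eq_iff_index_eq[OF dist, of "Suc i" "?n - 1"] that n
          \<open>c \<noteq> []\<close>
        by simp_all
      then show False using n by simp
    qed
    ultimately show ?thesis by simp
  qed
  have path: "(c ! 0, c ! i) \<in> (adj_rel ?F)\<^sup>*" if "i < ?n" for i
    using that
  proof (induction i)
    case (Suc i)
    then show ?case using step[of i] by (meson Suc_lessD rtrancl.rtrancl_into_rtrancl)
  qed simp
  have "(c ! 0, c ! (?n - 1)) \<in> (adj_rel ?F)\<^sup>*" using path n by simp
  then have "adj_rel E \<subseteq> (adj_rel ?F)\<^sup>*"
    using adj_rel_rtrancl_sym[of "c ! 0" "c ! (?n - 1)" ?F] by (auto simp: doubleton_eq_iff)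
  then have "(adj_rel E)\<^sup>* \<subseteq> (adj_rel ?F)\<^sup>*" by (rule rtrancl_subset_rtrancl)
  then have "connected_graph (V, ?F)" using assms(1) unfolding connected_graph_def by auto
  with e show ?thesis by blast
qed

text \<open>A connected subgraph on \<open>V\<close> with the fewest edges has no cycle, since a
  cycle would offer an edge to remove.\<close>

lemma ex_spanning_tree:
  assumes "simple_graph (V, E)" "connected_graph (V, E)"
  shows "\<exists>F\<subseteq>E. is_tree (V, F)"
proof -
  have finE: "finite E" using finite_edges[OF assms(1)] by simp
  let ?P = "\<lambda>F. F \<subseteq> E \<and> connected_graph (V, F)"
  obtain F where F: "?P F" "\<And>F'. ?P F' \<Longrightarrow> card F \<le> card F'"
    using ex_has_least_nat[of ?P E card] assms(2) by blast
  have "\<not> is_cycle (V, F) c" for c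
  proof
    assume "is_cycle (V, F) c"
    then obtain e where e: "e \<in> F" "connected_graph (V, F - {e})"
      using connected_graph_remove_cycle_edge F(1) by blast
    have "card (F - {e}) < card F"
      using e(1) F(1) finE by (meson card_Diff1_less finite_subset)
    moreover have "card F \<le> card (F - {e})" using F e(2) by blast
    ultimately show False by simp
  qed
  moreover have "simple_graph (V, F)" using assms(1) F(1) by (auto simp: simple_graph_def)
  ultimately show ?thesis using F(1) unfolding is_tree_def by blast
qed

text \<open>Trees are relaxed to connected subgraphs and a set of trees to an indexed family, so
  that neither a certificate nor a construction has to care about cycles or about
  distinctness.\<close>

definition disjoint_connected :: "'v graph \<Rightarrow> 'v set \<Rightarrow> nat \<Rightarrow> (nat \<Rightarrow> 'v set) \<Rightarrow> (nat \<Rightarrow> 'v set set) \<Rightarrow> bool"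
  where
  "disjoint_connected G S q V E \<longleftrightarrow>
     (\<forall>t<q. connected_graph (V t, E t) \<and> S \<subseteq> V t \<and> V t \<subseteq> fst G \<and> E t \<subseteq> snd G \<and> \<Union> (E t) \<subseteq> V t) \<and>
     (\<forall>t<q. \<forall>t'<q. t \<noteq> t' \<longrightarrow> V t \<inter> V t' \<subseteq> S \<and> E t \<inter> E t' = {})"

lemma connected_graph_edge:
  assumes "connected_graph (V, E)" "u \<in> V" "v \<in> V" "u \<noteq> v"
  shows "\<exists>w. {u, w} \<in> E"
proof -
  have "(u, v) \<in> (adj_rel E)\<^sup>*" using assms by (auto simp: connected_graph_def)
  then show ?thesis using assms(4) by (auto elim: converse_rtranclE)
qed

text \<open>For the converse, spanning trees are taken. Two indices cannot yield the same tree: with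
  two terminals every tree has an edge, and the edge sets are disjoint. Thus the set of trees does
  have \<open>q\<close> elements.\<close>

lemma le_kappa_iff_disjoint_connected:
  assumes G: "simple_graph G" and S: "2 \<le> card S"
  shows "q \<le> kappa G S \<longleftrightarrow> (\<exists>V E. disjoint_connected G S q V E)"
proof
  assume "q \<le> kappa G S"
  then obtain \<T> where \<T>: "internally_disjoint_trees G S \<T>" "card \<T> = q"
    using le_kappa_iff[OF G] by blast
  then obtain h where h: "bij_betw h {..<q} \<T>"
    using ex_bij_betw_nat_finite[OF finite_internally_disjoint_trees[OF G \<T>(1)]]
    unfolding atLeast0LessThan \<T>(2) by blast
  have tc: "tree_connecting G S (h t)" if "t < q" for t
    using \<T>(1) h that by (auto simp: internally_disjoint_trees_def bij_betw_def)
  have dj: "snd (h t) \<inter> snd (h t') = {} \<and> fst (h t) \<inter> fst (h t') = S"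
    if "t < q" "t' < q" "t \<noteq> t'" for t t'
  proof -
    have "h t \<noteq> h t'" "h t \<in> \<T>" "h t' \<in> \<T>"
      using h that by (auto simp: bij_betw_def inj_on_def)
    then show ?thesis using \<T>(1) by (simp add: internally_disjoint_trees_def)
  qed
  have "disjoint_connected G S q (fst \<circ> h) (snd \<circ> h)"
    unfolding disjoint_connected_def
  proof (intro conjI allI impI)
    fix t assume t: "t < q"
    show "connected_graph ((fst \<circ> h) t, (snd \<circ> h) t)" "S \<subseteq> (fst \<circ> h) t" "(fst \<circ> h) t \<subseteq> fst G"
      "(snd \<circ> h) t \<subseteq> snd G"
      using tc[OF t] by (auto simp: tree_connecting_def is_tree_def)
    show "\<Union> ((snd \<circ> h) t) \<subseteq> (fst \<circ> h) t"
      using tc[OF t] by (auto simp: tree_connecting_def is_tree_def simple_graph_def)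
  next
    fix t t' assume t: "t < q" "t' < q" "t \<noteq> t'"
    show "(fst \<circ> h) t \<inter> (fst \<circ> h) t' \<subseteq> S" "(snd \<circ> h) t \<inter> (snd \<circ> h) t' = {}"
      using dj[OF t] by auto
  qed
  then show "\<exists>V E. disjoint_connected G S q V E" by blast
next
  assume "\<exists>V E. disjoint_connected G S q V E"
  then obtain V E where "disjoint_connected G S q V E" by blast
  then have
    1: "\<And>t. t < q \<Longrightarrow> connected_graph (V t, E t) \<and> S \<subseteq> V t \<and> V t \<subseteq> fst G \<and> E t \<subseteq> snd G \<and> \<Union> (E t) \<subseteq> V t"
    and 2: "\<And>t t'. t < q \<Longrightarrow> t' < q \<Longrightarrow> t \<noteq> t' \<Longrightarrow> V t \<inter> V t' \<subseteq> S \<and> E t \<inter> E t' = {}"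
    by (simp_all add: disjoint_connected_def)
  have "\<exists>F\<subseteq>E t. is_tree (V t, F)" if "t < q" for t
  proof (rule ex_spanning_tree)
    show "connected_graph (V t, E t)" using 1[OF that] by simp
    have "finite (V t)" using 1[OF that] G by (meson finite_subset simple_graph_def)
    moreover have "card e = 2" if "e \<in> E t" for e
      using 1[OF \<open>t < q\<close>] that G by (auto simp: simple_graph_def)
    ultimately show "simple_graph (V t, E t)"
      using 1[OF that] by (auto simp: simple_graph_def)
  qed
  then obtain F where F: "\<And>t. t < q \<Longrightarrow> F t \<subseteq> E t \<and> is_tree (V t, F t)" by metis
  let ?T = "\<lambda>t. (V t, F t)"
  have ne: "F t \<noteq> {}" if "t < q" for t
  proof -
    obtain u v where "u \<in> S" "v \<in> S" "u \<noteq> v"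
      using S by (auto simp: card_le_Suc_iff numeral_2_eq_2)
    moreover have "u \<in> V t" "v \<in> V t" using 1[OF that] calculation by auto
    ultimately show ?thesis
      using connected_graph_edge[of "V t" "F t" u v] F[OF that] by (auto simp: is_tree_def)
  qed
  have "inj_on ?T {..<q}"
  proof (rule inj_onI, rule ccontr)
    fix t t' assume t: "t \<in> {..<q}" "t' \<in> {..<q}" "?T t = ?T t'" "t \<noteq> t'"
    then have "F t \<subseteq> E t \<inter> E t'" using F[of t] F[of t'] by auto
    then show False using 2[of t t'] ne[of t] t by auto
  qed
  then have "card (?T ` {..<q}) = q" by (simp add: card_image)
  moreover have "internally_disjoint_trees G S (?T ` {..<q})"
    unfolding internally_disjoint_trees_def
  proof (intro conjI ballI impI)
    fix T assume "T \<in> ?T ` {..<q}"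
    then show "tree_connecting G S T" using F 1 by (fastforce simp: tree_connecting_def)
  next
    fix T T' assume "T \<in> ?T ` {..<q}" "T' \<in> ?T ` {..<q}" "T \<noteq> T'"
    then obtain t t' where t: "t < q" "t' < q" "t \<noteq> t'" "T = ?T t" "T' = ?T t'" by auto
    show "snd T \<inter> snd T' = {}" using F[OF t(1)] F[OF t(2)] 2[OF t(1-3)] t(4,5) by auto
    show "fst T \<inter> fst T' = S" using 1[OF t(1)] 1[OF t(2)] 2[OF t(1-3)] t(4,5) by auto
  qed
  ultimately show "q \<le> kappa G S" using le_kappa_iff[OF G] by blast
qed

section \<open>Membership in NP\<close>

lemma pair_Nil: "pair [] u = False # u"
  by (simp add: pair_def)

lemma pair_Cons: "pair (b # x) u = True # b # pair x u"
  by (simp add: pair_def)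

lemma length_pair: "length (pair x u) = 2 * length x + 1 + length u"
  by (induction x) (auto simp: pair_Nil pair_Cons)

lemma pair_nth_mark: "i < length x \<Longrightarrow> pair x u ! (2 * i)"
proof (induction x arbitrary: i)
  case (Cons b x)
  then show ?case by (cases i) (auto simp: pair_Cons)
qed simp

lemma pair_nth_fst: "i < length x \<Longrightarrow> pair x u ! (2 * i + 1) = x ! i"
proof (induction x arbitrary: i)
  case (Cons b x)
  then show ?case by (cases i) (auto simp: pair_Cons)
qed simp

lemma pair_nth_separator: "\<not> pair x u ! (2 * length x)"
  by (induction x) (auto simp: pair_Nil pair_Cons)

lemma pair_nth_snd: "pair x u ! (2 * length x + 1 + i) = u ! i"
  by (induction x) (auto simp: pair_Nil pair_Cons)

lemma length_encode: "length (encode n E S k) = n + 1 + n * n + n + k"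
  by (simp add: encode_def)

lemma mult_add_less:
  fixes i j m n :: nat
  assumes "i < m" "j < n"
  shows "i * n + j < m * n"
proof -
  have "i * n + j < Suc i * n" using assms by simp
  also have "\<dots> \<le> m * n" using assms by (intro mult_le_mono) auto
  finally show ?thesis .
qed

lemma encode_nth:
  "i < n \<Longrightarrow> encode n E S k ! i"
  "\<not> encode n E S k ! n"
  "i < n \<Longrightarrow> j < n \<Longrightarrow> encode n E S k ! (n + 1 + (i * n + j)) \<longleftrightarrow> {i, j} \<in> E"
  "i < n \<Longrightarrow> encode n E S k ! (n + 1 + n * n + i) \<longleftrightarrow> i \<in> S"
  "i < k \<Longrightarrow> encode n E S k ! (n + 1 + n * n + n + i)"
proof -
  let ?M = "map (\<lambda>(i, j). {i, j} \<in> E) (List.product [0..<n] [0..<n])"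
  let ?S = "map (\<lambda>i. i \<in> S) [0..<n]"
  let ?T = "[False] @ ?M @ ?S @ replicate k True"
  have e: "encode n E S k = replicate n True @ False # ?M @ ?S @ replicate k True"
    by (simp add: encode_def)
  have sh: "encode n E S k ! (n + 1 + l) = (?M @ ?S @ replicate k True) ! l" for l
    unfolding e by (simp add: nth_append)
  have sh2: "encode n E S k ! (n + 1 + n * n + l) = (?S @ replicate k True) ! l" for l
    using sh[of "n * n + l"] by (simp add: nth_append add.assoc)
  show "i < n \<Longrightarrow> encode n E S k ! i" "\<not> encode n E S k ! n" by (simp_all add: e nth_append)
  show "encode n E S k ! (n + 1 + (i * n + j)) \<longleftrightarrow> {i, j} \<in> E" if "i < n" "j < n"
  proof -
    have "i * n + j < n * n" using mult_add_less[OF that] .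
    then show ?thesis unfolding sh using that by (simp add: nth_append product_nth)
  qed
  show "i < n \<Longrightarrow> encode n E S k ! (n + 1 + n * n + i) \<longleftrightarrow> i \<in> S"
    unfolding sh2 by (simp add: nth_append)
  show "i < k \<Longrightarrow> encode n E S k ! (n + 1 + n * n + n + i)"
    using sh2[of "n + i"] by (simp add: nth_append add.assoc)
qed

lemma eq_encodeI:
  assumes len: "length x = n + 1 + n * n + n + k"
    and "\<forall>i<n. x ! i" "\<not> x ! n"
    and mat: "\<forall>i<n. \<forall>j<n. x ! (n + 1 + (i * n + j)) = ({i, j} \<in> E)"
    and vec: "\<forall>i<n. x ! (n + 1 + n * n + i) = (i \<in> S)"
    and ones: "\<forall>i<k. x ! (n + 1 + n * n + n + i)"
  shows "x = encode n E S k"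
proof (rule nth_equalityI)
  show "length x = length (encode n E S k)" using len by (simp add: length_encode)
  fix l assume "l < length x"
  then consider "l < n" | "l = n" | "n + 1 \<le> l" "l < n + 1 + n * n"
    | "n + 1 + n * n \<le> l" "l < n + 1 + n * n + n" | "n + 1 + n * n + n \<le> l" "l < n + 1 + n * n + n + k"
    unfolding len by linarith
  then show "x ! l = encode n E S k ! l"
  proof cases
    case 3
    define p where "p = l - (n + 1)"
    have p: "l = n + 1 + p" "p < n * n" using 3 by (auto simp: p_def)
    then have "0 < n" by (cases n) auto
    then have "p div n < n" "p mod n < n" "p = p div n * n + p mod n"
      using p(2) by (auto simp: less_mult_imp_div_less)
    then show ?thesis
      using mat encode_nth(3)[of "p div n" n "p mod n" E S k] p(1) by metis
  next
    case 4
    define p where "p = l - (n + 1 + n * n)"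
    have "l = n + 1 + n * n + p" "p < n" using 4 by (auto simp: p_def)
    then show ?thesis using vec encode_nth(4)[of p n E S k] by metis
  next
    case 5
    define p where "p = l - (n + 1 + n * n + n)"
    have "l = n + 1 + n * n + n + p" "p < k" using 5 by (auto simp: p_def)
    then show ?thesis using ones encode_nth(5)[of p k n E S] by metis
  qed (use assms(2,3) encode_nth(1)[of l n E S k] encode_nth(2)[of n E S k] in auto)
qed

text \<open>The bit \<open>cert_index n t i j d\<close> of a certificate tells that vertex \<open>i\<close> of the \<open>t\<close>-th
  subgraph is at the end of a walk of length \<open>d\<close> from the root, with last edge \<open>{j, i}\<close>.\<close>

definition cert_index :: "nat \<Rightarrow> nat \<Rightarrow> nat \<Rightarrow> nat \<Rightarrow> nat \<Rightarrow> nat" where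
  "cert_index n t i j d = ((t * n + i) * n + j) * (n * n + 1) + d"

text \<open>Descending from a hit of positive depth leads to a hit of depth 0, whose vertex is the
  only root; this expresses connectedness without quantifying over walks. The second vertex of a bit
  of depth 0 is arbitrary. Shared edges are excluded in both orientations, because a bit names an
  ordered pair.\<close>

definition cert_ok :: "nat \<Rightarrow> (nat \<Rightarrow> nat \<Rightarrow> bool) \<Rightarrow> (nat \<Rightarrow> bool) \<Rightarrow> nat \<Rightarrow> (nat \<Rightarrow> nat \<Rightarrow> nat \<Rightarrow> nat \<Rightarrow> bool) \<Rightarrow> bool"
  where
  "cert_ok n adj S k U \<longleftrightarrow>
    (\<forall>t<k. (\<forall>i<n. \<forall>j<n. \<forall>d<n * n + 1. U t i j d \<longrightarrow> d = 0 \<or> adj i j \<and> (\<exists>l<n. U t j l (d - 1))) \<and>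
      (\<forall>i<n. \<forall>j<n. \<forall>i'<n. \<forall>j'<n. U t i j 0 \<and> U t i' j' 0 \<longrightarrow> i = i') \<and>
      (\<forall>i<n. S i \<longrightarrow> (\<exists>d<n * n + 1. \<exists>l<n. U t i l d)) \<and>
      (\<forall>t'<k. t \<noteq> t' \<longrightarrow>
        (\<forall>i<n. (\<exists>d<n * n + 1. \<exists>l<n. U t i l d) \<and> (\<exists>d<n * n + 1. \<exists>l<n. U t' i l d) \<longrightarrow> S i) \<and>
        (\<forall>i<n. \<forall>j<n. (\<exists>d<n * n + 1. d \<noteq> 0 \<and> U t i j d) \<longrightarrow>
           \<not> (\<exists>d<n * n + 1. d \<noteq> 0 \<and> U t' i j d) \<and> \<not> (\<exists>d<n * n + 1. d \<noteq> 0 \<and> U t' j i d))))"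

lemma cert_ok_imp_le_kappa:
  assumes cert: "cert_ok n (\<lambda>i j. {i, j} \<in> E) (\<lambda>i. i \<in> S) k U"
    and G: "simple_graph ({..<n}, E)" and S: "S \<subseteq> {..<n}" "2 \<le> card S"
  shows "k \<le> kappa ({..<n}, E) S"
proof -
  let ?D = "n * n + 1"
  define hit where "hit t i d \<longleftrightarrow> i < n \<and> d < ?D \<and> (\<exists>l<n. U t i l d)" for t i d
  define V where "V t = {i. \<exists>d. hit t i d}" for t
  define F where "F t = {{i, j} | i j. i < n \<and> j < n \<and> (\<exists>d<?D. d \<noteq> 0 \<and> U t i j d)}" for t
  note c = cert[unfolded cert_ok_def, rule_format]
  note c1 = conjunct1[OF c, rule_format]
    and c2 = conjunct1[OF conjunct2[OF c], rule_format, OF _ _ _ _ _ conjI]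
    and c3 = conjunct1[OF conjunct2[OF conjunct2[OF c]], rule_format]
  note c4 = conjunct2[OF conjunct2[OF conjunct2[OF c]], rule_format]
  note c5 = conjunct1[OF c4, rule_format, OF _ _ _ _ conjI] and c6 = conjunct2[OF c4, rule_format]
  have step: "{i, j} \<in> E \<and> hit t j (d - 1)" if "t < k" "i < n" "j < n" "d < ?D" "U t i j d" "d \<noteq> 0" for t i j d
  proof -
    have "{i, j} \<in> E \<and> (\<exists>l<n. U t j l (d - 1))" using c1[OF that(1-5)] that(6) by blast
    then show ?thesis using that by (auto simp: hit_def)
  qed
  have "disjoint_connected ({..<n}, E) S k V F"
    unfolding disjoint_connected_def
  proof (intro conjI allI impI)
    fix t assume t: "t < k"
    show SV: "S \<subseteq> V t"
    proof
      fix i assume "i \<in> S"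
      moreover from this have "i < n" using S by auto
      ultimately show "i \<in> V t" using c3[OF t] unfolding V_def hit_def by blast
    qed
    show "V t \<subseteq> fst ({..<n}, E)" by (auto simp: V_def hit_def)
    show "F t \<subseteq> snd ({..<n}, E)" using step[OF t] by (auto simp: F_def)
    show "\<Union> (F t) \<subseteq> V t"
    proof -
      have "i \<in> V t \<and> j \<in> V t" if "i < n" "j < n" "d < ?D" "d \<noteq> 0" "U t i j d" for i j d
        using step[OF t that(1-3,5,4)] that unfolding V_def hit_def by blast
      then show ?thesis unfolding F_def by blast
    qed
    \<comment> \<open>Induction on the depth; each step down crosses an edge of
      \<open>F t\<close>.\<close>
    have root: "\<exists>r. hit t r 0 \<and> (r, i) \<in> (adj_rel (F t))\<^sup>*" if "hit t i d" for i d
      using that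
    proof (induction d arbitrary: i)
      case 0
      then show ?case by blast
    next
      case (Suc d)
      then obtain j where j: "i < n" "Suc d < ?D" "j < n" "U t i j (Suc d)" unfolding hit_def by blast
      then have "hit t j d" using step[OF t j(1,3,2,4)] by simp
      then obtain r where r: "hit t r 0" "(r, j) \<in> (adj_rel (F t))\<^sup>*" using Suc.IH by blast
      have "{i, j} \<in> F t" unfolding F_def using j by blast
      then have "(j, i) \<in> adj_rel (F t)" by (simp add: insert_commute)
      with r show ?case by (meson rtrancl.rtrancl_into_rtrancl)
    qed
    have unique: "r = r'" if "hit t r 0" "hit t r' 0" for r r'
      using c2[OF t] that unfolding hit_def by blast
    obtain s where "s \<in> S" using S(2) by fastforce
    then obtain d where "hit t s d" using SV by (auto simp: V_def)
    then obtain r where r: "hit t r 0" using root by blast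
    show "connected_graph (V t, F t)"
    proof (rule connected_graphI)
      show "r \<in> V t" using r by (auto simp: V_def)
      fix v assume "v \<in> V t"
      then obtain r' where "hit t r' 0" "(r', v) \<in> (adj_rel (F t))\<^sup>*" using root by (auto simp: V_def)
      then show "(r, v) \<in> (adj_rel (F t))\<^sup>*" using unique[OF r] by blast
    qed
  next
    fix t t' assume t: "t < k" "t' < k" "t \<noteq> t'"
    have "i \<in> S" if "i < n" "(\<exists>d<?D. \<exists>l<n. U t i l d)" "(\<exists>d<?D. \<exists>l<n. U t' i l d)" for i
      by (rule c5[OF t that])
    then show "V t \<inter> V t' \<subseteq> S" unfolding V_def hit_def by blast
    have no: "\<not> (\<exists>d<?D. d \<noteq> 0 \<and> U t' i j d) \<and> \<not> (\<exists>d<?D. d \<noteq> 0 \<and> U t' j i d)"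
      if "i < n" "j < n" "(\<exists>d<?D. d \<noteq> 0 \<and> U t i j d)" for i j
      by (rule c6[OF t that])
    show "F t \<inter> F t' = {}"
    proof (rule ccontr)
      assume "F t \<inter> F t' \<noteq> {}"
      then obtain i j i' j' where "i < n" "j < n" "\<exists>d<?D. d \<noteq> 0 \<and> U t i j d"
        "\<exists>d<?D. d \<noteq> 0 \<and> U t' i' j' d" "{i, j} = {i', j'}"
        unfolding F_def by blast
      then show False using no[of i j] by (auto simp: doubleton_eq_iff)
    qed
  qed
  then show ?thesis using le_kappa_iff_disjoint_connected[OF G S(2)] by blast
qed

lemma le_kappa_imp_cert_ok:
  assumes k: "k \<le> kappa ({..<n}, E) S"
    and G: "simple_graph ({..<n}, E)" and S: "S \<subseteq> {..<n}" "2 \<le> card S"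
  shows "\<exists>U. cert_ok n (\<lambda>i j. {i, j} \<in> E) (\<lambda>i. i \<in> S) k U"
proof -
  let ?D = "n * n + 1"
  obtain V F where VF: "disjoint_connected ({..<n}, E) S k V F"
    using le_kappa_iff_disjoint_connected[OF G S(2)] k by blast
  have conn: "connected_graph (V t, F t)" and SV: "S \<subseteq> V t" and Vn: "V t \<subseteq> {..<n}" and FE: "F t \<subseteq> E"
    and FV: "\<Union> (F t) \<subseteq> V t" if "t < k" for t
    using VF that by (simp_all add: disjoint_connected_def)
  have disj: "V t \<inter> V t' \<subseteq> S" "F t \<inter> F t' = {}" if "t < k" "t' < k" "t \<noteq> t'" for t t'
    using VF that unfolding disjoint_connected_def by blast+
  obtain s where s: "s \<in> S" using S(2) by fastforce
  define R where "R t = adj_rel (F t)" for t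
  \<comment> \<open>All subgraphs are rooted at one terminal \<open>s\<close>. Every walk from
    \<open>s\<close> is recorded, so a vertex may be hit at several depths.\<close>
  define U where "U t i j d \<longleftrightarrow> i \<in> V t \<and> (if d = 0 then i = s \<and> j = s
      else {i, j} \<in> F t \<and> (s, j) \<in> R t ^^ (d - 1))" for t i j d
  have reach: "\<exists>l<n. U t i l d" if t: "t < k" and i: "i \<in> V t" and d: "(s, i) \<in> R t ^^ d" for t i d
  proof (cases d)
    case 0
    then have "i = s" using d by simp
    then show ?thesis using 0 i s S(1) by (auto simp: U_def)
  next
    case (Suc e)
    then obtain j where j: "(s, j) \<in> R t ^^ e" "(j, i) \<in> R t" using d by auto
    then have "{i, j} \<in> F t" by (simp add: R_def insert_commute)
    moreover from this have "j < n" using FV[OF t] Vn[OF t] by auto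
    ultimately show ?thesis using i j(1) Suc by (auto simp: U_def)
  qed
  have member: "\<exists>d<?D. \<exists>l<n. U t i l d" if t: "t < k" and i: "i \<in> V t" for t i
  proof -
    \<comment> \<open>Origin of the depth range: a pair in the closure of a finite relation is
      linked by at most as many steps as the relation has elements, here at most
      \<open>n * n\<close>.\<close>
    have RR: "R t \<subseteq> {..<n} \<times> {..<n}" using FV[OF t] Vn[OF t] by (auto simp: R_def)
    then have fin: "finite (R t)" by (rule finite_subset) simp
    have "card (R t) \<le> n * n" using card_mono[OF _ RR] by simp
    moreover have "(s, i) \<in> (R t)\<^sup>*"
      using conn[OF t] i s SV[OF t] by (auto simp: connected_graph_def R_def)
    then obtain d where "d \<le> card (R t)" "(s, i) \<in> R t ^^ d"
      unfolding rtrancl_finite_eq_relpow[OF fin] by blast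
    ultimately have "d < ?D" "\<exists>l<n. U t i l d" using reach[OF t i] by auto
    then show ?thesis by blast
  qed
  have inV: "i \<in> V t" if "U t i j d" for t i j d using that by (simp add: U_def)
  have inF: "{i, j} \<in> F t" if "U t i j d" "d \<noteq> 0" for t i j d using that by (simp add: U_def)
  have "cert_ok n (\<lambda>i j. {i, j} \<in> E) (\<lambda>i. i \<in> S) k U"
    unfolding cert_ok_def
  proof (intro conjI allI impI)
    fix t i j d assume t: "t < k" and *: "i < n" "j < n" "d < ?D" "U t i j d"
    show "d = 0 \<or> {i, j} \<in> E \<and> (\<exists>l<n. U t j l (d - 1))"
    proof (cases "d = 0")
      case False
      have ij: "{i, j} \<in> F t" "(s, j) \<in> R t ^^ (d - 1)" using *(4) False by (auto simp: U_def)
      then have "j \<in> V t" using FV[OF t] by auto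
      then show ?thesis using ij reach[OF t] FE[OF t] by auto
    qed simp
  next
    fix t i j i' j' assume "U t i j 0 \<and> U t i' j' 0"
    then show "i = i'" by (simp add: U_def)
  next
    fix t i assume "t < k" "i < n" "i \<in> S"
    then show "\<exists>d<?D. \<exists>l<n. U t i l d" using member SV by blast
  next
    fix t t' i assume t: "t < k" "t' < k" "t \<noteq> t'"
      and "(\<exists>d<?D. \<exists>l<n. U t i l d) \<and> (\<exists>d<?D. \<exists>l<n. U t' i l d)"
    then have "i \<in> V t \<inter> V t'" using inV by blast
    then show "i \<in> S" using disj(1)[OF t] by blast
  next
    fix t t' i j assume t: "t < k" "t' < k" "t \<noteq> t'" and "\<exists>d<?D. d \<noteq> 0 \<and> U t i j d"
    then have "{i, j} \<in> F t" using inF by blast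
    then have no: "{i, j} \<notin> F t'" using disj(2)[OF t] by blast
    show "\<not> (\<exists>d<?D. d \<noteq> 0 \<and> U t' i j d)" using no inF by blast
    show "\<not> (\<exists>d<?D. d \<noteq> 0 \<and> U t' j i d)" using no inF[of t' j i] by (auto simp: insert_commute)
  qed
  then show ?thesis by blast
qed


section \<open>Instances and certificates as bit strings\<close>

text \<open>\<open>X\<close> and \<open>Y\<close> read the bits of the instance and of the
  certificate. The numbers \<open>n\<close> and \<open>k\<close> are not decoded but guessed; the
  conditions on \<open>L\<close> and \<open>X\<close> pin them down.\<close>

definition instance_ok ::
    "nat \<Rightarrow> nat \<Rightarrow> (nat \<Rightarrow> bool) \<Rightarrow> (nat \<Rightarrow> bool) \<Rightarrow> nat \<Rightarrow> nat \<Rightarrow> bool" where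
  "instance_ok k\<^sub>1 L X Y n k \<longleftrightarrow>
     L = n + 1 + n * n + n + k \<and> 2 \<le> k \<and> k < n \<and> (\<forall>i<n. X i) \<and> \<not> X n \<and>
     (\<forall>i<n. \<not> X (n + 1 + (i * n + i))) \<and>
     (\<forall>i<n. \<forall>j<n. X (n + 1 + (i * n + j)) \<longrightarrow> X (n + 1 + (j * n + i))) \<and>
     (\<Sum>i<n. if X (n + 1 + n * n + i) then 1 else 0) = k\<^sub>1 \<and> (\<forall>i<k. X (n + 1 + n * n + n + i)) \<and>
     cert_ok n (\<lambda>i j. X (n + 1 + (i * n + j))) (\<lambda>i. X (n + 1 + n * n + i)) k
       (\<lambda>t i j d. Y (cert_index n t i j d))"

lemma cert_ok_cong:
  assumes "\<And>i j. i < n \<Longrightarrow> j < n \<Longrightarrow> adj i j = adj' i j" "\<And>i. i < n \<Longrightarrow> S i = S' i"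
    and "\<And>t i j d. t < k \<Longrightarrow> i < n \<Longrightarrow> j < n \<Longrightarrow> d < n * n + 1 \<Longrightarrow> U t i j d = U' t i j d"
  shows "cert_ok n adj S k U = cert_ok n adj' S' k U'"
  unfolding cert_ok_def using assms
  by (simp cong: imp_cong conj_cong)

lemma cert_index_less:
  assumes "t < k" "i < n" "j < n" "d < n * n + 1"
  shows "cert_index n t i j d < k * n * n * (n * n + 1)"
  unfolding cert_index_def using assms by (intro mult_add_less)

lemma cert_index_inject:
  assumes "i < n" "j < n" "d < n * n + 1"
  shows "cert_index n t i j d mod (n * n + 1) = d"
    "cert_index n t i j d div (n * n + 1) mod n = j"
    "cert_index n t i j d div (n * n + 1) div n mod n = i"
    "cert_index n t i j d div (n * n + 1) div n div n = t"
  using assms unfolding cert_index_def by (simp_all only: div_mult_self3 mod_mult_self3 mod_less div_less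
      div_mult_self4 mod_mult_self4 add_0_right less_zeroE neq0_conv)

text \<open>The verifier reads the instance inside \<open>pair x u\<close>, where reading too far
  would run into the certificate. The length condition comes to the rescue: once it holds,
  \<open>X\<close> is only consulted below \<open>L\<close>.\<close>

lemma instance_ok_cong:
  assumes X: "\<And>i. i < L \<Longrightarrow> X i = X' i"
    and Y: "\<And>t i j d. t < k \<Longrightarrow> i < n \<Longrightarrow> j < n \<Longrightarrow> d < n * n + 1 \<Longrightarrow>
      Y (cert_index n t i j d) = Y' (cert_index n t i j d)"
  shows "instance_ok k\<^sub>1 L X Y n k = instance_ok k\<^sub>1 L X' Y' n k"
proof (cases "L = n + 1 + n * n + n + k \<and> 2 \<le> k \<and> k < n")
  case True
  then have L: "L = n + 1 + n * n + n + k" by simp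
  have 1: "X i = X' i" if "i < n" for i using that by (intro X) (simp add: L)
  have 2: "X n = X' n" by (intro X) (simp add: L)
  have 3: "X (n + 1 + (i * n + j)) = X' (n + 1 + (i * n + j))" if "i < n" "j < n" for i j
    using mult_add_less[OF that] by (intro X) (simp add: L)
  have 4: "X (n + 1 + n * n + i) = X' (n + 1 + n * n + i)" if "i < n" for i
    using that by (intro X) (simp add: L)
  have 5: "X (n + 1 + n * n + n + i) = X' (n + 1 + n * n + n + i)" if "i < k" for i
    using that by (intro X) (simp add: L)
  have 6: "(\<Sum>i<n. if X (n + 1 + n * n + i) then 1 else 0) =
      (\<Sum>i<n. if X' (n + 1 + n * n + i) then 1 else (0 :: nat))"
    using 4 by (intro sum.cong) auto
  have 7: "cert_ok n (\<lambda>i j. X (n + 1 + (i * n + j))) (\<lambda>i. X (n + 1 + n * n + i)) k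
       (\<lambda>t i j d. Y (cert_index n t i j d)) =
     cert_ok n (\<lambda>i j. X' (n + 1 + (i * n + j))) (\<lambda>i. X' (n + 1 + n * n + i)) k
       (\<lambda>t i j d. Y' (cert_index n t i j d))"
    using 3 4 Y by (rule cert_ok_cong)
  show ?thesis unfolding instance_ok_def 6 7 2 using 1 3 5 by (simp only: cong: imp_cong)
next
  case False
  then show ?thesis unfolding instance_ok_def by blast
qed

lemma instance_ok_encode:
  assumes "instance_ok k\<^sub>1 (length x) (\<lambda>i. x ! i) Y n k" "2 \<le> k\<^sub>1"
  shows "x \<in> internally_disjoint_trees_problem k\<^sub>1"
proof -
  let ?adj = "\<lambda>i j. x ! (n + 1 + (i * n + j))"
  let ?S = "{i. i < n \<and> x ! (n + 1 + n * n + i)}"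
  let ?E = "{{i, j} | i j. i < n \<and> j < n \<and> ?adj i j}"
  note ok = assms(1)[unfolded instance_ok_def]
  have irr: "\<not> ?adj i i" if "i < n" for i using ok that by blast
  have sym: "?adj i j \<Longrightarrow> ?adj j i" if "i < n" "j < n" for i j using ok that by blast
  have E: "{i, j} \<in> ?E \<longleftrightarrow> ?adj i j" if "i < n" "j < n" for i j
    using that sym by (auto simp: doubleton_eq_iff)
  have G: "simple_graph ({..<n}, ?E)"
    unfolding simple_graph_def
  proof (intro conjI ballI)
    fix e assume "e \<in> snd ({..<n}, ?E)"
    then obtain i j where e: "e = {i, j}" "i < n" "j < n" "?adj i j" by auto
    then have "i \<noteq> j" using irr by blast
    with e show "e \<subseteq> fst ({..<n}, ?E)" "card e = 2" by auto
  qed simp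
  have "card ?S = k\<^sub>1"
    using ok by (simp add: sum.If_cases Int_def)
  moreover have "x = encode n ?E ?S k"
    by (rule eq_encodeI) (use ok E in auto)
  moreover have "cert_ok n (\<lambda>i j. {i, j} \<in> ?E) (\<lambda>i. i \<in> ?S) k (\<lambda>t i j d. Y (cert_index n t i j d))"
    using ok by (subst cert_ok_cong[where adj' = ?adj]) (use E in auto)
  then have "k \<le> kappa ({..<n}, ?E) ?S"
    using G \<open>card ?S = k\<^sub>1\<close> assms(2) by (intro cert_ok_imp_le_kappa) auto
  moreover have "2 \<le> k" "k \<le> n - 1" using ok by auto
  ultimately show ?thesis
    unfolding internally_disjoint_trees_problem_def using G
    by (intro CollectI exI[of _ n] exI[of _ ?E] exI[of _ ?S] exI[of _ k]) auto
qed

lemma instance_ok_if_problem: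
  assumes "x \<in> internally_disjoint_trees_problem k\<^sub>1" "2 \<le> k\<^sub>1"
  shows "\<exists>n k u. k < n \<and> n \<le> length x \<and> length u = k * n * n * (n * n + 1) \<and>
    instance_ok k\<^sub>1 (length x) (\<lambda>i. x ! i) (\<lambda>i. i < length u \<and> u ! i) n k"
proof -
  obtain n E S k where x: "x = encode n E S k" and G: "simple_graph ({..<n}, E)"
    and S: "S \<subseteq> {..<n}" "card S = k\<^sub>1" and k: "2 \<le> k" "k \<le> n - 1" "k \<le> kappa ({..<n}, E) S"
    using assms(1) by (auto simp: internally_disjoint_trees_problem_def)
  obtain U where U: "cert_ok n (\<lambda>i j. {i, j} \<in> E) (\<lambda>i. i \<in> S) k U"
    using le_kappa_imp_cert_ok[OF k(3) G S(1)] S(2) assms(2) by blast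
  let ?D = "n * n + 1"
  define u where "u = map (\<lambda>l. U (l div ?D div n div n) (l div ?D div n mod n) (l div ?D mod n) (l mod ?D))
    [0..<k * n * n * ?D]"
  have u: "cert_index n t i j d < length u \<and> u ! cert_index n t i j d \<longleftrightarrow> U t i j d"
    if "t < k" "i < n" "j < n" "d < ?D" for t i j d
    using cert_index_less[OF that] cert_index_inject[OF that(2-4), of t] by (simp add: u_def)
  have C: "cert_ok n (\<lambda>i j. x ! (n + 1 + (i * n + j))) (\<lambda>i. x ! (n + 1 + n * n + i)) k
      (\<lambda>t i j d. cert_index n t i j d < length u \<and> u ! cert_index n t i j d)"
    using U by (subst cert_ok_cong[where U' = U]) (use u in \<open>auto simp only: x encode_nth\<close>)
  have "card {i. i < n \<and> i \<in> S} = k\<^sub>1"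
    using S by (metis (no_types, lifting) Collect_cong Collect_mem_eq lessThan_iff subsetD)
  moreover have "{i. i < n \<and> x ! (n + 1 + n * n + i)} = {i. i < n \<and> i \<in> S}"
    unfolding x using encode_nth(4) by blast
  ultimately have "(\<Sum>i<n. if x ! (n + 1 + n * n + i) then 1 else 0) = k\<^sub>1"
    by (simp add: sum.If_cases Int_def)
  moreover have "{i, i} \<notin> E" for i
  proof
    assume "{i, i} \<in> E"
    then have "card {i, i} = 2" using G by (auto simp: simple_graph_def)
    then show False by simp
  qed
  ultimately have "instance_ok k\<^sub>1 (length x) (\<lambda>i. x ! i) (\<lambda>i. i < length u \<and> u ! i) n k"
    unfolding instance_ok_def using C k
    by (simp only: x encode_nth length_encode insert_commute cong: imp_cong) auto
  moreover have "length u = k * n * n * ?D" by (simp add: u_def)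
  moreover have "n \<le> length x" "k < n" using k by (auto simp: x length_encode)
  ultimately show ?thesis by blast
qed

section \<open>The verifier as a term\<close>

definition fst_bit :: "expr \<Rightarrow> expr" where
  "fst_bit e = Bit (Plus (Times (Const 2) e) (Const 1))"

definition adj_expr :: "expr \<Rightarrow> expr \<Rightarrow> expr" where
  "adj_expr i j = fst_bit (Plus (Plus (Var 1) (Const 1)) (Plus (Times i (Var 1)) j))"

definition member_expr :: "expr \<Rightarrow> expr" where
  "member_expr i = fst_bit (Plus (Plus (Plus (Var 1) (Const 1)) (Times (Var 1) (Var 1))) i)"

definition depth_expr :: expr where
  "depth_expr = Plus (Times (Var 1) (Var 1)) (Const 1)"

definition cert_expr :: "expr \<Rightarrow> expr \<Rightarrow> expr \<Rightarrow> expr \<Rightarrow> expr" where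
  "cert_expr t i j d = Bit (Plus (Plus (Times (Const 2) (Var 0)) (Const 1))
     (Plus (Times (Plus (Times (Plus (Times t (Var 1)) i) (Var 1)) j) depth_expr) d))"

definition hit_expr :: "expr \<Rightarrow> expr \<Rightarrow> expr" where
  "hit_expr t i = BEx 20 depth_expr (BEx 21 (Var 1) (cert_expr t i (Var 21) (Var 20)))"

definition edge_expr :: "expr \<Rightarrow> expr \<Rightarrow> expr \<Rightarrow> expr" where
  "edge_expr t i j = BEx 20 depth_expr (Conj (Var 20) (cert_expr t i j (Var 20)))"

text \<open>Variables 0, 1, 2 hold the length of the instance, its order \<open>n\<close> and the number \<open>k\<^sub>2\<close>;
  3 and 4 range over trees, 5 to 8 over vertices and 9 over depths.\<close>

definition cert_ok_expr :: expr where
  "cert_ok_expr = BAll 3 (Var 2) (Conjs [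
     BAll 5 (Var 1) (BAll 6 (Var 1) (BAll 9 depth_expr (Imp (cert_expr (Var 3) (Var 5) (Var 6) (Var 9))
       (Disj (Equal (Var 9) (Const 0)) (Conj (adj_expr (Var 5) (Var 6))
         (BEx 7 (Var 1) (cert_expr (Var 3) (Var 6) (Var 7) (Minus (Var 9) (Const 1))))))))),
     BAll 5 (Var 1) (BAll 6 (Var 1) (BAll 7 (Var 1) (BAll 8 (Var 1)
       (Imp (Conj (cert_expr (Var 3) (Var 5) (Var 6) (Const 0)) (cert_expr (Var 3) (Var 7) (Var 8) (Const 0)))
         (Equal (Var 5) (Var 7)))))),
     BAll 5 (Var 1) (Imp (member_expr (Var 5)) (hit_expr (Var 3) (Var 5))),
     BAll 4 (Var 2) (Imp (Neg (Equal (Var 3) (Var 4))) (Conj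
       (BAll 5 (Var 1) (Imp (Conj (hit_expr (Var 3) (Var 5)) (hit_expr (Var 4) (Var 5))) (member_expr (Var 5))))
       (BAll 5 (Var 1) (BAll 6 (Var 1) (Imp (edge_expr (Var 3) (Var 5) (Var 6))
         (Conj (Neg (edge_expr (Var 4) (Var 5) (Var 6))) (Neg (edge_expr (Var 4) (Var 6) (Var 5)))))))))])"

definition instance_ok_expr :: "nat \<Rightarrow> expr" where
  "instance_ok_expr k\<^sub>1 = Conjs [
     Equal (Var 0) (Plus (Plus (Plus (Plus (Var 1) (Const 1)) (Times (Var 1) (Var 1))) (Var 1)) (Var 2)),
     Leq (Const 2) (Var 2), Less (Var 2) (Var 1), BAll 3 (Var 1) (fst_bit (Var 3)), Neg (fst_bit (Var 1)),
     BAll 3 (Var 1) (Neg (adj_expr (Var 3) (Var 3))),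
     BAll 3 (Var 1) (BAll 4 (Var 1) (Imp (adj_expr (Var 3) (Var 4)) (adj_expr (Var 4) (Var 3)))),
     Equal (Sum 3 (Var 1) (member_expr (Var 3))) (Const k\<^sub>1),
     BAll 3 (Var 2) (fst_bit
       (Plus (Plus (Plus (Plus (Var 1) (Const 1)) (Times (Var 1) (Var 1))) (Var 1)) (Var 3))),
     cert_ok_expr]"

text \<open>The length of the instance is the only \<open>L\<close> for which the even positions
  below \<open>2 * L\<close> hold \<open>True\<close> and position \<open>2 * L\<close> holds
  \<open>False\<close>. It is found by bounded search, like \<open>n\<close> and
  \<open>k\<close>.\<close>

definition verifier :: "nat \<Rightarrow> expr" where
  "verifier k\<^sub>1 = BEx 0 Len (Conjs [
     BAll 1 (Var 0) (Bit (Times (Const 2) (Var 1))), Less (Times (Const 2) (Var 0)) Len,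
     Neg (Bit (Times (Const 2) (Var 0))),
     BEx 1 (Plus (Var 0) (Const 1)) (BEx 2 (Var 1) (instance_ok_expr k\<^sub>1))])"

lemma tr_instance_ok_expr:
  assumes "\<rho> 0 = L" "\<rho> 1 = n" "\<rho> 2 = k"
  shows "tr y (instance_ok_expr k\<^sub>1) \<rho> \<longleftrightarrow>
    instance_ok k\<^sub>1 L (\<lambda>i. 2 * i + 1 < length y \<and> y ! (2 * i + 1))
      (\<lambda>i. 2 * L + 1 + i < length y \<and> y ! (2 * L + 1 + i)) n k"
proof -
  note defs = fst_bit_def adj_expr_def member_expr_def depth_expr_def cert_expr_def hit_expr_def edge_expr_def
  have "tr y cert_ok_expr \<rho> \<longleftrightarrow> cert_ok n
      (\<lambda>i j. 2 * (n + 1 + (i * n + j)) + 1 < length y \<and> y ! (2 * (n + 1 + (i * n + j)) + 1))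
      (\<lambda>i. 2 * (n + 1 + n * n + i) + 1 < length y \<and> y ! (2 * (n + 1 + n * n + i) + 1)) k
      (\<lambda>t i j d. 2 * L + 1 + cert_index n t i j d < length y \<and> y ! (2 * L + 1 + cert_index n t i j d))"
    unfolding cert_ok_def cert_ok_expr_def defs cert_index_def
    by (simp only: tr_Const tr_Var tr_Bit tr_Neg tr_Conj tr_Disj tr_Less tr_BEx tr_Imp tr_BAll tr_Leq tr_Equal
        tr_Conjs val.simps list.set ball_simps insert_iff empty_iff simp_thms assms fun_upd_apply
        num.simps numeral_eq_iff zero_neq_numeral numeral_eq_one_iff one_eq_numeral_iff zero_neq_one if_True if_False)
  moreover have "val y (Bit e) \<rho>' = (if tr y (Bit e) \<rho>' then 1 else 0)" for e \<rho>' by simp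
  ultimately show ?thesis
    unfolding instance_ok_def instance_ok_expr_def defs
    using assms by (simp add: fun_upd_apply)
qed

lemma tr_verifier:
  "tr (pair x u) (verifier k\<^sub>1) (\<lambda>_. 0) \<longleftrightarrow> (\<exists>n k. k < n \<and> n \<le> length x \<and>
    instance_ok k\<^sub>1 (length x) (\<lambda>i. x ! i) (\<lambda>i. i < length u \<and> u ! i) n k)"
proof -
  let ?y = "pair x u"
  let ?I = "\<lambda>L n k. instance_ok k\<^sub>1 L (\<lambda>i. 2 * i + 1 < length ?y \<and> ?y ! (2 * i + 1))
      (\<lambda>i. 2 * L + 1 + i < length ?y \<and> ?y ! (2 * L + 1 + i)) n k"
  let ?Q = "\<lambda>L. (\<forall>i<L. 2 * i < length ?y \<and> ?y ! (2 * i)) \<and>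
      2 * L < length ?y \<and> \<not> ?y ! (2 * L) \<and> (\<exists>n<L + 1. \<exists>k<n. ?I L n k)"
  have "tr ?y (verifier k\<^sub>1) (\<lambda>_. 0) \<longleftrightarrow> (\<exists>L<length ?y. ?Q L)"
    unfolding verifier_def by (simp add: tr_instance_ok_expr del: One_nat_def cong: conj_cong)
  also have "\<dots> \<longleftrightarrow> (\<exists>n<length x + 1. \<exists>k<n. ?I (length x) n k)"
  proof
    assume "\<exists>L<length ?y. ?Q L"
    then obtain L where L: "\<forall>i<L. 2 * i < length ?y \<and> ?y ! (2 * i)" "\<not> ?y ! (2 * L)"
      "\<exists>n<L + 1. \<exists>k<n. ?I L n k" by blast
    have "\<not> L < length x" using pair_nth_mark L(2) by blast
    moreover have "\<not> length x < L" using pair_nth_separator L(1) by blast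
    ultimately have "L = length x" by simp
    with L(3) show "\<exists>n<length x + 1. \<exists>k<n. ?I (length x) n k" by simp
  next
    assume "\<exists>n<length x + 1. \<exists>k<n. ?I (length x) n k"
    then show "\<exists>L<length ?y. ?Q L"
      using pair_nth_mark[of _ x u] pair_nth_separator[of x u]
      by (intro exI[of _ "length x"]) (auto simp: length_pair)
  qed
  finally have tr: "tr ?y (verifier k\<^sub>1) (\<lambda>_. 0) \<longleftrightarrow> (\<exists>n<length x + 1. \<exists>k<n. ?I (length x) n k)" .
  have I: "?I (length x) n k = instance_ok k\<^sub>1 (length x) (\<lambda>i. x ! i) (\<lambda>i. i < length u \<and> u ! i) n k" for n k
    by (rule instance_ok_cong)
      (simp_all only: length_pair pair_nth_snd pair_nth_fst add_less_cancel_left, simp_all)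
  have "(\<exists>n<length x + 1. \<exists>k<n. P n k) \<longleftrightarrow> (\<exists>n k. k < n \<and> n \<le> length x \<and> P n k)" for P
    by (auto simp: less_Suc_eq_le)
  then show ?thesis unfolding tr I .
qed

theorem internally_disjoint_trees_problem_in_NP:
  assumes "2 \<le> k\<^sub>1"
  shows "internally_disjoint_trees_problem k\<^sub>1 \<in> NP"
proof -
  let ?v = "\<lambda>y. outputs y (Out (verifier k\<^sub>1)) (\<lambda>_. 0)"
  \<comment> \<open>From the certificate length \<open>k * n * n * (n * n + 1)\<close>, with
    \<open>k\<close> and \<open>n\<close> at most the length of the instance.\<close>
  let ?p = "monom 1 5 + monom 1 3 :: nat poly"
  have "x \<in> internally_disjoint_trees_problem k\<^sub>1 \<longleftrightarrow>
      (\<exists>u. length u \<le> poly ?p (length x) \<and> ?v (pair x u) = [True])" for x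
  proof
    assume "x \<in> internally_disjoint_trees_problem k\<^sub>1"
    then obtain n k u where nk: "k < n" "n \<le> length x" and u: "length u = k * n * n * (n * n + 1)"
      and ok: "instance_ok k\<^sub>1 (length x) (\<lambda>i. x ! i) (\<lambda>i. i < length u \<and> u ! i) n k"
      using instance_ok_if_problem assms by blast
    have "length u \<le> length x * length x * length x * (length x * length x + 1)"
      unfolding u using nk by (intro mult_le_mono add_mono) auto
    also have "\<dots> = poly ?p (length x)" by (simp add: poly_monom algebra_simps eval_nat_numeral)
    finally have "length u \<le> poly ?p (length x)" .
    moreover have "?v (pair x u) = [True]" using tr_verifier nk ok unfolding outputs_Out by blast
    ultimately show "\<exists>u. length u \<le> poly ?p (length x) \<and> ?v (pair x u) = [True]" by blast
  next
    assume "\<exists>u. length u \<le> poly ?p (length x) \<and> ?v (pair x u) = [True]"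
    then obtain u where "tr (pair x u) (verifier k\<^sub>1) (\<lambda>_. 0)" unfolding outputs_Out by auto
    then show "x \<in> internally_disjoint_trees_problem k\<^sub>1"
      unfolding tr_verifier using instance_ok_encode assms by blast
  qed
  then show ?thesis unfolding NP_def using polytime_outputs[of "Out (verifier k\<^sub>1)"] by blast
qed

section \<open>Satisfiability as a problem on trees\<close>

text \<open>Lets trees be indexed by vertices, namely the neighbours of a terminal.\<close>

lemma le_kappa_family:
  assumes "simple_graph G" "2 \<le> card S" "finite I"
    and "\<And>i. i \<in> I \<Longrightarrow> connected_graph (V i, E i)"
    and "\<And>i. i \<in> I \<Longrightarrow> S \<subseteq> V i \<and> V i \<subseteq> fst G \<and> E i \<subseteq> snd G \<and> \<Union> (E i) \<subseteq> V i"
    and "\<And>i j. i \<in> I \<Longrightarrow> j \<in> I \<Longrightarrow> i \<noteq> j \<Longrightarrow> V i \<inter> V j \<subseteq> S \<and> E i \<inter> E j = {}"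
  shows "card I \<le> kappa G S"
proof -
  obtain h where h: "bij_betw h {..<card I} I"
    using ex_bij_betw_nat_finite[OF assms(3)] unfolding atLeast0LessThan by blast
  then have "h t \<in> I" if "t < card I" for t using that by (auto simp: bij_betw_def)
  moreover have "h t \<noteq> h t'" if "t < card I" "t' < card I" "t \<noteq> t'" for t t'
    using h that by (auto simp: bij_betw_def inj_on_def)
  ultimately have "disjoint_connected G S (card I) (V \<circ> h) (E \<circ> h)"
    unfolding disjoint_connected_def using assms(4-6) by simp
  then show ?thesis using le_kappa_iff_disjoint_connected[OF assms(1,2)] by blast
qed

text \<open>\<open>False\<close> travels upwards and from \<open>m - 1\<close> back to 0. So a
  \<open>False\<close> anywhere makes index 0 \<open>False\<close>, and from 0 it reaches every
  index. This turns local choices on the cycle of a variable into one truth value.\<close>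

lemma cyclic_constant:
  fixes P :: "nat \<Rightarrow> bool"
  assumes step: "\<And>i. i < m \<Longrightarrow> \<not> P i \<Longrightarrow> \<not> P (Suc i mod m)" and i: "i < m"
  shows "P i = P 0"
proof -
  have fwd: "\<not> P (j + d)" if "\<not> P j" "j + d < m" for j d
    using that(2)
  proof (induction d)
    case 0
    show ?case using that(1) by simp
  next
    case (Suc d)
    then show ?case using step[of "j + d"] by simp
  qed
  have "\<not> P i" if "\<not> P 0" using fwd[OF that, of i] i by simp
  moreover have "\<not> P 0" if "\<not> P i"
  proof -
    have "\<not> P (m - 1)" using fwd[OF that, of "m - 1 - i"] i by simp
    then have "\<not> P (Suc (m - 1) mod m)" using i by (intro step) auto
    moreover have "Suc (m - 1) = m" using i by simp
    ultimately show ?thesis by simp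
  qed
  ultimately show ?thesis by blast
qed

definition index :: "nat \<Rightarrow> nat \<Rightarrow> nat \<Rightarrow> nat \<Rightarrow> nat \<Rightarrow> nat" where
  "index V m \<tau> X i = (\<tau> * V + X) * m + i"

lemma index_inject:
  assumes "index V m \<tau> X i = index V m \<tau>' X' i'" "X < V" "X' < V" "i < m" "i' < m"
  shows "\<tau> = \<tau>' \<and> X = X' \<and> i = i'"
proof -
  have "i = index V m \<tau> X i mod m" "\<tau> * V + X = index V m \<tau> X i div m"
    using assms(2-) by (auto simp: index_def)
  moreover have "i' = index V m \<tau>' X' i' mod m" "\<tau>' * V + X' = index V m \<tau>' X' i' div m"
    using assms(2-) by (auto simp: index_def)
  ultimately have i: "i = i'" and e: "\<tau> * V + X = \<tau>' * V + X'" using assms(1) by metis+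
  have "X = (\<tau> * V + X) mod V" "\<tau> = (\<tau> * V + X) div V"
    "X' = (\<tau>' * V + X') mod V" "\<tau>' = (\<tau>' * V + X') div V"
    using assms(2-) by auto
  with i e show ?thesis by metis
qed

lemma index_eq_iff:
  "X < V \<Longrightarrow> X' < V \<Longrightarrow> i < m \<Longrightarrow> i' < m \<Longrightarrow>
    index V m \<tau> X i = index V m \<tau>' X' i' \<longleftrightarrow> \<tau> = \<tau>' \<and> X = X' \<and> i = i'"
  using index_inject by blast

lemma index_less:
  assumes "\<tau> < T" "X < V" "i < m"
  shows "index V m \<tau> X i < T * V * m"
proof -
  have "\<tau> * V + X < Suc \<tau> * V" using assms by simp
  also have "\<dots> \<le> T * V" using assms by (intro mult_le_mono) auto
  finally have "Suc (\<tau> * V + X) * m \<le> T * V * m" by (intro mult_le_mono) auto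
  then show ?thesis using assms by (simp add: index_def)
qed

text \<open>Each variable \<open>X\<close> has a cycle through \<open>Src X i\<close>, \<open>Tip True X i\<close>, \<open>Snk X i\<close>, \<open>Tip False X (i - 1)\<close>,
  \<open>Src X (i - 1)\<close>, \<dots> in which the sources must be joined to the sinks either all through the
  \<open>True\<close> tips or all through the \<open>False\<close> tips; clause \<open>i\<close> needs a tip left over at index \<open>i\<close>.\<close>

datatype vertex = Src nat nat | Snk nat nat | Tip bool nat nat | Cls nat | Fin nat | Term nat

text \<open>Each edge is listed in one direction only. \<open>Tip s X i\<close> is left over when
  \<open>X\<close> has the value \<open>\<not> s\<close>, which is why clause \<open>i\<close> sees
  it for the literal of sign \<open>\<not> s\<close>.\<close>

fun arc :: "nat \<Rightarrow> (nat \<Rightarrow> bool \<Rightarrow> nat \<Rightarrow> bool) \<Rightarrow> vertex \<Rightarrow> vertex \<Rightarrow> bool" where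
  "arc m lit (Term j) (Src X i) \<longleftrightarrow> j \<noteq> 1"
| "arc m lit (Term j) (Snk X i) \<longleftrightarrow> j = 1"
| "arc m lit (Term j) (Cls i) \<longleftrightarrow> j \<noteq> 2"
| "arc m lit (Term j) (Fin i) \<longleftrightarrow> j = 2"
| "arc m lit (Src X i) (Tip s Y j) \<longleftrightarrow> X = Y \<and> i = j"
| "arc m lit (Tip s X i) (Snk Y j) \<longleftrightarrow> X = Y \<and> j = (if s then i else Suc i mod m)"
| "arc m lit (Cls i) (Tip s X j) \<longleftrightarrow> i = j \<and> lit X (\<not> s) i"
| "arc m lit (Fin i) (Tip s X j) \<longleftrightarrow> i = j \<and> lit X (\<not> s) i"
| "arc m lit _ _ \<longleftrightarrow> False"

fun valid :: "nat \<Rightarrow> nat \<Rightarrow> nat \<Rightarrow> vertex \<Rightarrow> bool" where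
  "valid k V m (Src X i) \<longleftrightarrow> X < V \<and> i < m"
| "valid k V m (Snk X i) \<longleftrightarrow> X < V \<and> i < m"
| "valid k V m (Tip s X i) \<longleftrightarrow> X < V \<and> i < m"
| "valid k V m (Cls i) \<longleftrightarrow> i < m"
| "valid k V m (Fin i) \<longleftrightarrow> i < m"
| "valid k V m (Term j) \<longleftrightarrow> j < k"

text \<open>The leading digit is the kind of vertex. \<open>Cls\<close>, \<open>Fin\<close> and
  \<open>Term\<close> do not exhaust their digits; numbers that label no vertex become isolated
  vertices of the graph.\<close>

fun label :: "nat \<Rightarrow> nat \<Rightarrow> vertex \<Rightarrow> nat" where
  "label V m (Src X i) = index V m 0 X i"
| "label V m (Snk X i) = index V m 1 X i"
| "label V m (Tip s X i) = index V m (if s then 2 else 3) X i"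
| "label V m (Cls i) = index V m 4 0 i"
| "label V m (Fin i) = index V m 5 0 i"
| "label V m (Term j) = index V m (6 + j) 0 0"

definition sat_edges :: "nat \<Rightarrow> nat \<Rightarrow> nat \<Rightarrow> (nat \<Rightarrow> bool \<Rightarrow> nat \<Rightarrow> bool) \<Rightarrow> nat set set" where
  "sat_edges k V m lit =
     {{label V m u, label V m v} | u v. valid k V m u \<and> valid k V m v \<and> arc m lit u v}"

definition sat_terminals :: "nat \<Rightarrow> nat \<Rightarrow> nat \<Rightarrow> nat set" where
  "sat_terminals k V m = label V m ` Term ` {..<k}"

definition satisfiable :: "nat \<Rightarrow> nat \<Rightarrow> (nat \<Rightarrow> bool \<Rightarrow> nat \<Rightarrow> bool) \<Rightarrow> bool" where
  "satisfiable V m lit \<longleftrightarrow> (\<exists>\<sigma>. \<forall>i<m. \<exists>X<V. lit X (\<sigma> X) i)"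

section \<open>Trees in the graph of a satisfiability instance\<close>

locale sat_graph =
  fixes k V m :: nat and lit :: "nat \<Rightarrow> bool \<Rightarrow> nat \<Rightarrow> bool"
  assumes k: "3 \<le> k" and V: "0 < V" and m: "0 < m"
begin

abbreviation "ok \<equiv> valid k V m"
abbreviation "nm \<equiv> label V m"
abbreviation "E \<equiv> sat_edges k V m lit"
abbreviation "S \<equiv> sat_terminals k V m"
abbreviation "n \<equiv> (6 + k) * V * m"
abbreviation "con \<equiv> arc m lit"

lemma nm_inject: "ok u \<Longrightarrow> ok v \<Longrightarrow> nm u = nm v \<longleftrightarrow> u = v"
  using V m
  by (cases u; cases v) (simp_all add: index_eq_iff)

lemma nm_less: "ok u \<Longrightarrow> nm u < n"
  using V m by (cases u) (auto intro!: index_less)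

declare label.simps [simp del]

lemma con_neq: "con u v \<Longrightarrow> u \<noteq> v"
  by (cases u; cases v) auto

lemma simple: "simple_graph ({..<n}, E)"
  unfolding simple_graph_def
proof (intro conjI ballI)
  fix e assume "e \<in> snd ({..<n}, E)"
  then obtain u v where e: "ok u" "ok v" "con u v" "e = {nm u, nm v}" by (auto simp: sat_edges_def)
  then show "e \<subseteq> fst ({..<n}, E)" using nm_less by auto
  show "card e = 2" using e nm_inject con_neq by (simp add: card_2_iff')
qed simp

lemma S_subset: "S \<subseteq> {..<n}"
  using nm_less by (auto simp: sat_terminals_def)

lemma card_S: "card S = k"
proof -
  have "inj_on nm (Term ` {..<k})" by (rule inj_onI) (auto simp: nm_inject)
  then show ?thesis by (simp add: sat_terminals_def card_image inj_on_def)
qed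

lemma nm_in_S: "ok u \<Longrightarrow> nm u \<in> S \<longleftrightarrow> (\<exists>j. u = Term j)"
  unfolding sat_terminals_def by (auto simp: nm_inject)

lemma nbr: "{nm u, y} \<in> E \<Longrightarrow> ok u \<Longrightarrow> \<exists>v. ok v \<and> y = nm v \<and> (con u v \<or> con v u)"
  unfolding sat_edges_def by (auto simp: doubleton_eq_iff nm_inject)

definition N :: "nat \<Rightarrow> vertex set" where
  "N j = {u. ok u \<and> con (Term j) u}"

lemma N_eq: "N j = (if j = 1 then (\<lambda>(X, i). Snk X i) else (\<lambda>(X, i). Src X i)) ` ({..<V} \<times> {..<m}) \<union>
    (if j = 2 then Fin else Cls) ` {..<m}" (is "_ = ?R")
proof -
  have "u \<in> N j \<longleftrightarrow> u \<in> ?R" for u by (cases u) (auto simp: N_def)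
  then show ?thesis by blast
qed

lemma finite_N: "finite (N j)"
  by (simp add: N_eq)

lemma card_N: "card (N j) = V * m + m"
  unfolding N_eq
  by (subst card_Un_disjoint) (auto simp: card_image inj_on_def)

text \<open>The trees are indexed by the neighbours \<open>u\<close> of terminal 0. Each is built on
  a path of three inner vertices starting at \<open>u\<close>: \<open>u\<close> is adjacent to all
  terminals but one, and the other end of the path to the missing one. The tip used for clause
  \<open>i\<close> has the opposite sign of the tip used by \<open>Src (c i) i\<close>, so it is
  free.\<close>

lemma satisfiable_imp_le_kappa:
  assumes "satisfiable V m lit"
  shows "V * m + m \<le> kappa ({..<n}, E) S"
proof -
  from assms obtain \<sigma> where "\<And>i. i < m \<Longrightarrow> \<exists>X<V. lit X (\<sigma> X) i"
    by (auto simp: satisfiable_def)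
  then obtain c where c: "\<And>i. i < m \<Longrightarrow> c i < V \<and> lit (c i) (\<sigma> (c i)) i" by metis
  define F where "F u = (case u of
      Src X i \<Rightarrow> {Src X i, Tip (\<sigma> X) X i, Snk X (if \<sigma> X then i else Suc i mod m)}
    | Cls i \<Rightarrow> {Cls i, Tip (\<not> \<sigma> (c i)) (c i) i, Fin i} | _ \<Rightarrow> {})" for u
  define VV where "VV u = nm ` F u \<union> S" for u
  \<comment> \<open>All edges within the vertex set may be taken, since only connectedness is asked
    for. Two such sets share no edge, because no edge joins two terminals.\<close>
  define EE where "EE u = {e \<in> E. e \<subseteq> VV u}" for u
  have N0: "u \<in> N 0 \<longleftrightarrow> (\<exists>X i. u = Src X i \<and> X < V \<and> i < m) \<or> (\<exists>i. u = Cls i \<and> i < m)" for u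
    by (auto simp: N_eq)
  have F: "ok v \<and> \<not> (\<exists>j. v = Term j)" if "u \<in> N 0" "v \<in> F u" for u v
    using that c m by (auto simp: N0 F_def)
  have Suc_mod: "i = j" if "Suc i mod m = Suc j mod m" "i < m" "j < m" for i j
    using that by (auto simp: mod_Suc split: if_splits)
  have disj: "F u \<inter> F v = {}" if "u \<in> N 0" "v \<in> N 0" "u \<noteq> v" for u v
    using that by (auto simp: N0 F_def dest: Suc_mod split: if_splits)
  have edge: "(nm x, nm y) \<in> adj_rel (EE u)"
    if "ok x" "ok y" "con x y \<or> con y x" "nm x \<in> VV u" "nm y \<in> VV u" for x y u
  proof -
    have "{nm x, nm y} \<in> E" unfolding sat_edges_def using that(1-3) insert_commute by blast
    then show ?thesis using that(4,5) by (simp add: EE_def)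
  qed
  have S_VV: "nm (Term j) \<in> VV u" if "j < k" for j u
    using that by (simp add: VV_def sat_terminals_def)
  have "card (N 0) \<le> kappa ({..<n}, E) S"
  proof (rule le_kappa_family[where V = VV and E = EE, OF simple _ finite_N])
    show "2 \<le> card S" using card_S k by simp
  next
    fix u assume u: "u \<in> N 0"
    have "VV u \<subseteq> {..<n}" using F[OF u] nm_less S_subset by (auto simp: VV_def)
    then show "S \<subseteq> VV u \<and> VV u \<subseteq> fst ({..<n}, E) \<and> EE u \<subseteq> snd ({..<n}, E) \<and> \<Union> (EE u) \<subseteq> VV u"
      by (auto simp: VV_def EE_def)
    have FVV: "nm x \<in> VV u" if "x \<in> F u" for x using that by (simp add: VV_def)
    let ?R = "(adj_rel (EE u))\<^sup>*"
    obtain y z b where yz: "F u = {u, y, z}" "ok u" "ok y" "ok z" "con u y \<or> con y u" "con y z \<or> con z y"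
      "b < k" "con (Term b) z" "\<And>j. j \<noteq> b \<Longrightarrow> con (Term j) u"
    proof (cases u)
      case (Src X i)
      then show ?thesis
        using that[of "Tip (\<sigma> X) X i" "Snk X (if \<sigma> X then i else Suc i mod m)" 1] u k m
        by (auto simp: N0 F_def)
    next
      case (Cls i)
      then show ?thesis
        using that[of "Tip (\<not> \<sigma> (c i)) (c i) i" "Fin i" 2] u k c
        by (auto simp: N0 F_def)
    qed (use u in \<open>auto simp: N0\<close>)
    have in_VV: "nm u \<in> VV u" "nm y \<in> VV u" "nm z \<in> VV u" using FVV yz(1) by auto
    have 1: "(nm u, nm y) \<in> ?R" using edge[of u y u] yz(2,3,5) in_VV by blast
    have 2: "(nm u, nm z) \<in> ?R"
      using rtrancl_into_rtrancl[OF 1 edge[of y z u]] yz(3,4,6) in_VV by blast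
    have 3: "(nm u, nm (Term j)) \<in> ?R" if "j < k" for j
    proof (cases "j = b")
      case True
      then show ?thesis
        using rtrancl_into_rtrancl[OF 2 edge[of z "Term b" u]] yz(4,7,8) in_VV S_VV[OF yz(7)] by simp
    next
      case False
      then show ?thesis
        using r_into_rtrancl[OF edge[of u "Term j" u]] yz(2) yz(9)[OF False] in_VV S_VV[OF that] that by simp
    qed
    show "connected_graph (VV u, EE u)"
    proof (rule connected_graphI)
      show "nm u \<in> VV u" by (rule in_VV)
      fix v assume "v \<in> VV u"
      then show "(nm u, v) \<in> ?R"
        using 1 2 3 yz(1) by (auto simp: VV_def sat_terminals_def)
    qed
  next
    fix u v assume uv: "u \<in> N 0" "v \<in> N 0" "u \<noteq> v"
    have sub: "VV u \<inter> VV v \<subseteq> S"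
    proof
      fix w assume w: "w \<in> VV u \<inter> VV v"
      show "w \<in> S"
      proof (rule ccontr)
        assume "w \<notin> S"
        then obtain x y where "x \<in> F u" "y \<in> F v" "nm x = nm y" using w by (auto simp: VV_def)
        moreover from this have "x = y" using F[OF uv(1), of x] F[OF uv(2), of y] nm_inject[of x y] by simp
        ultimately show False using disj[OF uv] by blast
      qed
    qed
    have "\<not> e \<subseteq> S" if e: "e \<in> E" for e
    proof -
      obtain x y where "ok x" "ok y" "con x y" "e = {nm x, nm y}"
        using e unfolding sat_edges_def by blast
      then show ?thesis using nm_in_S[of x] nm_in_S[of y] by auto
    qed
    moreover have "e \<subseteq> S" "e \<in> E" if "e \<in> EE u \<inter> EE v" for e
      using that sub unfolding EE_def by blast+
    ultimately have "EE u \<inter> EE v = {}" by blast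
    with sub show "VV u \<inter> VV v \<subseteq> S \<and> EE u \<inter> EE v = {}" by blast
  qed
  then show ?thesis by (simp add: card_N)
qed

text \<open>The local claims are cut arguments: if the required tip or sink were missing, a few
  vertices around the source or clause vertex would be closed under adjacency in the tree, and one
  terminal would lie outside.\<close>

lemma le_kappa_imp_satisfiable:
  assumes "V * m + m \<le> kappa ({..<n}, E) S"
  shows "satisfiable V m lit"
proof -
  let ?q = "V * m + m"
  have "2 \<le> card S" using card_S k by simp
  then obtain VV EE where "disjoint_connected ({..<n}, E) S ?q VV EE"
    using le_kappa_iff_disjoint_connected[OF simple] assms by blast
  then have
    1: "\<And>t. t < ?q \<Longrightarrow> connected_graph (VV t, EE t) \<and> S \<subseteq> VV t \<and> VV t \<subseteq> {..<n} \<and> EE t \<subseteq> E \<and>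
      \<Union> (EE t) \<subseteq> VV t"
    and 2: "\<And>t t'. t < ?q \<Longrightarrow> t' < ?q \<Longrightarrow> t \<noteq> t' \<Longrightarrow> VV t \<inter> VV t' \<subseteq> S"
    by (simp_all add: disjoint_connected_def)
  define A where "A t = {v. ok v \<and> nm v \<in> VV t}" for t
  have disj: "t = t'" if "t < ?q" "t' < ?q" "v \<in> A t" "v \<in> A t'" "\<And>j. v \<noteq> Term j" for t t' v
    using 2[of t t'] that nm_in_S[of v] by (auto simp: A_def)
  have step: "\<exists>v\<in>A t. y = nm v \<and> (con u v \<or> con v u)" if "t < ?q" "{nm u, y} \<in> EE t" "ok u" for t u y
  proof -
    have "{nm u, y} \<in> E" "y \<in> VV t" using 1[OF that(1)] that(2) by auto
    then show ?thesis using nbr[OF _ that(3)] unfolding A_def by blast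
  qed
  have trm: "Term j \<in> A t" if "t < ?q" "j < k" for t j
    using 1[OF that(1)] that by (auto simp: A_def sat_terminals_def)
  have closed: "v \<in> U" if t: "t < ?q" and uv: "u \<in> A t" "u \<in> U" "v \<in> A t" and U: "\<And>x. x \<in> U \<Longrightarrow> ok x"
    and cl: "\<And>x y. x \<in> U \<Longrightarrow> y \<in> A t \<Longrightarrow> con x y \<or> con y x \<Longrightarrow> y \<in> U" for t u v U
  proof -
    have "nm v \<in> nm ` U"
    proof (rule connected_graph_closed[of "VV t" "EE t" "nm u"])
      fix x y assume xy: "x \<in> nm ` U" "{x, y} \<in> EE t"
      from xy(1) obtain z where z: "x = nm z" "z \<in> U" by (rule imageE)
      obtain w where "w \<in> A t" "y = nm w" "con z w \<or> con w z"
        using step[OF t xy(2)[unfolded z(1)] U[OF z(2)]] by blast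
      then show "y \<in> nm ` U" using cl z(2) by blast
    next
      show "connected_graph (VV t, EE t)" using 1[OF t] by blast
      show "nm u \<in> VV t" "nm v \<in> VV t" using uv(1,3) unfolding A_def by blast+
      show "nm u \<in> nm ` U" using uv(2) by blast
    qed
    then obtain w where "nm v = nm w" "w \<in> U" by (rule imageE)
    then show ?thesis using nm_inject[of v w] U uv(3) by (simp add: A_def)
  qed
  have term_nbr: "\<exists>u\<in>A t. u \<in> N j" if t: "t < ?q" and j: "j < k" for t j
  proof -
    define j' where "j' = (if j = 0 then 1 else 0 :: nat)"
    have j': "j' < k" "j' \<noteq> j" using k by (auto simp: j'_def)
    then have "nm (Term j) \<noteq> nm (Term j')" using j by (subst nm_inject) auto
    then obtain w where "{nm (Term j), w} \<in> EE t"
      using connected_graph_edge[of "VV t" "EE t" "nm (Term j)" "nm (Term j')"]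
        1[OF t] trm[OF t j] trm[OF t j'(1)] by (auto simp: A_def)
    then obtain v where "v \<in> A t" "con (Term j) v \<or> con v (Term j)"
      using step[of t "Term j" w] t j by auto
    then have "v \<in> N j" by (cases v) (auto simp: N_def A_def)
    then show ?thesis using \<open>v \<in> A t\<close> by blast
  qed
  \<comment> \<open>Different trees choose different neighbours of terminal \<open>j\<close>, and
    there are as many trees as neighbours. So the choice \<open>f\<close> is a bijection: every
    neighbour is in some tree, and no tree has a second one.\<close>
  have cover: "\<exists>t<?q. u \<in> A t"
    and only: "\<And>t. t < ?q \<Longrightarrow> u \<in> A t \<Longrightarrow> A t \<inter> N j = {u}" if u: "u \<in> N j" and j: "j < k" for u j
  proof -
    obtain f where f: "\<And>t. t < ?q \<Longrightarrow> f t \<in> A t \<inter> N j" using term_nbr[OF _ j] by (metis IntI)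
    have nt: "v \<noteq> Term l" if "v \<in> N j" for v l using that by (auto simp: N_def)
    have "inj_on f {..<?q}"
    proof (rule inj_onI)
      fix t t' assume t: "t \<in> {..<?q}" "t' \<in> {..<?q}" "f t = f t'"
      show "t = t'"
        by (rule disj[of t t' "f t"]) (use t f[of t] f[of t'] nt in auto)
    qed
    then have "f ` {..<?q} = N j"
      using f by (intro card_subset_eq finite_N) (auto simp: card_image card_N)
    then have sur: "\<exists>t<?q. v = f t" if "v \<in> N j" for v using that by auto
    have uniq: "v = f t" if v: "v \<in> A t \<inter> N j" and t: "t < ?q" for v t
    proof -
      obtain t' where t': "t' < ?q" "v = f t'" using sur v by blast
      have "t' = t" by (rule disj[of t' t v]) (use t' t v f nt in blast)+
      with t' show ?thesis by simp
    qed
    show "\<exists>t<?q. u \<in> A t" using sur[OF u] f by blast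
    show "A t \<inter> N j = {u}" if t: "t < ?q" "u \<in> A t" for t
    proof -
      have ut: "u = f t" using uniq u t by blast
      have "v = u" if "v \<in> A t \<inter> N j" for v using uniq[OF that t(1)] ut by simp
      then show ?thesis using u t(2) by blast
    qed
  qed
  have Src_N: "Src X i \<in> N j" if "X < V" "i < m" "j \<noteq> 1" for X i j using that by (simp add: N_def)
  have Cls_N: "Cls i \<in> N j" if "i < m" "j \<noteq> 2" for i j using that by (simp add: N_def)
  have k0: "0 < k" using k by simp
  have wheel: "\<exists>s. Tip s X i \<in> A t \<and> Snk X (if s then i else Suc i mod m) \<in> A t"
    if t: "t < ?q" and src: "Src X i \<in> A t" for t X i
  proof (rule ccontr)
    assume neg: "\<not> ?thesis"
    have ok: "X < V" "i < m" using src by (auto simp: A_def)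
    have a: "A t \<inter> N j = {Src X i}" if "j \<noteq> 1" "j < k" for j
      using only[OF Src_N[OF ok that(1)] that(2) t src] .
    \<comment> \<open>\<open>Cls l\<close> and \<open>Fin l\<close> are neighbours of terminals 0
      and 2, whose only neighbour in this tree is \<open>Src X i\<close>; so no tip can be left
      towards a clause.\<close>
    have no: "Cls l \<notin> A t" "Fin l \<notin> A t" for l
    proof -
      have "Cls l \<in> A t \<Longrightarrow> Cls l \<in> A t \<inter> N 0" "Fin l \<in> A t \<Longrightarrow> Fin l \<in> A t \<inter> N 2"
        by (simp_all add: N_def A_def)
      then show "Cls l \<notin> A t" "Fin l \<notin> A t" using a[of 0] a[of 2] k by auto
    qed
    let ?U = "Term ` {j. j < k \<and> j \<noteq> 1} \<union> {Src X i} \<union> {Tip s X i | s. Tip s X i \<in> A t}"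
    have "Term 1 \<in> ?U"
    proof (rule closed[OF t src])
      fix x y assume x: "x \<in> ?U" and y: "y \<in> A t" and c: "con x y \<or> con y x"
      have "ok y" using y by (simp add: A_def)
      from x consider j where "x = Term j" "j < k" "j \<noteq> 1" | "x = Src X i" | s where "x = Tip s X i" "Tip s X i \<in> A t"
        by auto
      then show "y \<in> ?U"
      proof cases
        case 1
        then have "con x y" using c by (cases y) auto
        then have "y \<in> A t \<inter> N j" using y 1 by (auto simp: N_def A_def)
        then show ?thesis using a[of j] 1 by auto
      next
        case 2
        then show ?thesis using c y \<open>ok y\<close> by (cases y) auto
      next
        case 3
        then show ?thesis using c y no neg by (cases y) (auto split: if_splits)
      qed
    next
      show "Term 1 \<in> A t" using trm[OF t] k by simp
    next
      fix x assume "x \<in> ?U"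
      then show "ok x" using ok by (auto simp: A_def)
    qed simp
    then show False by auto
  qed
  have "\<exists>t<?q. Src X i \<in> A t" if "X < V" "i < m" for X i
    using cover[OF Src_N[OF that] k0] by simp
  then obtain T where T: "\<And>X i. X < V \<Longrightarrow> i < m \<Longrightarrow> T X i < ?q \<and> Src X i \<in> A (T X i)" by metis
  then have "\<exists>s. Tip s X i \<in> A (T X i) \<and> Snk X (if s then i else Suc i mod m) \<in> A (T X i)"
    if "X < V" "i < m" for X i using wheel that by blast
  then obtain s where s: "\<And>X i. X < V \<Longrightarrow> i < m \<Longrightarrow>
      Tip (s X i) X i \<in> A (T X i) \<and> Snk X (if s X i then i else Suc i mod m) \<in> A (T X i)" by metis
  \<comment> \<open>A source that uses its \<open>False\<close> tip takes the sink that the next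
    source would need for its \<open>True\<close> tip.\<close>
  have next_False: "\<not> s X (Suc i mod m)" if "X < V" "i < m" "\<not> s X i" for X i
  proof
    assume s': "s X (Suc i mod m)"
    let ?i = "Suc i mod m"
    have i: "?i < m" using m by simp
    have eq: "T X i = T X ?i"
      using disj[of "T X i" "T X ?i" "Snk X ?i"] s[OF that(1,2)] s[OF that(1) i] T[OF that(1,2)] T[OF that(1) i]
        that(3) s' by simp
    have "A (T X i) \<inter> N 0 = {Src X i}"
      using only[OF Src_N[OF that(1,2)] k0] T[OF that(1,2)] by simp
    moreover have "A (T X ?i) = A (T X i)" using arg_cong[OF eq, of A] by (rule sym)
    then have "Src X ?i \<in> A (T X i) \<inter> N 0"
      using conjunct2[OF T[OF that(1) i]] Src_N[OF that(1) i] by (metis IntI zero_neq_one)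
    ultimately have "Src X ?i \<in> {Src X i}" by metis
    \<comment> \<open>For \<open>m = 1\<close> the two indices do coincide, so the contradiction
      comes from the values of \<open>s\<close>, not from the indices.\<close>
    then have "i = ?i" by (simp only: singleton_iff vertex.inject)
    then have "s X i = s X ?i" by (rule arg_cong)
    then show False using that(3) s' by blast
  qed
  have const: "s X i = s X 0" if "X < V" "i < m" for X i
    by (rule cyclic_constant[where P = "s X", OF next_False[OF that(1)] that(2)])
  have clause: "\<exists>X s. Tip s X i \<in> A t \<and> lit X (\<not> s) i" if t: "t < ?q" and cls: "Cls i \<in> A t" for t i
  proof (rule ccontr)
    assume neg: "\<not> ?thesis"
    have ok: "i < m" using cls by (auto simp: A_def)
    have a: "A t \<inter> N j = {Cls i}" if "j \<noteq> 2" "j < k" for j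
      using only[OF Cls_N[OF ok that(1)] that(2) t cls] .
    let ?U = "Term ` {j. j < k \<and> j \<noteq> 2} \<union> {Cls i}"
    have "Term 2 \<in> ?U"
    proof (rule closed[OF t cls])
      fix x y assume x: "x \<in> ?U" and y: "y \<in> A t" and c: "con x y \<or> con y x"
      have "ok y" using y by (simp add: A_def)
      from x consider j where "x = Term j" "j < k" "j \<noteq> 2" | "x = Cls i" by auto
      then show "y \<in> ?U"
      proof cases
        case 1
        then have "con x y" using c by (cases y) auto
        then have "y \<in> A t \<inter> N j" using y 1 by (auto simp: N_def A_def)
        then show ?thesis using a[of j] 1 by auto
      next
        case 2
        then show ?thesis using c y neg \<open>ok y\<close> by (cases y) auto
      qed
    next
      show "Term 2 \<in> A t" using trm[OF t] k by simp
    next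
      fix x assume "x \<in> ?U"
      then show "ok x" using ok by (auto simp: A_def)
    qed simp
    then show False by auto
  qed
  have "\<exists>X<V. lit X (s X 0) i" if i: "i < m" for i
  proof -
    obtain t where t: "t < ?q" "Cls i \<in> A t" using cover[OF Cls_N[OF i] k0] by auto
    then obtain X b where b: "Tip b X i \<in> A t" "lit X (\<not> b) i" using clause[OF t] by blast
    have X: "X < V" using b by (auto simp: A_def)
    \<comment> \<open>Otherwise the tip would also lie in the tree of \<open>Src X i\<close>, and
      that tree would contain two neighbours of terminal 0.\<close>
    have "s X i \<noteq> b"
    proof
      assume "s X i = b"
      then have "t = T X i"
        using disj[OF t(1) conjunct1[OF T[OF X i]] b(1)] s[OF X i] by simp
      then have "Src X i \<in> A t \<inter> N 0" using T[OF X i] Src_N[OF X i] by simp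
      moreover have "A t \<inter> N 0 = {Cls i}" using only[OF Cls_N[OF i] k0 t] by simp
      ultimately show False by auto
    qed
    then have "s X 0 = (\<not> b)" using const[OF X i] by auto
    with b X show ?thesis by auto
  qed
  then show ?thesis unfolding satisfiable_def by (intro exI[of _ "\<lambda>X. s X 0"]) auto
qed

end

section \<open>Writing the graph by nested loops\<close>

definition index_expr :: "expr \<Rightarrow> expr \<Rightarrow> expr \<Rightarrow> expr \<Rightarrow> expr \<Rightarrow> expr" where
  "index_expr V m \<tau> X i = Plus (Times (Plus (Times \<tau> V) X) m) i"

lemma val_index_expr [simp]:
  "val x (index_expr V m \<tau> X i) \<rho> = index (val x V \<rho>) (val x m \<rho>) (val x \<tau> \<rho>) (val x X \<rho>) (val x i \<rho>)"
  by (simp add: index_expr_def index_def)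

text \<open>Quantification over vertices becomes bounded quantification over numbers, as terms
  require, and \<open>mod\<close> becomes a case distinction. The sign \<open>True\<close> of a tip
  is \<open>b = 0\<close>; as clauses see tips with the opposite sign, \<open>b\<close> is also the
  sign of the literal.\<close>

lemma ex_arc_iff:
  assumes "0 < m"
  shows "(\<exists>u v. valid k V m u \<and> valid k V m v \<and> arc m lit u v \<and> a = label V m u \<and> c = label V m v) \<longleftrightarrow>
    (\<exists>j<k. \<exists>X<V. \<exists>i<m. j \<noteq> 1 \<and> a = index V m (6 + j) 0 0 \<and> c = index V m 0 X i) \<or>
    (\<exists>j<k. \<exists>X<V. \<exists>i<m. j = 1 \<and> a = index V m (6 + j) 0 0 \<and> c = index V m 1 X i) \<or>
    (\<exists>j<k. \<exists>i<m. j \<noteq> 2 \<and> a = index V m (6 + j) 0 0 \<and> c = index V m 4 0 i) \<or>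
    (\<exists>j<k. \<exists>i<m. j = 2 \<and> a = index V m (6 + j) 0 0 \<and> c = index V m 5 0 i) \<or>
    (\<exists>X<V. \<exists>i<m. \<exists>b<2. a = index V m 0 X i \<and> c = index V m (2 + b) X i) \<or>
    (\<exists>X<V. \<exists>i<m. \<exists>b<2. \<exists>j<m. (if b = 0 then j = i else j = i + 1 \<or> j = 0 \<and> i + 1 = m) \<and>
       a = index V m (2 + b) X i \<and> c = index V m 1 X j) \<or>
    (\<exists>X<V. \<exists>i<m. \<exists>b<2. lit X (b \<noteq> 0) i \<and> a = index V m 4 0 i \<and> c = index V m (2 + b) X i) \<or>
    (\<exists>X<V. \<exists>i<m. \<exists>b<2. lit X (b \<noteq> 0) i \<and> a = index V m 5 0 i \<and> c = index V m (2 + b) X i)"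
    (is "?L \<longleftrightarrow> ?D1 \<or> ?D2 \<or> ?D3 \<or> ?D4 \<or> ?D5 \<or> ?D6 \<or> ?D7 \<or> ?D8")
proof
  assume ?L
  then obtain u v where uv: "valid k V m u" "valid k V m v" "arc m lit u v"
    "a = label V m u" "c = label V m v" by blast
  show "?D1 \<or> ?D2 \<or> ?D3 \<or> ?D4 \<or> ?D5 \<or> ?D6 \<or> ?D7 \<or> ?D8"
  proof (cases u)
    case Outer: (Term j)
    show ?thesis
    proof (cases v)
      case (Src X i)
      have "j < k" "j \<noteq> 1" "X < V" "i < m" "a = index V m (6 + j) 0 0" "c = index V m 0 X i"
        using uv Outer \<open>v = Src X i\<close> by (simp_all)
      then have ?D1 by blast
      then show ?thesis by blast
    next
      case (Snk X i)
      have "j < k" "j = 1" "X < V" "i < m" "a = index V m (6 + j) 0 0" "c = index V m 1 X i"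
        using uv Outer \<open>v = Snk X i\<close> by (simp_all)
      then have ?D2 by blast
      then show ?thesis by blast
    next
      case (Cls i)
      have "j < k" "j \<noteq> 2" "i < m" "a = index V m (6 + j) 0 0" "c = index V m 4 0 i"
        using uv Outer \<open>v = Cls i\<close> by (simp_all)
      then have ?D3 by blast
      then show ?thesis by blast
    next
      case (Fin i)
      have "j < k" "j = 2" "i < m" "a = index V m (6 + j) 0 0" "c = index V m 5 0 i"
        using uv Outer \<open>v = Fin i\<close> by (simp_all)
      then have ?D4 by blast
      then show ?thesis by blast
    qed (use uv Outer in auto)
  next
    case Outer: (Src X i)
    show ?thesis
    proof (cases v)
      case (Tip s Y j)
      define b where "b = (if s then 0 else 1 :: nat)"
      have "X < V" "i < m" "b < 2" "a = index V m 0 X i" "c = index V m (2 + b) X i"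
        using uv Outer \<open>v = Tip s Y j\<close> by (simp_all add: b_def numeral_2_eq_2 numeral_3_eq_3)
      then have ?D5 by blast
      then show ?thesis by blast
    qed (use uv Outer in auto)
  next
    case Outer: (Tip s X i)
    show ?thesis
    proof (cases v)
      case (Snk Y j)
      define b where "b = (if s then 0 else 1 :: nat)"
      have "X < V" "i < m" "b < 2" "j < m" "if b = 0 then j = i else j = i + 1 \<or> j = 0 \<and> i + 1 = m"
        "a = index V m (2 + b) X i" "c = index V m 1 X j"
        using uv Outer \<open>v = Snk Y j\<close> by (simp_all add: b_def numeral_2_eq_2 numeral_3_eq_3 mod_Suc split: if_splits)
      then have ?D6 by blast
      then show ?thesis by blast
    qed (use uv Outer in auto)
  next
    case Outer: (Cls i)
    show ?thesis
    proof (cases v)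
      case (Tip s X j)
      define b where "b = (if s then 0 else 1 :: nat)"
      have "X < V" "i < m" "b < 2" "lit X (b \<noteq> 0) i" "a = index V m 4 0 i" "c = index V m (2 + b) X i"
        using uv Outer \<open>v = Tip s X j\<close> by (simp_all add: b_def numeral_2_eq_2 numeral_3_eq_3 split: if_splits)
      then have ?D7 by blast
      then show ?thesis by blast
    qed (use uv Outer in auto)
  next
    case Outer: (Fin i)
    show ?thesis
    proof (cases v)
      case (Tip s X j)
      define b where "b = (if s then 0 else 1 :: nat)"
      have "X < V" "i < m" "b < 2" "lit X (b \<noteq> 0) i" "a = index V m 5 0 i" "c = index V m (2 + b) X i"
        using uv Outer \<open>v = Tip s X j\<close> by (simp_all add: b_def numeral_2_eq_2 numeral_3_eq_3 split: if_splits)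
      then have ?D8 by blast
      then show ?thesis by blast
    qed (use uv Outer in auto)
  qed (use uv in auto)
next
  have I: "valid k V m u \<Longrightarrow> valid k V m v \<Longrightarrow> arc m lit u v \<Longrightarrow> a = label V m u \<Longrightarrow> c = label V m v \<Longrightarrow> ?L"
    for u v by blast
  assume "?D1 \<or> ?D2 \<or> ?D3 \<or> ?D4 \<or> ?D5 \<or> ?D6 \<or> ?D7 \<or> ?D8"
  then show ?L
  proof (elim disjE exE conjE, goal_cases)
    case (1 j X i)
    then show ?case
      by (intro I[of "Term j" "Src X i"])
        (auto simp: less_Suc_eq numeral_2_eq_2 numeral_3_eq_3 mod_Suc)
  next
    case (2 j X i)
    then show ?case
      by (intro I[of "Term j" "Snk X i"])
        (auto simp: less_Suc_eq numeral_2_eq_2 numeral_3_eq_3 mod_Suc)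
  next
    case (3 j i)
    then show ?case
      by (intro I[of "Term j" "Cls i"])
        (auto simp: less_Suc_eq numeral_2_eq_2 numeral_3_eq_3 mod_Suc)
  next
    case (4 j i)
    then show ?case
      by (intro I[of "Term j" "Fin i"])
        (auto simp: less_Suc_eq numeral_2_eq_2 numeral_3_eq_3 mod_Suc)
  next
    case (5 X i b)
    then show ?case
      by (intro I[of "Src X i" "Tip (b = 0) X i"])
        (auto simp: less_Suc_eq numeral_2_eq_2 numeral_3_eq_3 mod_Suc)
  next
    case (6 X i b j)
    then show ?case
      by (intro I[of "Tip (b = 0) X i" "Snk X j"])
        (auto simp: less_Suc_eq numeral_2_eq_2 numeral_3_eq_3 mod_Suc)
  next
    case (7 X i b)
    then show ?case
      by (intro I[of "Cls i" "Tip (b = 0) X i"])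
        (auto simp: less_Suc_eq numeral_2_eq_2 numeral_3_eq_3 mod_Suc)
  next
    case (8 X i b)
    then show ?case
      by (intro I[of "Fin i" "Tip (b = 0) X i"])
        (auto simp: less_Suc_eq numeral_2_eq_2 numeral_3_eq_3 mod_Suc)
  qed
qed

text \<open>Variables 20 and 21 hold two vertices; 0, 1, 2 hold the variable, sign and clause of an occurrence.\<close>

definition arc_expr :: "nat \<Rightarrow> expr \<Rightarrow> expr \<Rightarrow> expr \<Rightarrow> nat \<Rightarrow> nat \<Rightarrow> expr" where
  "arc_expr k V m lit a c =
    (let idx = index_expr V m; is = (\<lambda>e e'. Conj (Equal (Var a) e) (Equal (Var c) e'));
         tm = idx (Plus (Const 6) (Var 3)) (Const 0) (Const 0); tip = idx (Plus (Const 2) (Var 1)) (Var 0) (Var 2)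
     in Disjs [
       BEx 3 (Const k) (BEx 0 V (BEx 2 m (Conj (Neg (Equal (Var 3) (Const 1))) (is tm (idx (Const 0) (Var 0) (Var 2)))))),
       BEx 3 (Const k) (BEx 0 V (BEx 2 m (Conj (Equal (Var 3) (Const 1)) (is tm (idx (Const 1) (Var 0) (Var 2)))))),
       BEx 3 (Const k) (BEx 2 m (Conj (Neg (Equal (Var 3) (Const 2))) (is tm (idx (Const 4) (Const 0) (Var 2))))),
       BEx 3 (Const k) (BEx 2 m (Conj (Equal (Var 3) (Const 2)) (is tm (idx (Const 5) (Const 0) (Var 2))))),
       BEx 0 V (BEx 2 m (BEx 1 (Const 2) (is (idx (Const 0) (Var 0) (Var 2)) tip))),
       BEx 0 V (BEx 2 m (BEx 1 (Const 2) (BEx 4 m (Conj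
         (Conj (Imp (Neg (Var 1)) (Equal (Var 4) (Var 2))) (Imp (Var 1) (Disj
           (Equal (Var 4) (Plus (Var 2) (Const 1)))
           (Conj (Equal (Var 4) (Const 0)) (Equal (Plus (Var 2) (Const 1)) m)))))
         (is tip (idx (Const 1) (Var 0) (Var 4))))))),
       BEx 0 V (BEx 2 m (BEx 1 (Const 2) (Conj lit (is (idx (Const 4) (Const 0) (Var 2)) tip)))),
       BEx 0 V (BEx 2 m (BEx 1 (Const 2) (Conj lit (is (idx (Const 5) (Const 0) (Var 2)) tip))))])"

text \<open>The loops follow the layout of \<open>encode\<close>. Both orders of 20 and 21 are tried
  because \<open>arc\<close> lists an edge once; the numbers avoid the variables 0 to 4 bound inside
  \<open>arc_expr\<close>.\<close>

definition sat_cmd :: "nat \<Rightarrow> expr \<Rightarrow> expr \<Rightarrow> expr \<Rightarrow> cmd" where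
  "sat_cmd k V m lit =
    (let n = Times (Times (Const (6 + k)) V) m in
     Then (For 30 n (Out (Const 1))) (Then (Out (Const 0))
      (Then (For 20 n (For 21 n (Out (Disj (arc_expr k V m lit 20 21) (arc_expr k V m lit 21 20)))))
       (Then (For 20 n (Out (BEx 3 (Const k)
          (Equal (Var 20) (index_expr V m (Plus (Const 6) (Var 3)) (Const 0) (Const 0))))))
        (For 30 (Plus (Times V m) m) (Out (Const 1)))))))"

lemma tr_arc_expr:
  assumes V: "\<And>\<rho>. val x V \<rho> = V'" and m: "\<And>\<rho>. val x m \<rho> = m'" "0 < m'"
    and lit: "\<And>\<rho>. tr x lit \<rho> \<longleftrightarrow> lit' (\<rho> 0) (\<rho> 1 \<noteq> 0) (\<rho> 2)"
    and ac: "5 \<le> a" "5 \<le> c"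
  shows "tr x (arc_expr k V m lit a c) \<rho> \<longleftrightarrow> (\<exists>u v. valid k V' m' u \<and> valid k V' m' v \<and> arc m' lit' u v \<and>
    \<rho> a = label V' m' u \<and> \<rho> c = label V' m' v)"
proof -
  have "a \<noteq> 0" "a \<noteq> 1" "a \<noteq> 2" "a \<noteq> 3" "a \<noteq> 4" "c \<noteq> 0" "c \<noteq> 1" "c \<noteq> 2" "c \<noteq> 3" "c \<noteq> 4"
    using ac by auto
  moreover have "(if b = 0 then P else Q) \<longleftrightarrow> (\<not> b \<noteq> 0 \<longrightarrow> P) \<and> (b \<noteq> 0 \<longrightarrow> Q)" for P Q and b :: nat by simp
  ultimately show ?thesis
    unfolding ex_arc_iff[OF m(2)] arc_expr_def Let_def
    by (simp add: V m lit del: One_nat_def)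
qed

lemma outputs_sat_cmd:
  assumes V: "\<And>\<rho>. val x V \<rho> = V'" and m: "\<And>\<rho>. val x m \<rho> = m'" "0 < m'"
    and lit: "\<And>\<rho>. tr x lit \<rho> \<longleftrightarrow> lit' (\<rho> 0) (\<rho> 1 \<noteq> 0) (\<rho> 2)"
  shows "outputs x (sat_cmd k V m lit) \<rho> =
    encode ((6 + k) * V' * m') (sat_edges k V' m' lit') (sat_terminals k V' m') (V' * m' + m')"
proof -
  have E: "{i, j} \<in> sat_edges k V' m' lit' \<longleftrightarrow>
      (\<exists>u v. valid k V' m' u \<and> valid k V' m' v \<and> arc m' lit' u v \<and> i = label V' m' u \<and> j = label V' m' v) \<or>
      (\<exists>u v. valid k V' m' u \<and> valid k V' m' v \<and> arc m' lit' u v \<and> j = label V' m' u \<and> i = label V' m' v)" for i j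
    unfolding sat_edges_def by (auto simp: doubleton_eq_iff)
  have S: "i \<in> sat_terminals k V' m' \<longleftrightarrow> (\<exists>j<k. i = index V' m' (6 + j) 0 0)" for i
    unfolding sat_terminals_def image_image by (auto simp: label.simps image_iff)
  show ?thesis
    unfolding sat_cmd_def encode_def Let_def
    by (simp add: outputs_Out del: outputs.simps(1) One_nat_def)
      (simp add: outputs_Out V m tr_arc_expr[OF V m lit] E S product_concat_map map_concat comp_def
        map_replicate_const del: outputs.simps(1) One_nat_def)
qed

lemma poly_reducible_satisfiable:
  assumes k4: "4 \<le> k"
    and valV: "\<And>x \<rho>. val x V \<rho> = V' x" "\<And>x. 0 < V' x" and valm: "\<And>x \<rho>. val x m \<rho> = m' x" "\<And>x. 0 < m' x"
    and lit: "\<And>x \<rho>. tr x lit \<rho> \<longleftrightarrow> lit' x (\<rho> 0) (\<rho> 1 \<noteq> 0) (\<rho> 2)"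
    and L: "\<And>x. x \<in> L \<longleftrightarrow> satisfiable (V' x) (m' x) (lit' x)"
  shows "poly_reducible L (internally_disjoint_trees_problem k)"
proof -
  let ?f = "\<lambda>x. outputs x (sat_cmd k V m lit) (\<lambda>_. 0)"
  have "x \<in> L \<longleftrightarrow> ?f x \<in> internally_disjoint_trees_problem k" for x
  proof -
    define n where "n = (6 + k) * V' x * m' x"
    define q where "q = V' x * m' x + m' x"
    define E where "E = sat_edges k (V' x) (m' x) (lit' x)"
    define S where "S = sat_terminals k (V' x) (m' x)"
    interpret sat_graph k "V' x" "m' x" "lit' x" using k4 valV(2)[of x] valm(2)[of x] by unfold_locales auto
    have f: "?f x = encode n E S q"
      unfolding n_def q_def E_def S_def by (rule outputs_sat_cmd[OF valV(1) valm lit])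
    have iff: "x \<in> L \<longleftrightarrow> q \<le> kappa ({..<n}, E) S"
      using L satisfiable_imp_le_kappa le_kappa_imp_satisfiable unfolding n_def q_def E_def S_def by blast
    have G: "simple_graph ({..<n}, E)" "S \<subseteq> {..<n}" "card S = k"
      using simple S_subset card_S unfolding n_def E_def S_def by auto
    have pos: "1 \<le> V' x * m' x" "1 \<le> m' x" "m' x \<le> V' x * m' x" using valV(2)[of x] valm(2)[of x] by (auto simp: Suc_le_eq)
    \<comment> \<open>The factor \<open>6 + k\<close> in the order of the graph leaves ample room
      for \<open>q < n\<close>.\<close>
    have "2 * (V' x * m' x) + 1 \<le> 6 * (V' x * m' x)" using pos by simp
    also have "\<dots> \<le> n" unfolding n_def mult.assoc by (intro mult_le_mono) auto
    finally have q: "2 \<le> q" "q \<le> n - 1" using pos unfolding q_def by linarith+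
    show ?thesis
    proof
      assume "x \<in> L"
      then show "?f x \<in> internally_disjoint_trees_problem k"
        unfolding f internally_disjoint_trees_problem_def using iff G q by blast
    next
      assume "?f x \<in> internally_disjoint_trees_problem k"
      \<comment> \<open>An encoding determines its instance, so the membership speaks about this
        very graph.\<close>
      then obtain n' E' S' q' where "encode n E S q = encode n' E' S' q'" "simple_graph ({..<n'}, E')"
        "S' \<subseteq> {..<n'}" "q' \<le> kappa ({..<n'}, E') S'"
        unfolding f internally_disjoint_trees_problem_def by blast
      then show "x \<in> L" using encode_inject[of n E S q n' E' S' q'] G iff by blast
    qed
  qed
  then show ?thesis unfolding poly_reducible_def using polytime_outputs by blast
qed

section \<open>Computations as clauses\<close>

lemma pair_contents:
  "i < length x \<Longrightarrow> contents (pair x u) (2 * int i) = 2"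
  "i < length x \<Longrightarrow> contents (pair x u) (2 * int i + 1) = (if x ! i then 2 else 1)"
  "contents (pair x u) (2 * int (length x)) = 1"
  "contents (pair x u) (2 * int (length x) + 1 + int j) = contents u (int j)"
proof -
  have nat: "contents y (int l) = (if l < length y then if y ! l then 2 else 1 else 0)" for y l
    by (simp add: contents_def)
  have e1: "2 * int l = int (2 * l)" and e2: "2 * int l + 1 = int (2 * l + 1)"
    and e3: "2 * int l + 1 + int j = int (2 * l + 1 + j)" for l
    by simp_all
  show "contents (pair x u) (2 * int i) = 2" if "i < length x"
    unfolding e1 nat using pair_nth_mark[OF that, of u] that by (simp add: length_pair)
  show "contents (pair x u) (2 * int i + 1) = (if x ! i then 2 else 1)" if "i < length x"
    unfolding e2 nat using pair_nth_fst[OF that, of u] that by (simp add: length_pair)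
  show "contents (pair x u) (2 * int (length x)) = 1"
    unfolding e1 nat using pair_nth_separator[of x u] by (simp add: length_pair)
  show "contents (pair x u) (2 * int (length x) + 1 + int j) = contents u (int j)"
    unfolding e3 nat pair_nth_snd by (simp add: length_pair)
qed

text \<open>Tapes are described relative to their heads, so that a move shifts the whole tape. In a
  clause the parameters \<open>t\<close> and \<open>r\<close> are variables 10 and 11, and the time and the
  position of a propositional variable are 12 and 13.\<close>

type_synonym literal = "bool \<times> nat \<times> expr"

definition env :: "nat \<Rightarrow> nat \<Rightarrow> nat \<Rightarrow> nat \<Rightarrow> env" where
  "env t r t' r' = (\<lambda>_. 0)(10 := t, 11 := r, 12 := t', 13 := r')"

definition locates :: "expr \<Rightarrow> expr \<Rightarrow> expr" where
  "locates e e' = Conj (Equal (Var 12) e) (Equal (Var 13) e')"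

text \<open>Relative to the head, the old cell \<open>r + 1\<close> becomes the new cell
  \<open>r + shift d\<close>. The added 1 avoids a negative position when the head moves
  right.\<close>

primrec shift :: "move \<Rightarrow> nat" where
  "shift Left = 2"
| "shift Stay = 1"
| "shift Right = 0"

lemma int_shift: "int (shift d) = 1 - offset d"
  by (cases d) auto

lemma shift_le: "shift d \<le> 2"
  by (cases d) auto

section \<open>Clauses that describe a run\<close>

locale cook_levin =
  fixes M :: tm and f :: "bool list \<Rightarrow> bool list" and p b :: "nat poly"
  assumes tm: "turing_machine M" and computes: "computes_within M f (poly b)"
begin

abbreviation "K \<equiv> tape_count M"
abbreviation "H \<equiv> state_count M"
abbreviation "G \<equiv> symbol_count M"

text \<open>The time bound at the greatest length of \<open>pair x u\<close> for an admissible
  certificate \<open>u\<close>.\<close>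

definition T :: "bool list \<Rightarrow> nat" where
  "T x = poly b (2 * length x + 1 + poly p (length x))"

text \<open>The position of the head in every described tape; the tapes are described up to
  \<open>R x\<close>, twice as far. The summand \<open>2 * T x\<close> keeps the output in view
  although the known part shrinks by one cell on each side per step; the others make room for the
  longest input.\<close>

definition C :: "bool list \<Rightarrow> nat" where
  "C x = 2 * T x + 2 * length x + poly p (length x) + 3"

definition R :: "bool list \<Rightarrow> nat" where
  "R x = 2 * C x"

definition T_expr :: expr where
  "T_expr = poly_expr b (Plus (Plus (Times (Const 2) Len) (Const 1)) (poly_expr p Len))"

definition C_expr :: expr where
  "C_expr = Plus (Plus (Plus (Times (Const 2) T_expr) (Times (Const 2) Len)) (poly_expr p Len)) (Const 3)"

definition R_expr :: expr where
  "R_expr = Times (Const 2) C_expr"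

lemma val_T_expr [simp]: "val x T_expr \<rho> = T x"
  and val_C_expr [simp]: "val x C_expr \<rho> = C x"
  and val_R_expr [simp]: "val x R_expr \<rho> = R x"
  by (simp_all add: T_expr_def C_expr_def R_expr_def T_def C_def R_def)

definition cell_kind :: "nat \<Rightarrow> nat \<Rightarrow> nat" where
  "cell_kind k s = Suc H + k * G + s"

definition kinds :: nat where
  "kinds = Suc H + K * G"

lemma cell_kind_less: "k < K \<Longrightarrow> s < G \<Longrightarrow> cell_kind k s < kinds"
  using mult_add_less[of k K s G] by (simp add: cell_kind_def kinds_def)

lemma cell_kind_inject: "s < G \<Longrightarrow> s' < G \<Longrightarrow> cell_kind k s = cell_kind k' s' \<longleftrightarrow> k = k' \<and> s = s'"
proof -
  assume s: "s < G" "s' < G"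
  have "k = (k * G + s) div G" "s = (k * G + s) mod G" "k' = (k' * G + s') div G" "s' = (k' * G + s') mod G"
    using s by auto
  then show ?thesis unfolding cell_kind_def by (metis add_left_cancel add.assoc)
qed

text \<open>A halting state repeats its configuration, so the run can be inspected at the fixed time
  \<open>T x\<close>.\<close>

definition transition :: "nat \<Rightarrow> nat list \<Rightarrow> nat \<times> (nat \<times> move) list" where
  "transition q ss = (if q < H then delta M q ss else (q, map (\<lambda>s. (s, Stay)) ss))"

text \<open>The negated antecedent of a transition. The symbols read are the cells at
  \<open>C x\<close>, wherever the heads are; facts about states are kept at position 0.\<close>

definition premise :: "nat \<Rightarrow> nat list \<Rightarrow> literal list" where
  "premise q ss = (False, q, locates (Var 10) (Const 0)) #
     map (\<lambda>k. (False, cell_kind k (ss ! k), locates (Var 10) C_expr)) [0..<K]"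

definition state_clause :: "nat \<Rightarrow> nat list \<Rightarrow> literal list" where
  "state_clause q ss =
     (True, fst (transition q ss), locates (Plus (Var 10) (Const 1)) (Const 0)) # premise q ss"

text \<open>The two positive literals have complementary guards, so one of them is present: the
  scanned cell receives the written symbol, any other cell keeps its own.\<close>

definition cell_clause :: "nat \<Rightarrow> nat list \<Rightarrow> nat \<Rightarrow> nat \<Rightarrow> literal list" where
  "cell_clause q ss k s =
     (let r = Plus (Var 11) (Const 1); a = snd (transition q ss) ! k;
          l = locates (Plus (Var 10) (Const 1)) (Plus (Var 11) (Const (shift (snd a)))) in
      (True, cell_kind k (fst a), Conj (Equal r C_expr) l) # (True, cell_kind k s, Conj (Neg (Equal r C_expr)) l) #
      (False, cell_kind k s, locates (Var 10) r) # premise q ss)"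

definition init_state_clause :: "literal list" where
  "init_state_clause = [(True, 0, locates (Const 0) (Const 0))]"

definition init_cell_clause :: "nat \<Rightarrow> literal list" where
  "init_cell_clause k = [(True, cell_kind k 0, locates (Const 0) (Plus (Var 11) (Const 1)))]"

text \<open>The only place of real choice: each of the \<open>poly p (length x)\<close> cells behind
  the separator is blank or carries a certificate bit.\<close>

definition input_clause :: "literal list" where
  "input_clause =
    (let r = Plus (Var 11) (Const 1); n = Plus C_expr (Times (Const 2) Len); l = locates (Const 0) r;
         i = Plus C_expr (Times (Const 2) (Var 14)); i' = Plus i (Const 1);
         cert = Conj (Less n r) (Leq r (Plus n (poly_expr p Len))) in
     [(True, cell_kind 0 0, Conj (Disj (Less r C_expr) (Less n r)) l),
      (True, cell_kind 0 1, Conj (Disjs [BEx 14 Len (Conj (Equal r i') (Neg (Bit (Var 14)))), Equal r n, cert]) l),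
      (True, cell_kind 0 2, Conj (Disjs [BEx 14 Len (Equal r i), BEx 14 Len (Conj (Equal r i') (Bit (Var 14))), cert]) l)])"

text \<open>Blanks behind the separator continue to the right, so the certificate may be shorter
  than its bound. Where the first guard fails, the last two literals are complementary and the
  clause holds trivially.\<close>

definition blank_clause :: "literal list" where
  "blank_clause =
    (let r = Plus (Var 11) (Const 1); n = Plus C_expr (Times (Const 2) Len);
         l = locates (Const 0) (Plus (Var 11) (Const 2)) in
     [(False, cell_kind 0 0, Conj (Less n r) (locates (Const 0) r)), (True, cell_kind 0 0, l),
      (False, cell_kind 0 0, Conj (Leq r n) l)])"

text \<open>The place of the output relative to the head is unknown at time \<open>T x\<close>, so
  \<open>[True]\<close> is recognised by its shape: no \<open>False\<close>, no two adjacent cells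
  \<open>True\<close>, and some nonblank cell within distance \<open>T x\<close> of the
  head.\<close>

definition no_False_clause :: "literal list" where
  "no_False_clause = [(False, cell_kind 1 1, locates T_expr (Plus (Var 11) (Const 1)))]"

definition single_clause :: "literal list" where
  "single_clause = [(False, cell_kind 1 2, locates T_expr (Plus (Var 11) (Const 1))),
     (False, cell_kind 1 2, locates T_expr (Plus (Var 11) (Const 2)))]"

definition nonempty_clause :: "literal list" where
  "nonempty_clause = [(False, cell_kind 1 0,
     Conjs [Equal (Var 12) T_expr, Leq C_expr (Plus (Var 13) T_expr), Leq (Var 13) (Plus C_expr T_expr)])]"

definition situations :: "(nat \<times> nat list) list" where
  "situations = List.product [0..<Suc H] (List.n_lists K [0..<G])"

definition clauses :: "literal list list" where
  "clauses =
     map (\<lambda>(q, ss). state_clause q ss) situations @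
     map (\<lambda>((q, ss), (k, s)). cell_clause q ss k s)
       (List.product situations (List.product [0..<K] [0..<G])) @
     map init_cell_clause [1..<K] @
     [init_state_clause, input_clause, blank_clause, no_False_clause, single_clause, nonempty_clause]"

text \<open>A \<open>literal\<close> stands for all propositional variables whose time and position
  satisfy its term: a guard that fails leaves none, an inequality leaves many. The margin 3 admits
  time \<open>t + 1\<close> and positions up to \<open>r + 2\<close>.\<close>

definition lit_sat :: "bool list \<Rightarrow> (nat \<Rightarrow> nat \<Rightarrow> nat \<Rightarrow> bool) \<Rightarrow> nat \<Rightarrow> nat \<Rightarrow> literal \<Rightarrow> bool" where
  "lit_sat x \<sigma> t r l \<longleftrightarrow> (\<exists>t'<R x + 3. \<exists>r'<R x + 3.
     tr x (snd (snd l)) (env t r t' r') \<and> \<sigma> (fst (snd l)) t' r' = fst l)"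

definition clause_sat where
  "clause_sat x \<sigma> t r c \<longleftrightarrow> (\<exists>l\<in>set c. lit_sat x \<sigma> t r l)"

definition all_sat :: "bool list \<Rightarrow> (nat \<Rightarrow> nat \<Rightarrow> nat \<Rightarrow> bool) \<Rightarrow> bool" where
  "all_sat x \<sigma> \<longleftrightarrow> (\<forall>c\<in>set clauses. \<forall>t<R x. \<forall>r<R x. clause_sat x \<sigma> t r c)"

lemma bounds: "C x < R x" "T x < R x" "2 * T x + 2 < C x" "2 * length x + poly p (length x) + 2 < C x"
  by (auto simp: C_def R_def)

lemma R_pos: "0 < R x"
  by (simp add: R_def C_def)

section \<open>Meaning of the clauses\<close>

context
  fixes x :: "bool list" and \<sigma> :: "nat \<Rightarrow> nat \<Rightarrow> nat \<Rightarrow> bool" and t r :: nat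
  assumes t: "t < R x" and r: "r < R x"
begin

lemma env_simps [simp]:
  "env t r t' r' 10 = t" "env t r t' r' 11 = r" "env t r t' r' 12 = t'" "env t r t' r' 13 = r'"
  by (simp_all add: env_def)

lemma lit_sat_guarded [simp]:
  assumes "\<And>t' r'. tr x g (env t r t' r') = tr x g (env t r 0 0)"
    and "\<And>t' r'. val x e (env t r t' r') = val x e (env t r 0 0)" "val x e (env t r 0 0) < R x + 3"
    and "\<And>t' r'. val x e' (env t r t' r') = val x e' (env t r 0 0)" "val x e' (env t r 0 0) < R x + 3"
  shows "lit_sat x \<sigma> t r (s, k, Conj g (locates e e')) \<longleftrightarrow> tr x g (env t r 0 0) \<and>
    \<sigma> k (val x e (env t r 0 0)) (val x e' (env t r 0 0)) = s"
proof -
  have "lit_sat x \<sigma> t r (s, k, Conj g (locates e e')) \<longleftrightarrow> P \<and> \<sigma> k i j = s"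
    if "\<And>t' r'. tr x g (env t r t' r') = P" "\<And>t' r'. val x e (env t r t' r') = i" "i < R x + 3"
      "\<And>t' r'. val x e' (env t r t' r') = j" "j < R x + 3" for P i j
    using that by (auto simp: lit_sat_def locates_def)
  from this[OF assms] show ?thesis .
qed

lemma lit_sat_locates [simp]:
  assumes "\<And>t' r'. val x e (env t r t' r') = val x e (env t r 0 0)" "val x e (env t r 0 0) < R x + 3"
    and "\<And>t' r'. val x e' (env t r t' r') = val x e' (env t r 0 0)" "val x e' (env t r 0 0) < R x + 3"
  shows "lit_sat x \<sigma> t r (s, k, locates e e') \<longleftrightarrow>
    \<sigma> k (val x e (env t r 0 0)) (val x e' (env t r 0 0)) = s"
proof -
  have "lit_sat x \<sigma> t r (s, k, locates e e') = lit_sat x \<sigma> t r (s, k, Conj (Const 1) (locates e e'))"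
    by (simp add: lit_sat_def)
  then show ?thesis using lit_sat_guarded[of "Const 1", OF _ assms] by simp
qed

lemma premise_sat: "(\<exists>l\<in>set (premise q ss). lit_sat x \<sigma> t r l) \<longleftrightarrow>
    \<not> (\<sigma> q t 0 \<and> (\<forall>k<K. \<sigma> (cell_kind k (ss ! k)) t (C x)))"
  using t bounds(1)[of x] by (auto simp: premise_def)

lemma state_clause_sat: "clause_sat x \<sigma> t r (state_clause q ss) \<longleftrightarrow>
    (\<sigma> q t 0 \<and> (\<forall>k<K. \<sigma> (cell_kind k (ss ! k)) t (C x)) \<longrightarrow> \<sigma> (fst (transition q ss)) (t + 1) 0)"
  using t by (auto simp: clause_sat_def state_clause_def premise_sat)

lemma cell_clause_sat: "clause_sat x \<sigma> t r (cell_clause q ss k s) \<longleftrightarrow>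
    (\<sigma> q t 0 \<and> (\<forall>k<K. \<sigma> (cell_kind k (ss ! k)) t (C x)) \<and> \<sigma> (cell_kind k s) t (r + 1) \<longrightarrow>
     \<sigma> (cell_kind k (if r + 1 = C x then fst (snd (transition q ss) ! k) else s)) (t + 1)
       (r + shift (snd (snd (transition q ss) ! k))))"
proof -
  have "r + shift d < R x + 3" for d using r shift_le[of d] by simp
  then show ?thesis using t r by (auto simp: clause_sat_def cell_clause_def Let_def premise_sat)
qed

lemma init_state_clause_sat: "clause_sat x \<sigma> t r init_state_clause \<longleftrightarrow> \<sigma> 0 0 0"
  by (simp add: clause_sat_def init_state_clause_def)

lemma init_cell_clause_sat: "clause_sat x \<sigma> t r (init_cell_clause k) \<longleftrightarrow> \<sigma> (cell_kind k 0) 0 (r + 1)"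
  using r by (simp add: clause_sat_def init_cell_clause_def)

lemma input_clause_sat: "clause_sat x \<sigma> t r input_clause \<longleftrightarrow>
    (r + 1 < C x \<or> C x + 2 * length x < r + 1) \<and> \<sigma> (cell_kind 0 0) 0 (r + 1) \<or>
    ((\<exists>i<length x. r + 1 = C x + 2 * i + 1 \<and> \<not> x ! i) \<or> r + 1 = C x + 2 * length x \<or>
      C x + 2 * length x < r + 1 \<and> r + 1 \<le> C x + 2 * length x + poly p (length x)) \<and>
      \<sigma> (cell_kind 0 1) 0 (r + 1) \<or>
    ((\<exists>i<length x. r + 1 = C x + 2 * i) \<or> (\<exists>i<length x. r + 1 = C x + 2 * i + 1 \<and> x ! i) \<or>
      C x + 2 * length x < r + 1 \<and> r + 1 \<le> C x + 2 * length x + poly p (length x)) \<and>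
      \<sigma> (cell_kind 0 2) 0 (r + 1)"
  using r by (auto simp: clause_sat_def input_clause_def Let_def simp del: One_nat_def)

lemma blank_clause_sat: "clause_sat x \<sigma> t r blank_clause \<longleftrightarrow>
    (C x + 2 * length x < r + 1 \<and> \<sigma> (cell_kind 0 0) 0 (r + 1) \<longrightarrow> \<sigma> (cell_kind 0 0) 0 (r + 2))"
  using r by (auto simp: clause_sat_def blank_clause_def Let_def)

lemma no_False_clause_sat: "clause_sat x \<sigma> t r no_False_clause \<longleftrightarrow> \<not> \<sigma> (cell_kind 1 1) (T x) (r + 1)"
  using r bounds(2)[of x] by (simp add: clause_sat_def no_False_clause_def)

lemma single_clause_sat: "clause_sat x \<sigma> t r single_clause \<longleftrightarrow>
    \<not> (\<sigma> (cell_kind 1 2) (T x) (r + 1) \<and> \<sigma> (cell_kind 1 2) (T x) (r + 2))"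
  using r bounds(2)[of x] by (auto simp: clause_sat_def single_clause_def)

lemma nonempty_clause_sat: "clause_sat x \<sigma> t r nonempty_clause \<longleftrightarrow>
    (\<exists>r'. C x \<le> r' + T x \<and> r' \<le> C x + T x \<and> \<not> \<sigma> (cell_kind 1 0) (T x) r')"
proof -
  have r': "r' < R x + 3" if "r' \<le> C x + T x" for r' using that bounds[of x] by (simp add: R_def)
  have T: "T x < R x + 3" using bounds(2)[of x] by simp
  have "clause_sat x \<sigma> t r nonempty_clause \<longleftrightarrow> (\<exists>t'<R x + 3. \<exists>r'<R x + 3. (t' = T x \<and> C x \<le> r' + T x \<and> r' \<le> C x + T x) \<and>
      \<not> \<sigma> (cell_kind 1 0) t' r')"
    unfolding clause_sat_def nonempty_clause_def lit_sat_def by (simp del: One_nat_def)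
  then show ?thesis using r' T by blast
qed

end


section \<open>Runs seen from the heads\<close>

definition well_formed :: "config \<Rightarrow> bool" where
  "well_formed c \<longleftrightarrow> fst c \<le> H \<and> length (snd c) = K \<and> (\<forall>k<K. \<forall>i. fst (snd c ! k) i < G)"

definition conf :: "bool list \<Rightarrow> nat \<Rightarrow> config" where
  "conf y t = (step M ^^ t) (initial_config M y)"

definition cell :: "nat \<Rightarrow> config \<Rightarrow> nat \<Rightarrow> nat \<Rightarrow> nat" where
  "cell m c k r = fst (snd c ! k) (snd (snd c ! k) + int r - int m)"

abbreviation reads :: "config \<Rightarrow> nat list" where
  "reads c \<equiv> map read (snd c)"

lemma K_G: "2 \<le> K" "3 \<le> G"
  using tm by (auto simp: turing_machine_def)

lemma small: "0 < K" "1 < K" "0 < G" "1 < G" "2 < G"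
  using K_G by auto

lemma read_eq: "read t = fst t (snd t)"
  by (cases t) simp

lemma reads_ok:
  assumes "well_formed c"
  shows "length (reads c) = K" "set (reads c) \<subseteq> {..<G}" "k < K \<Longrightarrow> reads c ! k = cell m c k m"
proof -
  have read_less: "read (snd c ! i) < G" if "i < K" for i
    using assms that by (simp add: well_formed_def read_eq)
  show "length (reads c) = K" "k < K \<Longrightarrow> reads c ! k = cell m c k m"
    using assms by (simp_all add: well_formed_def cell_def read_eq)
  show "set (reads c) \<subseteq> {..<G}"
  proof
    fix a assume "a \<in> set (reads c)"
    then obtain i where "i < K" "a = read (snd c ! i)"
      using assms by (metis in_set_conv_nth length_map nth_map well_formed_def)
    then show "a \<in> {..<G}" using read_less by simp
  qed
qed

lemma transition_ok:
  assumes "q \<le> H" "length ss = K" "set ss \<subseteq> {..<G}"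
  shows "fst (transition q ss) \<le> H" "length (snd (transition q ss)) = K" "k < K \<Longrightarrow> fst (snd (transition q ss) ! k) < G"
proof -
  have 1: "fst (transition q ss) \<le> H \<and> length (snd (transition q ss)) = K \<and> fst ` set (snd (transition q ss)) \<subseteq> {..<G}"
  proof (cases "q < H")
    case True
    then show ?thesis using tm assms(2,3) unfolding turing_machine_def transition_def by simp
  next
    case False
    then show ?thesis using assms by (auto simp: transition_def)
  qed
  then show "fst (transition q ss) \<le> H" "length (snd (transition q ss)) = K" by auto
  show "fst (snd (transition q ss) ! k) < G" if "k < K"
    using 1 that by (metis image_subset_iff lessThan_iff nth_mem)
qed

lemma step_transition:
  assumes "well_formed c"
  shows "step M c = (fst (transition (fst c) (reads c)), map2 act (snd (transition (fst c) (reads c))) (snd c))"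
proof (cases "fst c < H")
  case True
  then show ?thesis by (simp add: step_def transition_def split: prod.splits) (metis fst_conv snd_conv)
next
  case False
  have "map2 act (map (\<lambda>s. (s, Stay)) (map read ts)) ts = ts" for ts
    by (induction ts) auto
  with False show ?thesis by (cases c) (simp add: step_def transition_def)
qed

lemma act_eq: "act a t = ((fst t)(snd t := fst a), snd t + offset (snd a))"
  by (cases a; cases t) simp

lemma well_formed_step:
  assumes "well_formed c"
  shows "well_formed (step M c)"
  using assms transition_ok[OF _ reads_ok(1,2)[OF assms]] unfolding step_transition[OF assms]
  by (auto simp: well_formed_def act_eq)

text \<open>\<open>shift\<close> cancels the offset of the head, so the rule is the same for all
  head positions and can be stated by clauses.\<close>

lemma cell_step:
  assumes c: "well_formed c" and k: "k < K"
  shows "cell m (step M c) k (r + shift (snd (snd (transition (fst c) (reads c)) ! k))) =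
    (if r + 1 = m then fst (snd (transition (fst c) (reads c)) ! k) else cell m c k (r + 1))"
proof -
  have len: "length (snd (transition (fst c) (reads c))) = K" "length (snd c) = K"
    using c transition_ok(2)[OF _ reads_ok(1,2)[OF c]] by (auto simp: well_formed_def)
  show ?thesis
    unfolding step_transition[OF c] cell_def using k len
    by (simp add: act_eq int_shift algebra_simps)
qed

lemma well_formed_conf: "well_formed (conf y t)"
proof (induction t)
  case 0
  have "contents y i < G" for y i using K_G by (simp add: contents_def)
  then show ?case using K_G
    by (auto simp: conf_def well_formed_def initial_config_def nth_Cons split: nat.split)
next
  case (Suc t)
  then show ?case using well_formed_step by (simp add: conf_def)
qed

lemma conf_Suc: "conf y (Suc t) = step M (conf y t)"
  by (simp add: conf_def)

lemma cell_conf_0: "k < K \<Longrightarrow> cell m (conf y 0) k r = (if k = 0 then contents y (int r - int m) else 0)"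
  by (cases k) (auto simp: cell_def conf_def initial_config_def contents_def)

text \<open>Limits where output cell 0 can appear relative to the head, which justifies the interval
  in \<open>nonempty_clause\<close>.\<close>

lemma head_bound: "k < K \<Longrightarrow> \<bar>snd (snd (conf y t) ! k)\<bar> \<le> int t"
proof (induction t)
  case 0
  then show ?case by (cases k) (auto simp: conf_def initial_config_def)
next
  case (Suc t)
  let ?c = "conf y t"
  have len: "length (snd (transition (fst ?c) (reads ?c))) = K" "length (snd ?c) = K"
    using well_formed_conf[of y t] transition_ok(2)[OF _ reads_ok(1,2)[OF well_formed_conf[of y t]]]
    by (auto simp: well_formed_def)
  have "\<bar>h + offset d\<bar> \<le> 1 + int t" if "\<bar>h\<bar> \<le> int t" for h d
    using that by (cases d) auto
  with Suc len show ?case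
    unfolding conf_Suc step_transition[OF well_formed_conf] by (simp add: act_eq)
qed

lemma conf_output:
  assumes "length u \<le> poly p (length x)"
  shows "fst (snd (conf (pair x u) (T x)) ! 1) = contents (f (pair x u))"
proof -
  let ?y = "pair x u"
  obtain t ts where t: "t \<le> poly b (length ?y)" "conf ?y t = (H, ts)" "fst (ts ! 1) = contents (f ?y)"
    using computes unfolding computes_within_def conf_def by blast
  have "poly b (length ?y) \<le> T x"
    unfolding T_def length_pair using assms by (intro poly_mono_nat) simp
  then obtain s where s: "T x = t + s" using t(1) by (metis le_trans le_Suc_ex)
  have "conf ?y (t + s) = (H, ts)"
  proof (induction s)
    case (Suc s)
    then show ?case by (simp add: conf_Suc step_def)
  qed (simp add: t(2))
  then show "fst (snd (conf ?y (T x)) ! 1) = contents (f ?y)"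
    unfolding s using t(3) by simp
qed

lemma position_cases:
  fixes r m n :: nat
  obtains "r < m" | i where "i < n" "r = m + 2 * i" | i where "i < n" "r = m + 2 * i + 1"
    | "r = m + 2 * n" | j where "r = m + 2 * n + 1 + j"
proof -
  consider "r < m" | "m \<le> r" "r < m + 2 * n" | "r = m + 2 * n" | "m + 2 * n < r" by linarith
  then show ?thesis
  proof cases
    case 2
    define i where "i = (r - m) div 2"
    have "i < n" "r = m + 2 * i \<or> r = m + 2 * i + 1" using 2 by (auto simp: i_def)
    then show ?thesis using that by blast
  next
    case 4
    then show ?thesis using that(5)[of "r - (m + 2 * n + 1)"] by simp
  qed (use that in blast)+
qed

text \<open>Cases along \<open>pair x u\<close>, for an arbitrary \<open>P\<close>, so as to serve
  both what the clauses allow and what they force.\<close>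

lemma cell_input:
  assumes "r < m \<Longrightarrow> P 0" "\<And>i. i < length x \<Longrightarrow> r = m + 2 * i \<Longrightarrow> P 2"
    and "\<And>i. i < length x \<Longrightarrow> r = m + 2 * i + 1 \<Longrightarrow> P (if x ! i then 2 else 1)"
    and "r = m + 2 * length x \<Longrightarrow> P 1"
    and "\<And>j. r = m + 2 * length x + 1 + j \<Longrightarrow> P (contents u (int j))"
  shows "P (contents (pair x u) (int r - int m))"
proof (cases rule: position_cases[where r = r and m = m and n = "length x"])
  case 1
  then have "contents (pair x u) (int r - int m) = 0" by (simp add: contents_def)
  then show ?thesis using assms(1)[OF 1] by simp
next
  case (2 i)
  then have "int r - int m = 2 * int i" by simp
  then show ?thesis using assms(2)[OF 2] 2 by (simp add: pair_contents)
next
  case (3 i)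
  then have "int r - int m = 2 * int i + 1" by simp
  then show ?thesis using assms(3)[OF 3] 3 by (simp only: pair_contents)
next
  case 4
  then have "int r - int m = 2 * int (length x)" by simp
  then show ?thesis using assms(4)[OF 4] by (simp only: pair_contents)
next
  case (5 j)
  then have "int r - int m = 2 * int (length x) + 1 + int j" by simp
  then show ?thesis using assms(5)[OF 5] by (simp only: pair_contents)
qed

section \<open>Accepting runs and satisfying assignments\<close>

lemma set_clauses: "c \<in> set clauses \<longleftrightarrow>
    (\<exists>q\<le>H. \<exists>ss. length ss = K \<and> set ss \<subseteq> {..<G} \<and>
      (c = state_clause q ss \<or> (\<exists>k<K. \<exists>s<G. c = cell_clause q ss k s))) \<or>
    (\<exists>k<K. k \<noteq> 0 \<and> c = init_cell_clause k) \<or>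
    c \<in> {init_state_clause, input_clause, blank_clause, no_False_clause, single_clause, nonempty_clause}"
proof -
  have sit: "set situations = {(q, ss). q \<le> H \<and> length ss = K \<and> set ss \<subseteq> {..<G}}"
    by (auto simp: situations_def set_n_lists subset_iff)
  have A: "c \<in> set (map (\<lambda>(q, ss). state_clause q ss) situations) \<longleftrightarrow>
      (\<exists>q\<le>H. \<exists>ss. length ss = K \<and> set ss \<subseteq> {..<G} \<and> c = state_clause q ss)"
    unfolding set_map sit by auto
  have B: "c \<in> set (map (\<lambda>((q, ss), (k, s)). cell_clause q ss k s)
       (List.product situations (List.product [0..<K] [0..<G]))) \<longleftrightarrow>
      (\<exists>q\<le>H. \<exists>ss. length ss = K \<and> set ss \<subseteq> {..<G} \<and> (\<exists>k<K. \<exists>s<G. c = cell_clause q ss k s))"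
    unfolding set_map set_product sit by (auto simp: image_iff Bex_def)
  have D: "c \<in> set (map init_cell_clause [1..<K]) \<longleftrightarrow> (\<exists>k<K. k \<noteq> 0 \<and> c = init_cell_clause k)"
    by auto
  show ?thesis
    unfolding clauses_def set_append Un_iff A B D by (simp only: list.set) blast
qed


lemma clause_cases [consumes 1, case_names state cell init other]:
  assumes "c \<in> set clauses"
  obtains q ss where "q \<le> H" "length ss = K" "set ss \<subseteq> {..<G}" "c = state_clause q ss"
    | q ss k s where "q \<le> H" "length ss = K" "set ss \<subseteq> {..<G}" "k < K" "s < G" "c = cell_clause q ss k s"
    | k where "k < K" "k \<noteq> 0" "c = init_cell_clause k"
    | "c \<in> {init_state_clause, input_clause, blank_clause, no_False_clause, single_clause, nonempty_clause}"
  using assms unfolding set_clauses by blast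

lemma all_satD:
  assumes "all_sat x \<sigma>" "c \<in> set clauses" "t < R x" "r < R x"
  shows "clause_sat x \<sigma> t r c"
  using assms by (simp add: all_sat_def)

lemma all_sat_if_accepts:
  assumes u: "length u \<le> poly p (length x)" "f (pair x u) = [True]"
  shows "\<exists>\<sigma>. all_sat x \<sigma>"
proof -
  let ?y = "pair x u" and ?C = "C x"
  let ?c = "conf ?y"
  define \<sigma> where "\<sigma> kd t r \<longleftrightarrow> (if kd \<le> H then fst (?c t) = kd
    else \<exists>k<K. \<exists>s<G. kd = cell_kind k s \<and> cell ?C (?c t) k r = s)" for kd t r
  have st: "\<sigma> q t r \<longleftrightarrow> fst (?c t) = q" if "q \<le> H" for q t r using that by (simp add: \<sigma>_def)
  have ce: "\<sigma> (cell_kind k s) t r \<longleftrightarrow> cell ?C (?c t) k r = s" if "k < K" "s < G" for k s t r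
  proof -
    have "\<not> cell_kind k s \<le> H" by (simp add: cell_kind_def)
    then show ?thesis using that by (auto simp: \<sigma>_def cell_kind_inject)
  qed
  have wf: "well_formed (?c t)" for t by (rule well_formed_conf)
  have len: "length ss = K \<Longrightarrow> (\<forall>k<K. reads (?c t) ! k = ss ! k) \<longleftrightarrow> ss = reads (?c t)" for ss t
    using reads_ok(1)[OF wf[of t]] by (auto simp: list_eq_iff_nth_eq)
  have body: "\<sigma> q t 0 \<and> (\<forall>k<K. \<sigma> (cell_kind k (ss ! k)) t ?C) \<longleftrightarrow> q = fst (?c t) \<and> ss = reads (?c t)"
    if q: "q \<le> H" and ss: "length ss = K" "set ss \<subseteq> {..<G}" for q ss t
  proof -
    have "ss ! k < G" if "k < K" for k using ss that by (metis lessThan_iff nth_mem subsetD)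
    then have "(\<forall>k<K. \<sigma> (cell_kind k (ss ! k)) t ?C) \<longleftrightarrow> (\<forall>k<K. reads (?c t) ! k = ss ! k)"
      using ce reads_ok(3)[OF wf[of t], of _ ?C] by simp
    then show ?thesis using st[OF q] len[OF ss(1)] by auto
  qed
  have out: "cell ?C (?c (T x)) 1 r = contents [True] (snd (snd (?c (T x)) ! 1) + int r - int ?C)" for r
    using conf_output[OF u(1)] u(2) by (simp add: cell_def)
  have "clause_sat x \<sigma> t r c" if c: "c \<in> set clauses" and tr: "t < R x" "r < R x" for c t r
  proof -
    from c show ?thesis
    proof (cases rule: clause_cases)
      case 1: (state q ss)
      have "fst (transition q ss) \<le> H" using transition_ok(1) 1 by blast
      then show ?thesis
        unfolding 1(4) state_clause_sat[OF tr] body[OF 1(1-3)]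
        using step_transition[OF wf[of t]] by (auto simp: st conf_Suc simp flip: Suc_eq_plus1)
    next
      case 2: (cell q ss k s)
      have w: "fst (snd (transition q ss) ! k) < G" using transition_ok(3) 2 by blast
      have "cell ?C (?c (t + 1)) k (r + shift (snd (snd (transition q ss) ! k))) =
          (if r + 1 = ?C then fst (snd (transition q ss) ! k) else s)"
        if "q = fst (?c t)" "ss = reads (?c t)" "cell ?C (?c t) k (r + 1) = s"
        unfolding Suc_eq_plus1[symmetric] conf_Suc that(1,2)
        using cell_step[OF wf 2(4), of ?C t r] that(3) by simp
      then show ?thesis
        unfolding 2(6) cell_clause_sat[OF tr] conj_assoc[symmetric] body[OF 2(1-3)]
        using 2(4,5) w by (auto simp: ce)
    next
      case (init k)
      then show ?thesis by (simp add: init_cell_clause_sat[OF tr] ce small cell_conf_0)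
    next
      case other
      then consider (4) "c = init_state_clause" | (5) "c = input_clause" | (6) "c = blank_clause"
        | (7) "c = no_False_clause" | (8) "c = single_clause" | (9) "c = nonempty_clause" by blast
      then show ?thesis
      proof cases
        case 4
        then show ?thesis by (simp add: init_state_clause_sat[OF tr] st) (simp add: conf_def initial_config_def)
      next
        case 5
        show ?thesis
          unfolding 5 input_clause_sat[OF tr] ce[OF small(1) small(3)] ce[OF small(1) small(4)] ce[OF small(1) small(5)]
            cell_conf_0[OF small(1)]
          by (rule cell_input[where P = "\<lambda>a. (_ \<and> (if 0 = 0 then a else 0) = 0) \<or> (_ \<and> (if 0 = 0 then a else 0) = 1) \<or>
              (_ \<and> (if 0 = 0 then a else 0) = 2)"])
            (use u(1) in \<open>auto simp: contents_def\<close>)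
      next
        case 6
        have "contents ?y (int (r + 2) - int ?C) = 0"
          if "?C + 2 * length x < r + 1" "contents ?y (int (r + 1) - int ?C) = 0"
          using that by (auto simp: contents_def split: if_splits)
        then show ?thesis unfolding 6 blank_clause_sat[OF tr] by (simp add: ce small cell_conf_0)
      next
        case 7
        show ?thesis unfolding 7 no_False_clause_sat[OF tr] ce[OF small(2,4)] out
          by (simp add: contents_def)
      next
        case 8
        show ?thesis unfolding 8 single_clause_sat[OF tr] ce[OF small(2,5)] out
          by (simp add: contents_def)
      next
        case 9
        define h where "h = snd (snd (?c (T x)) ! 1)"
        have h: "\<bar>h\<bar> \<le> int (T x)" unfolding h_def by (rule head_bound[OF small(2)])
        \<comment> \<open>The place of output cell 0, which holds \<open>True\<close>.\<close>
        define r' where "r' = nat (int ?C - h)"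
        have r': "int r' = int ?C - h" using h bounds(3)[of x] by (simp add: r'_def)
        have "?C \<le> r' + T x" "r' \<le> ?C + T x" using r' h by linarith+
        moreover have "cell ?C (?c (T x)) 1 r' = 2" unfolding out h_def[symmetric] r' by (simp add: contents_def)
        ultimately show ?thesis unfolding 9 nonempty_clause_sat[OF tr] ce[OF small(2,3)] by auto
      qed
    qed
  qed
  then show ?thesis unfolding all_sat_def by blast
qed

text \<open>A certificate is read off the input cells; then \<open>\<sigma>\<close> contains the
  facts of the run on it, possibly among others. The negative clauses forbid facts, so they apply to
  the true output.\<close>

lemma accepts_if_all_sat:
  assumes sat: "all_sat x \<sigma>"
  shows "\<exists>u. length u \<le> poly p (length x) \<and> f (pair x u) = [True]"
proof -
  let ?C = "C x" and ?n = "length x" and ?P = "poly p (length x)"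
  let ?b = "?C + 2 * ?n + 1"
  note clauseD = all_satD[OF sat, unfolded set_clauses]
  define z where "z r = \<sigma> (cell_kind 0 0) 0 r" for r
  have input: "clause_sat x \<sigma> 0 r input_clause" and blank: "clause_sat x \<sigma> 0 r blank_clause" if "r < R x" for r
    using clauseD[of input_clause 0 r] clauseD[of blank_clause 0 r] that R_pos[of x] by blast+
  have blank_next: "z (r + 1)" if "?b \<le> r" "r \<le> R x" "z r" for r
    using blank[of "r - 1"] blank_clause_sat[of 0 x "r - 1" \<sigma>] that R_pos[of x] by (simp add: z_def)
  \<comment> \<open>The certificate ends before the first blank, at the latest at its length bound.
    Before that, \<open>input_clause\<close> leaves only the two bits.\<close>
  define l where "l = (LEAST j. j = ?P \<or> z (?b + j))"
  define u where "u = map (\<lambda>j. \<sigma> (cell_kind 0 2) 0 (?b + j)) [0..<l]"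
  have l: "l = ?P \<or> z (?b + l)" unfolding l_def by (rule LeastI[of _ ?P]) simp
  have lP: "l \<le> ?P" unfolding l_def by (rule Least_le) simp
  have nz: "\<not> z (?b + j)" if "j < l" for j using not_less_Least that unfolding l_def by blast
  have u: "length u \<le> ?P" using lP by (simp add: u_def)
  let ?y = "pair x u"
  let ?c = "conf ?y"
  have wf: "well_formed (?c t)" for t by (rule well_formed_conf)
  have inp: "(r < ?C \<or> ?C + 2 * ?n < r) \<and> \<sigma> (cell_kind 0 0) 0 r \<or>
    ((\<exists>i<?n. r = ?C + 2 * i + 1 \<and> \<not> x ! i) \<or> r = ?C + 2 * ?n \<or> ?C + 2 * ?n < r \<and> r \<le> ?C + 2 * ?n + ?P) \<and>
      \<sigma> (cell_kind 0 1) 0 r \<or>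
    ((\<exists>i<?n. r = ?C + 2 * i) \<or> (\<exists>i<?n. r = ?C + 2 * i + 1 \<and> x ! i) \<or>
      ?C + 2 * ?n < r \<and> r \<le> ?C + 2 * ?n + ?P) \<and> \<sigma> (cell_kind 0 2) 0 r" if "1 \<le> r" "r \<le> R x" for r
  proof -
    have r: "r - 1 < R x" "r - 1 + 1 = r" using that by auto
    show ?thesis using input[OF r(1)] unfolding input_clause_sat[OF R_pos[of x] r(1)] r(2) .
  qed
  have tape0: "\<sigma> (cell_kind 0 (contents ?y (int r - int ?C))) 0 r" if r: "1 \<le> r" "r \<le> R x" for r
  proof (rule cell_input)
    assume "r < ?C"
    then show "\<sigma> (cell_kind 0 0) 0 r" using inp[OF r] by auto
  next
    fix i assume "i < ?n" "r = ?C + 2 * i"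
    then show "\<sigma> (cell_kind 0 2) 0 r" using inp[OF r] by auto presburger+
  next
    fix i assume i: "i < ?n" "r = ?C + 2 * i + 1"
    then have "i' = i" if "r = ?C + 2 * i' + 1" for i' using that by simp
    moreover have "r \<noteq> ?C + 2 * i'" for i' using i by presburger
    ultimately show "\<sigma> (cell_kind 0 (if x ! i then 2 else 1)) 0 r" using inp[OF r] i by auto
  next
    assume r': "r = ?C + 2 * ?n"
    then have "r \<noteq> ?C + 2 * i + 1" for i by presburger
    then show "\<sigma> (cell_kind 0 1) 0 r" using inp[OF r] r' by auto
  next
    fix j assume rj: "r = ?C + 2 * ?n + 1 + j"
    show "\<sigma> (cell_kind 0 (contents u (int j))) 0 r"
    proof (cases "j < l")
      case True
      then have "\<not> \<sigma> (cell_kind 0 0) 0 r" using nz[OF True] rj by (simp add: z_def)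
      moreover have "contents u (int j) = (if \<sigma> (cell_kind 0 2) 0 r then 2 else 1)"
        using True rj by (simp add: contents_def u_def)
      ultimately show ?thesis using inp[OF r] rj by auto
    next
      case False
      \<comment> \<open>The cell at \<open>l\<close> is blank by choice of \<open>l\<close>, or
        because no bit is allowed beyond the bound; the blanks then spread to the right.\<close>
      have chain: "z (?b + (l + d))" if "?b + (l + d) \<le> R x" for d
        using that
      proof (induction d)
        case 0
        show ?case
        proof (cases "l = ?P")
          case True
          have "1 \<le> ?b + l" by simp
          then show ?thesis using inp[of "?b + l"] 0 True by (auto simp: z_def)
        qed (use l in simp)
      next
        case (Suc d)
        then show ?case using blank_next[of "?b + (l + d)"] by simp
      qed
      have "z r" using chain[of "j - l"] False r rj by simp
      moreover have "contents u (int j) = 0" using False by (simp add: contents_def u_def)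
      ultimately show ?thesis by (simp add: z_def)
    qed
  qed
  \<comment> \<open>A border cell would depend on a cell outside the described part, so the known
    part loses one cell on each side per step.\<close>
  have run: "\<sigma> (fst (?c t)) t 0 \<and>
      (\<forall>k<K. \<forall>r. t + 1 \<le> r \<and> r + t \<le> R x \<longrightarrow> \<sigma> (cell_kind k (cell ?C (?c t) k r)) t r)" if "t \<le> T x" for t
    using that
  proof (induction t)
    case 0
    have "clause_sat x \<sigma> 0 0 init_state_clause" using clauseD[of init_state_clause 0 0] R_pos[of x] by blast
    then have "\<sigma> 0 0 0" by (simp add: init_state_clause_sat[OF R_pos[of x] R_pos[of x]])
    moreover have "\<sigma> (cell_kind k 0) 0 r" if "k < K" "k \<noteq> 0" "1 \<le> r" "r \<le> R x" for k r
    proof -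
      have r: "r - 1 < R x" "r - 1 + 1 = r" using that by auto
      have "clause_sat x \<sigma> 0 (r - 1) (init_cell_clause k)"
        using clauseD[of "init_cell_clause k" 0 "r - 1"] that R_pos[of x] r by blast
      then show ?thesis unfolding init_cell_clause_sat[OF R_pos[of x] r(1)] r(2) .
    qed
    ultimately show ?case
      using tape0 by (auto simp: cell_conf_0) (simp add: conf_def initial_config_def)
  next
    case (Suc t)
    let ?q = "fst (?c t)" and ?ss = "reads (?c t)"
    have IH: "\<sigma> ?q t 0" "\<And>k r. k < K \<Longrightarrow> t + 1 \<le> r \<Longrightarrow> r + t \<le> R x \<Longrightarrow> \<sigma> (cell_kind k (cell ?C (?c t) k r)) t r"
      using Suc by auto
    have t: "t < R x" "t + 1 \<le> ?C" "?C + t \<le> R x" using Suc.prems bounds[of x] by (simp_all add: R_def)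
    have q: "?q \<le> H" "length ?ss = K" "set ?ss \<subseteq> {..<G}"
      using wf[of t] reads_ok[OF wf[of t]] by (auto simp: well_formed_def)
    have reads: "\<forall>k<K. \<sigma> (cell_kind k (?ss ! k)) t ?C"
      using IH(2)[OF _ t(2,3)] reads_ok(3)[OF wf[of t], of _ ?C] by simp
    have "clause_sat x \<sigma> t 0 (state_clause ?q ?ss)"
      using clauseD[of "state_clause ?q ?ss" t 0] q t(1) R_pos[of x] by blast
    then have "\<sigma> (fst (transition ?q ?ss)) (t + 1) 0"
      unfolding state_clause_sat[OF t(1) R_pos[of x]] using IH(1) reads by blast
    then have "\<sigma> (fst (?c (Suc t))) (Suc t) 0"
      unfolding conf_Suc step_transition[OF wf] by simp
    moreover have "\<sigma> (cell_kind k (cell ?C (?c (Suc t)) k r)) (Suc t) r"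
      if k: "k < K" and r: "Suc t + 1 \<le> r" "r + Suc t \<le> R x" for k r
    proof -
      let ?d = "shift (snd (snd (transition ?q ?ss) ! k))"
      \<comment> \<open>The new cell \<open>r\<close> is the old cell \<open>r' + 1\<close>.\<close>
      define r' where "r' = r - ?d"
      have r': "r = r' + ?d" "t + 1 \<le> r' + 1" "r' + 1 + t \<le> R x" "r' < R x"
        using r shift_le[of "snd (snd (transition ?q ?ss) ! k)"] by (auto simp: r'_def)
      let ?s = "cell ?C (?c t) k (r' + 1)"
      have s: "?s < G" using wf[of t] k by (simp add: well_formed_def cell_def)
      have "clause_sat x \<sigma> t r' (cell_clause ?q ?ss k ?s)"
        using clauseD[of "cell_clause ?q ?ss k ?s" t r'] q k s t(1) r'(4) by blast
      then have "\<sigma> (cell_kind k (if r' + 1 = ?C then fst (snd (transition ?q ?ss) ! k) else ?s)) (t + 1) (r' + ?d)"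
        unfolding cell_clause_sat[OF t(1) r'(4)] using IH(1) reads IH(2)[OF k r'(2,3)] by blast
      then show ?thesis
        unfolding conf_Suc cell_step[OF wf k, of ?C t r', folded r'(1), symmetric]
        using r'(1) cell_step[OF wf k, of ?C t r'] by simp
    qed
    ultimately show ?case by blast
  qed
  define h where "h = snd (snd (?c (T x)) ! 1)"
  have h: "\<bar>h\<bar> \<le> int (T x)" unfolding h_def by (rule head_bound[OF small(2)])
  define r\<^sub>0 where "r\<^sub>0 = nat (int ?C - h)"
  have r\<^sub>0: "int r\<^sub>0 = int ?C - h" "T x + 2 \<le> r\<^sub>0" "r\<^sub>0 + 1 + T x < R x"
    using h bounds(3)[of x] by (auto simp: r\<^sub>0_def R_def)
  have cell: "cell ?C (?c (T x)) 1 r = contents (f ?y) (int r - int r\<^sub>0)" for r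
  proof -
    have "h + int r - int ?C = int r - int r\<^sub>0" using r\<^sub>0(1) by simp
    with conf_output[OF u] show ?thesis unfolding cell_def h_def[symmetric] by (simp only:)
  qed
  have final: "\<sigma> (cell_kind 1 (contents (f ?y) (int r - int r\<^sub>0))) (T x) r"
    if "T x + 1 \<le> r" "r + T x \<le> R x" for r
    using run[of "T x"] small(2) that unfolding cell[symmetric] by blast
  have 0: "\<sigma> (cell_kind 1 (contents (f ?y) 0)) (T x) r\<^sub>0"
    and 1: "\<sigma> (cell_kind 1 (contents (f ?y) 1)) (T x) (r\<^sub>0 + 1)"
    using final[of r\<^sub>0] final[of "r\<^sub>0 + 1"] r\<^sub>0 by simp_all
  have no_False: "\<not> \<sigma> (cell_kind 1 1) (T x) r" if "1 \<le> r" "r \<le> R x" for r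
  proof -
    have r: "r - 1 < R x" "r - 1 + 1 = r" using that by auto
    have "clause_sat x \<sigma> 0 (r - 1) no_False_clause" using clauseD[of no_False_clause 0 "r - 1"] r R_pos[of x] by blast
    then show ?thesis unfolding no_False_clause_sat[OF R_pos[of x] r(1)] r(2) .
  qed
  have single: "\<not> (\<sigma> (cell_kind 1 2) (T x) r\<^sub>0 \<and> \<sigma> (cell_kind 1 2) (T x) (r\<^sub>0 + 1))"
  proof -
    have r: "r\<^sub>0 - 1 < R x" "r\<^sub>0 - 1 + 1 = r\<^sub>0" "r\<^sub>0 - 1 + 2 = r\<^sub>0 + 1" using r\<^sub>0 by auto
    have "clause_sat x \<sigma> 0 (r\<^sub>0 - 1) single_clause" using clauseD[of single_clause 0 "r\<^sub>0 - 1"] r(1) R_pos[of x] by blast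
    then show ?thesis unfolding single_clause_sat[OF R_pos[of x] r(1)] r(2,3) .
  qed
  have "f ?y \<noteq> []"
  proof
    assume empty: "f ?y = []"
    have "clause_sat x \<sigma> 0 0 nonempty_clause" using clauseD[of nonempty_clause 0 0] R_pos[of x] by blast
    then obtain r where r: "?C \<le> r + T x" "r \<le> ?C + T x" "\<not> \<sigma> (cell_kind 1 0) (T x) r"
      unfolding nonempty_clause_sat[OF R_pos[of x] R_pos[of x]] by blast
    have "T x + 1 \<le> r" "r + T x \<le> R x" using r(1,2) bounds(3)[of x] by (simp_all add: R_def)
    moreover have "contents [] = (\<lambda>_. 0)" by (auto simp: contents_def)
    ultimately show False using final[of r] r(3) empty by simp
  qed
  moreover have "f ?y ! 0" if "f ?y \<noteq> []"
    using 0 no_False[of r\<^sub>0] r\<^sub>0 that by (auto simp: contents_def split: if_splits)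
  \<comment> \<open>A longer output without \<open>False\<close> would have \<open>True\<close> in
    the adjacent cells 0 and 1.\<close>
  moreover have "length (f ?y) < 2"
  proof (rule ccontr)
    assume len: "\<not> length (f ?y) < 2"
    have "contents (f ?y) 1 \<noteq> 1" using 1 no_False[of "r\<^sub>0 + 1"] r\<^sub>0 by auto
    moreover have "contents (f ?y) 0 \<noteq> 1" using 0 no_False[of "r\<^sub>0"] r\<^sub>0 by auto
    ultimately have "contents (f ?y) 1 = 2" "contents (f ?y) 0 = 2"
      using len by (auto simp: contents_def split: if_splits)
    then show False using 0 1 single by simp
  qed
  ultimately have "f ?y = [True]" by (cases "f ?y") (auto simp: less_Suc_eq numeral_2_eq_2)
  then show ?thesis using u by blast
qed


section \<open>The clauses as a satisfiability instance\<close>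

text \<open>The terms depend on variables 10 to 13 alone, as they bind 14 themselves. So they keep
  their meaning inside \<open>occurs_expr\<close>, where other variables carry values as
  well.\<close>

lemma clause_properties:
  assumes "c \<in> set clauses" "l \<in> set c"
  shows "fst (snd l) < kinds"
    "tr x (snd (snd l)) \<rho> = tr x (snd (snd l)) (env (\<rho> 10) (\<rho> 11) (\<rho> 12) (\<rho> 13))"
proof -
  have st: "q < kinds" if "q \<le> H" for q using that by (simp add: kinds_def)
  have pos [simp]: "tr x (locates e e') \<rho> \<longleftrightarrow> \<rho> 12 = val x e \<rho> \<and> \<rho> 13 = val x e' \<rho>" for e e' \<rho>
    by (simp add: locates_def)
  have P: "fst (snd l) < kinds \<and> tr x (snd (snd l)) \<rho> = tr x (snd (snd l)) (env (\<rho> 10) (\<rho> 11) (\<rho> 12) (\<rho> 13))"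
    if "q \<le> H" "length ss = K" "set ss \<subseteq> {..<G}" "l \<in> set (premise q ss)" for q ss
  proof -
    have "ss ! k < G" if "k < K" for k
      using \<open>length ss = K\<close> \<open>set ss \<subseteq> {..<G}\<close> that by (metis lessThan_iff nth_mem subsetD)
    then show ?thesis using that st by (auto simp: premise_def cell_kind_less env_def)
  qed
  from assms(1) have "fst (snd l) < kinds \<and>
    tr x (snd (snd l)) \<rho> = tr x (snd (snd l)) (env (\<rho> 10) (\<rho> 11) (\<rho> 12) (\<rho> 13))"
  proof (cases rule: clause_cases)
    case 1: (state q ss)
    then show ?thesis
      using assms(2) P[OF 1(1-3)] transition_ok(1)[OF 1(1-3)]
      by (auto simp: state_clause_def st env_def)
  next
    case 2: (cell q ss k s)
    then show ?thesis
      using assms(2) P[OF 2(1-3)] transition_ok(3)[OF 2(1-3)]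
      by (auto simp: cell_clause_def Let_def env_def cell_kind_less)
  next
    case init
    then show ?thesis using assms(2) small by (auto simp: init_cell_clause_def env_def cell_kind_less)
  next
    case 4: other
    have k: "cell_kind 0 0 < kinds" "cell_kind 0 1 < kinds" "cell_kind 0 2 < kinds"
      "cell_kind 1 0 < kinds" "cell_kind 1 1 < kinds" "cell_kind 1 2 < kinds" "0 < kinds"
      using small st by (auto intro!: cell_kind_less)
    from 4 assms(2) show ?thesis
      by (auto simp: init_state_clause_def input_clause_def blank_clause_def no_False_clause_def
          single_clause_def nonempty_clause_def Let_def env_def k simp del: One_nat_def)
  qed
  then show "fst (snd l) < kinds"
    "tr x (snd (snd l)) \<rho> = tr x (snd (snd l)) (env (\<rho> 10) (\<rho> 11) (\<rho> 12) (\<rho> 13))" by auto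
qed

definition side_expr :: expr where
  "side_expr = Plus R_expr (Const 3)"

definition literal_expr :: "nat \<Rightarrow> literal \<Rightarrow> expr" where
  "literal_expr j l = Conjs [
     Equal (Var 0) (index_expr side_expr side_expr (Const (fst (snd l))) (Var 12) (Var 13)),
     (if fst l then Var 1 else Neg (Var 1)),
     Equal (Var 2) (index_expr R_expr R_expr (Const j) (Var 10) (Var 11)), snd (snd l)]"

definition occurs_expr :: expr where
  "occurs_expr = BEx 10 R_expr (BEx 11 R_expr (BEx 12 side_expr (BEx 13 side_expr (Disjs
     (concat (map (\<lambda>j. map (literal_expr j) (clauses ! j)) [0..<length clauses]))))))"

definition occurs :: "bool list \<Rightarrow> nat \<Rightarrow> bool \<Rightarrow> nat \<Rightarrow> bool" where
  "occurs x X s i \<longleftrightarrow> (\<exists>t<R x. \<exists>r<R x. \<exists>t'<R x + 3. \<exists>r'<R x + 3. \<exists>j<length clauses. \<exists>l\<in>set (clauses ! j).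
     X = index (R x + 3) (R x + 3) (fst (snd l)) t' r' \<and> s = fst l \<and> i = index (R x) (R x) j t r \<and>
     tr x (snd (snd l)) (env t r t' r'))"

lemma tr_occurs_expr: "tr x occurs_expr \<rho> \<longleftrightarrow> occurs x (\<rho> 0) (\<rho> 1 \<noteq> 0) (\<rho> 2)"
proof -
  have side: "val x side_expr \<rho> = R x + 3" for \<rho> by (simp add: side_expr_def)
  have cond: "tr x (snd (snd l)) (\<rho>(10 := t, 11 := r, 12 := t', 13 := r')) \<longleftrightarrow> tr x (snd (snd l)) (env t r t' r')"
    if "j < length clauses" "l \<in> set (clauses ! j)" for j l t r t' r'
    using clause_properties(2)[OF nth_mem[OF that(1)] that(2), of x "\<rho>(10 := t, 11 := r, 12 := t', 13 := r')"]
    by simp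
  have disj: "tr x (Disjs (concat (map (\<lambda>j. map (h j) (g j)) [0..<n]))) \<rho>' \<longleftrightarrow>
      (\<exists>j<n. \<exists>l\<in>set (g j). tr x (h j l) \<rho>')"
    for n \<rho>' and g :: "nat \<Rightarrow> literal list" and h by auto
  have lit: "tr x (literal_expr j l) (\<rho>(10 := t, 11 := r, 12 := t', 13 := r')) \<longleftrightarrow>
     \<rho> 0 = index (R x + 3) (R x + 3) (fst (snd l)) t' r' \<and> (\<rho> 1 \<noteq> 0) = fst l \<and>
     \<rho> 2 = index (R x) (R x) j t r \<and> tr x (snd (snd l)) (env t r t' r')"
    if "j < length clauses" "l \<in> set (clauses ! j)" for j l t r t' r'
    using cond[OF that] by (simp add: literal_expr_def side)
  show ?thesis
    unfolding occurs_expr_def occurs_def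
    by (simp only: tr_BEx disj side val_R_expr lit cong: conj_cong bex_cong)
qed

text \<open>A renumbering: a propositional variable becomes the \<open>index\<close> of its kind,
  time and position, and a clause the \<open>index\<close> of its schema and its parameters
  \<open>t\<close> and \<open>r\<close>.\<close>

lemma satisfiable_iff:
  "satisfiable (kinds * (R x + 3) * (R x + 3)) (length clauses * R x * R x) (occurs x) \<longleftrightarrow> (\<exists>\<sigma>. all_sat x \<sigma>)"
  (is "satisfiable ?V ?m _ \<longleftrightarrow> _")
proof
  let ?N = "R x + 3"
  assume "satisfiable ?V ?m (occurs x)"
  then obtain \<tau> where \<tau>: "\<And>i. i < ?m \<Longrightarrow> \<exists>X<?V. occurs x X (\<tau> X) i" by (auto simp: satisfiable_def)
  have "all_sat x (\<lambda>kd t r. \<tau> (index ?N ?N kd t r))"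
    unfolding all_sat_def
  proof (intro ballI allI impI)
    fix c t r assume c: "c \<in> set clauses" and tr: "t < R x" "r < R x"
    then obtain j where j: "j < length clauses" "c = clauses ! j" by (metis in_set_conv_nth)
    then obtain X where "occurs x X (\<tau> X) (index (R x) (R x) j t r)"
      using \<tau>[OF index_less[OF j(1) tr]] by blast
    then obtain t0 r0 t' r' j' l where *: "t0 < R x" "r0 < R x" "t' < ?N" "r' < ?N" "l \<in> set (clauses ! j')"
      "X = index ?N ?N (fst (snd l)) t' r'" "\<tau> X = fst l" "index (R x) (R x) j t r = index (R x) (R x) j' t0 r0"
      "tr x (snd (snd l)) (env t0 r0 t' r')"
      unfolding occurs_def by blast
    have "j = j'" "t = t0" "r = r0" using index_inject[OF *(8) tr(1) *(1) tr(2) *(2)] by auto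
    then show "clause_sat x (\<lambda>kd t r. \<tau> (index ?N ?N kd t r)) t r c"
      unfolding clause_sat_def lit_sat_def j(2) using * by blast
  qed
  then show "\<exists>\<sigma>. all_sat x \<sigma>" by blast
next
  let ?N = "R x + 3"
  assume "\<exists>\<sigma>. all_sat x \<sigma>"
  then obtain \<sigma> where \<sigma>: "all_sat x \<sigma>" by blast
  define \<tau> where "\<tau> X = \<sigma> (X div ?N div ?N) (X div ?N mod ?N) (X mod ?N)" for X
  have dec: "a div B mod B < B \<and> a mod B < B \<and> index B B (a div B div B) (a div B mod B) (a mod B) = a"
    if "0 < B" for a B :: nat
    using that by (simp add: index_def)
  have \<tau>: "\<tau> (index ?N ?N kd t' r') = \<sigma> kd t' r'" if "t' < ?N" "r' < ?N" for kd t' r'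
  proof -
    let ?a = "index ?N ?N kd t' r'"
    have d: "?a div ?N mod ?N < ?N" "?a mod ?N < ?N"
      "index ?N ?N (?a div ?N div ?N) (?a div ?N mod ?N) (?a mod ?N) = ?a"
      using dec[of ?N ?a] by auto
    show ?thesis using index_inject[OF d(3) d(1) that(1) d(2) that(2)] unfolding \<tau>_def by simp
  qed
  have "\<exists>X<?V. occurs x X (\<tau> X) i" if i: "i < ?m" for i
  proof -
      define j where "j = i div R x div R x"
    define t where "t = i div R x mod R x"
    define r where "r = i mod R x"
    have d: "t < R x" "r < R x" "index (R x) (R x) j t r = i" using dec[OF R_pos[of x]] by (auto simp: j_def t_def r_def)
    have j: "j < length clauses"
      unfolding j_def using i by (simp add: less_mult_imp_div_less)
    have "clause_sat x \<sigma> t r (clauses ! j)" using all_satD[OF \<sigma> nth_mem[OF j] d(1,2)] .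
    then obtain l t' r' where l: "l \<in> set (clauses ! j)" "t' < ?N" "r' < ?N"
      "tr x (snd (snd l)) (env t r t' r')" "\<sigma> (fst (snd l)) t' r' = fst l"
      unfolding clause_sat_def lit_sat_def by blast
    let ?X = "index ?N ?N (fst (snd l)) t' r'"
    have "?X < ?V" using clause_properties(1)[OF nth_mem[OF j] l(1)] l(2,3) by (rule index_less)
    moreover have "\<tau> ?X = fst l" using \<tau>[OF l(2,3)] l(5) by simp
    then have "occurs x ?X (\<tau> ?X) i" unfolding occurs_def using d j l by blast
    ultimately show ?thesis by blast
  qed
  then show "satisfiable ?V ?m (occurs x)" unfolding satisfiable_def by blast
qed

lemma poly_reducible_trees:
  assumes L: "\<And>x. x \<in> L \<longleftrightarrow> (\<exists>u. length u \<le> poly p (length x) \<and> f (pair x u) = [True])" and k: "4 \<le> k"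
  shows "poly_reducible L (internally_disjoint_trees_problem k)"
proof (rule poly_reducible_satisfiable[OF k])
  show "val x (Times (Times (Const kinds) side_expr) side_expr) \<rho> = kinds * (R x + 3) * (R x + 3)" for x \<rho>
    by (simp add: side_expr_def)
  show "0 < kinds * (R x + 3) * (R x + 3)" for x by (simp add: kinds_def)
  show "val x (Times (Times (Const (length clauses)) R_expr) R_expr) \<rho> = length clauses * R x * R x" for x \<rho>
    by simp
  show "0 < length clauses * R x * R x" for x using R_pos[of x] by (simp add: clauses_def)
  show "tr x occurs_expr \<rho> \<longleftrightarrow> occurs x (\<rho> 0) (\<rho> 1 \<noteq> 0) (\<rho> 2)" for x \<rho> by (rule tr_occurs_expr)
  show "x \<in> L \<longleftrightarrow> satisfiable (kinds * (R x + 3) * (R x + 3)) (length clauses * R x * R x) (occurs x)" for x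
    unfolding satisfiable_iff L using all_sat_if_accepts accepts_if_all_sat by blast
qed

end

theorem theorem1:
  fixes k\<^sub>1 :: nat
  assumes "4 \<le> k\<^sub>1"
  shows "NP_complete (internally_disjoint_trees_problem k\<^sub>1)"
proof -
  have "poly_reducible L (internally_disjoint_trees_problem k\<^sub>1)" if NP: "L \<in> NP" for L
  proof -
    obtain f p where f: "polytime f"
      and L: "\<And>x. x \<in> L \<longleftrightarrow> (\<exists>u. length u \<le> poly p (length x) \<and> f (pair x u) = [True])"
      using NP unfolding NP_def by blast
    obtain M b where "turing_machine M" "computes_within M f (poly b)" using f unfolding polytime_def by blast
    then interpret cook_levin M f p b by unfold_locales
    show ?thesis using L assms by (rule poly_reducible_trees)
  qed
  moreover have "internally_disjoint_trees_problem k\<^sub>1 \<in> NP"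
    using assms by (intro internally_disjoint_trees_problem_in_NP) simp
  ultimately show ?thesis unfolding NP_complete_def NP_hard_def by blast
qed

end
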